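(* Let $\Omega$ be a domain in $\mathbb{C}^n$, let $p\in\partial\Omega$ be a $\mathbb{C}$-strictly convexifiable boundary point, and assume that $\partial\Omega$ is Dini-smooth near $p$. Then for any neighbourhood $U$ of $p$ we have $$\lim_{z,w\to p}\frac{k_{\Omega\cap U}(z,w)}{k_\Omega(z,w)}=1\qquad\text{and}\qquad \lim_{z,w\to p}\left(k_{\Omega\cap U}(z,w)-k_\Omega(z,w)\right)=0,$$ where the limits are taken over pairs $z,w$ of points lying in the same connected component of $\Omega\cap U$ (with $z\neq w$ in the first limit).
   Context: A domain is a non-empty connected open set; $\Delta\subset\mathbb{C}$ is the unit disc and $\mathcal{O}(\Delta,\Omega)$ is the set of holomorphic maps $\Delta\to\Omega$. The Lempert function of a domain $\Omega$ is $l_\Omega(z,w):=\tanh^{-1}\tilde l_\Omega(z,w)$, where $\tilde l_\Omega(z,w):=\inf\{|\alpha|:\alpha\in\Delta,\ \exists\varphi\in\mathcal{O}(\Delta,\Omega)\text{ with }\varphi(0)=z,\ \varphi(\alpha)=w\}$. The Kobayashi distance $k_\Omega$ is the largest pseudodistance on $\Omega$ not exceeding $l_\Omega$. If $\Omega\cap U$ is not connected and $z,w$ lie in the same connected component $D$ of $\Omega\cap U$, then $k_{\Omega\cap U}(z,w)$ means $k_D(z,w)$. A boundary point $p$ of a convex domain $G\subset\mathbb{C}^n$ is a $\mathbb{C}$-strictly convex boundary point if $\partial G\cap T^{\mathbb{C}}_p\partial G=\{p\}$, where $T^{\mathbb{C}}_p\partial G$ is the (affine) complex tangent space to $\partial G$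 through $p$. For a general domain $\Omega$, a point $p\in\partial\Omega$ is a $\mathbb{C}$-strictly convexifiable boundary point if there exist a neighbourhood $U$ of $p$ and a holomorphic embedding $\Psi:U\to\mathbb{C}^n$ such that $\Psi(\Omega\cap U)$ is a convex domain and $\Psi(p)$ is a $\mathbb{C}$-strictly convex boundary point of it. $\partial\Omega$ is Dini-smooth near $p$ if near $p$ it is a $\mathcal{C}^1$-smooth hypersurface (with $\Omega$ locally on one side) whose unit normal vector field is Dini-continuous, i.e. has modulus of continuity $\omega$ with $\int_0^1\frac{\omega(t)}{t}\,dt<\infty$ (a condition stronger than $\mathcal{C}^1$ and weaker than $\mathcal{C}^{1,\epsilon}$ smoothness). *)

theory Defs
  imports "HOL-Complex_Analysis.Complex_Analysis"
begin

definition domain_set :: "'a::topological_space set \<Rightarrow> bool" where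
  "domain_set S \<longleftrightarrow> open S \<and> connected S \<and> S \<noteq> {}"

definition analytic_disc :: "(complex^'n) set \<Rightarrow> (complex \<Rightarrow> complex^'n) \<Rightarrow> bool" where
  "analytic_disc \<Omega> \<phi> \<longleftrightarrow>
     (\<forall>i. (\<lambda>\<zeta>. \<phi> \<zeta> $ i) holomorphic_on ball 0 1) \<and> \<phi> ` ball 0 1 \<subseteq> \<Omega>"

text \<open>The infimum is over a non-empty subset of \<open>[0,1)\<close> when \<open>\<Omega>\<close> is a domain containing
  \<open>z\<close> and \<open>w\<close>, since any two points of a domain lie on a common analytic disc; the
  unspecified value of the infimum of the empty set is thus never used.\<close>

definition lempert_tilde :: "(complex^'n) set \<Rightarrow> complex^'n \<Rightarrow> complex^'n \<Rightarrow> real" where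
  "lempert_tilde \<Omega> z w =
     Inf {cmod \<alpha> | \<alpha>. \<alpha> \<in> ball 0 1 \<and> (\<exists>\<phi>. analytic_disc \<Omega> \<phi> \<and> \<phi> 0 = z \<and> \<phi> \<alpha> = w)}"

definition lempert :: "(complex^'n) set \<Rightarrow> complex^'n \<Rightarrow> complex^'n \<Rightarrow> real" where
  "lempert \<Omega> z w = artanh (lempert_tilde \<Omega> z w)"

definition pseudodistance_on :: "'a set \<Rightarrow> ('a \<Rightarrow> 'a \<Rightarrow> real) \<Rightarrow> bool" where
  "pseudodistance_on S d \<longleftrightarrow>
     (\<forall>x\<in>S. d x x = 0) \<and> (\<forall>x\<in>S. \<forall>y\<in>S. 0 \<le> d x y \<and> d x y = d y x) \<and>
     (\<forall>x\<in>S. \<forall>y\<in>S. \<forall>z\<in>S. d x z \<le> d x y + d y z)"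

definition kobayashi_candidate :: "(complex^'n) set \<Rightarrow> (complex^'n \<Rightarrow> complex^'n \<Rightarrow> real) \<Rightarrow> bool" where
  "kobayashi_candidate \<Omega> d \<longleftrightarrow>
     pseudodistance_on \<Omega> d \<and> (\<forall>x\<in>\<Omega>. \<forall>y\<in>\<Omega>. d x y \<le> lempert \<Omega> x y)"

text \<open>The largest pseudodistance below the Lempert function is the pointwise supremum of all
  of them; see the lemma that follows.\<close>

definition kobayashi :: "(complex^'n) set \<Rightarrow> complex^'n \<Rightarrow> complex^'n \<Rightarrow> real" where
  "kobayashi \<Omega> z w = (SUP d\<in>{d. kobayashi_candidate \<Omega> d}. d z w)"

lemma kobayashi_greatest:
  fixes \<Omega> :: "(complex^'n) set"
  assumes nonneg: "\<And>x y. x \<in> \<Omega> \<Longrightarrow> y \<in> \<Omega> \<Longrightarrow> 0 \<le> lempert \<Omega> x y"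
  shows "kobayashi_candidate \<Omega> (kobayashi \<Omega>)"
    and "\<And>d x y. kobayashi_candidate \<Omega> d \<Longrightarrow> x \<in> \<Omega> \<Longrightarrow> y \<in> \<Omega> \<Longrightarrow> d x y \<le> kobayashi \<Omega> x y"
proof -
  let ?C = "{d. kobayashi_candidate \<Omega> d}"
  have zero: "(\<lambda>_ _. 0) \<in> ?C"
    using nonneg by (simp add: kobayashi_candidate_def pseudodistance_on_def)
  have bdd: "bdd_above ((\<lambda>d. d x y) ` ?C)" if "x \<in> \<Omega>" "y \<in> \<Omega>" for x y
    by (rule bdd_aboveI[of _ "lempert \<Omega> x y"]) (use that in \<open>auto simp: kobayashi_candidate_def\<close>)
  show upper: "d x y \<le> kobayashi \<Omega> x y"
    if "kobayashi_candidate \<Omega> d" "x \<in> \<Omega>" "y \<in> \<Omega>" for d x y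
    unfolding kobayashi_def using that bdd by (intro cSUP_upper) auto
  have least: "kobayashi \<Omega> x y \<le> b" if "\<And>d. kobayashi_candidate \<Omega> d \<Longrightarrow> d x y \<le> b" for x y b
    unfolding kobayashi_def using that zero by (intro cSUP_least) auto
  have ge0: "0 \<le> kobayashi \<Omega> x y" if "x \<in> \<Omega>" "y \<in> \<Omega>" for x y
    using upper[of "\<lambda>_ _. 0" x y] zero that by simp
  have refl: "kobayashi \<Omega> x x = 0" if "x \<in> \<Omega>" for x
    using least[of x x 0] ge0[of x x] that
    by (force simp: kobayashi_candidate_def pseudodistance_on_def)
  have sym_le: "kobayashi \<Omega> x y \<le> kobayashi \<Omega> y x" if "x \<in> \<Omega>" "y \<in> \<Omega>" for x y
  proof (rule least)
    fix d assume d: "kobayashi_candidate \<Omega> d"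
    then have "d x y = d y x"
      using that by (simp add: kobayashi_candidate_def pseudodistance_on_def)
    with upper[OF d that(2,1)] show "d x y \<le> kobayashi \<Omega> y x" by simp
  qed
  have tri: "kobayashi \<Omega> x z \<le> kobayashi \<Omega> x y + kobayashi \<Omega> y z"
    if "x \<in> \<Omega>" "y \<in> \<Omega>" "z \<in> \<Omega>" for x y z
  proof (rule least)
    fix d assume d: "kobayashi_candidate \<Omega> d"
    then have "d x z \<le> d x y + d y z"
      using that by (simp add: kobayashi_candidate_def pseudodistance_on_def)
    with upper[OF d that(1,2)] upper[OF d that(2,3)]
    show "d x z \<le> kobayashi \<Omega> x y + kobayashi \<Omega> y z" by linarith
  qed
  have le: "kobayashi \<Omega> x y \<le> lempert \<Omega> x y" if "x \<in> \<Omega>" "y \<in> \<Omega>" for x y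
    by (rule least) (use that in \<open>simp add: kobayashi_candidate_def\<close>)
  show "kobayashi_candidate \<Omega> (kobayashi \<Omega>)"
    unfolding kobayashi_candidate_def pseudodistance_on_def
    using refl ge0 tri le sym_le by (auto intro: antisym)
qed

text \<open>Injective immersion and homeomorphism onto the image; in equal dimensions the image of an
  open set is open and \<open>\<Psi>\<close> is biholomorphic onto it.\<close>

definition holomorphic_embedding :: "(complex^'n) set \<Rightarrow> (complex^'n \<Rightarrow> complex^'n) \<Rightarrow> bool" where
  "holomorphic_embedding U \<Psi> \<longleftrightarrow>
     (\<forall>z\<in>U. \<exists>D. (\<Psi> has_derivative D) (at z) \<and> (\<forall>c v. D (c *s v) = c *s D v) \<and> inj D) \<and>
     (\<exists>\<Phi>. homeomorphism U (\<Psi> ` U) \<Psi> \<Phi>)"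

text \<open>\<open>r\<close> is a \<open>C\<^sup>1\<close> defining function of \<open>\<Omega>\<close> on the open set \<open>V\<close>, with gradient \<open>g\<close> taken for
  the real inner product of \<open>complex^'n\<close>.\<close>

definition local_defining_function ::
    "(complex^'n) set \<Rightarrow> (complex^'n) set \<Rightarrow> (complex^'n \<Rightarrow> real) \<Rightarrow> (complex^'n \<Rightarrow> complex^'n) \<Rightarrow> bool" where
  "local_defining_function \<Omega> V r g \<longleftrightarrow>
     open V \<and> (\<forall>x\<in>V. GDERIV r x :> g x) \<and> continuous_on V g \<and> (\<forall>x\<in>V. g x \<noteq> 0) \<and>
     \<Omega> \<inter> V = {x\<in>V. r x < 0} \<and> frontier \<Omega> \<inter> V = {x\<in>V. r x = 0}"

text \<open>The kernel of the differential of a defining function at \<open>p\<close> does not depend on the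
  defining function. The set below is empty if the boundary is not \<open>C\<^sup>1\<close> near \<open>p\<close>.\<close>

definition real_tangent_vectors :: "(complex^'n) set \<Rightarrow> complex^'n \<Rightarrow> (complex^'n) set" where
  "real_tangent_vectors G p =
     {v. \<exists>V r g. p \<in> V \<and> p \<in> frontier G \<and> local_defining_function G V r g \<and> inner (g p) v = 0}"

definition complex_tangent_space :: "(complex^'n) set \<Rightarrow> complex^'n \<Rightarrow> (complex^'n) set" where
  "complex_tangent_space G p =
     {p + v | v. v \<in> real_tangent_vectors G p \<and> \<i> *s v \<in> real_tangent_vectors G p}"

definition C_strictly_convex_point :: "(complex^'n) set \<Rightarrow> complex^'n \<Rightarrow> bool" where
  "C_strictly_convex_point G p \<longleftrightarrow>
     p \<in> frontier G \<and> frontier G \<inter> complex_tangent_space G p = {p}"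

definition C_strictly_convexifiable_point :: "(complex^'n) set \<Rightarrow> complex^'n \<Rightarrow> bool" where
  "C_strictly_convexifiable_point \<Omega> p \<longleftrightarrow>
     p \<in> frontier \<Omega> \<and>
     (\<exists>U \<Psi>. open U \<and> p \<in> U \<and> holomorphic_embedding U \<Psi> \<and>
        domain_set (\<Psi> ` (\<Omega> \<inter> U)) \<and> convex (\<Psi> ` (\<Omega> \<inter> U)) \<and>
        C_strictly_convex_point (\<Psi> ` (\<Omega> \<inter> U)) (\<Psi> p))"

definition modulus_of_continuity ::
    "'a::metric_space set \<Rightarrow> ('a \<Rightarrow> 'b::metric_space) \<Rightarrow> real \<Rightarrow> ennreal" where
  "modulus_of_continuity S f t =
     (SUP (x, y)\<in>{(x, y). x \<in> S \<and> y \<in> S \<and> dist x y \<le> t}. ennreal (dist (f x) (f y)))"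

definition dini_continuous_on ::
    "'a::metric_space set \<Rightarrow> ('a \<Rightarrow> 'b::metric_space) \<Rightarrow> bool" where
  "dini_continuous_on S f \<longleftrightarrow>
     (\<integral>\<^sup>+t\<in>{0<..1}. (modulus_of_continuity S f t / ennreal t) \<partial>lborel) < \<infinity>"

text \<open>The unit normal field at a boundary point \<open>x\<close> is the normalised gradient \<open>sgn (g x)\<close>.\<close>

definition dini_smooth_near :: "(complex^'n) set \<Rightarrow> complex^'n \<Rightarrow> bool" where
  "dini_smooth_near \<Omega> p \<longleftrightarrow>
     (\<exists>V r g. p \<in> V \<and> local_defining_function \<Omega> V r g \<and>
        dini_continuous_on (frontier \<Omega> \<inter> V) (\<lambda>x. sgn (g x)))"

text \<open>For possibly disconnected \<open>A\<close> and points \<open>z\<close>, \<open>w\<close> of the same component of \<open>A\<close>.\<close>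

definition kobayashi_comp :: "(complex^'n) set \<Rightarrow> complex^'n \<Rightarrow> complex^'n \<Rightarrow> real" where
  "kobayashi_comp A z w = kobayashi (connected_component_set A z) z w"

end

theory Submission
  imports Defs
begin

text \<open>The Kobayashi distance is the infimum of the lengths of chains of analytic discs, and the discs
  of a chain may be taken arbitrarily short. Near \<open>p\<close> the supporting complex hyperplanes of the convex
  model give, for each boundary point \<open>q\<close> near \<open>p\<close>, a holomorphic function \<open>H q\<close> into the left
  half-plane that vanishes at \<open>q\<close> and, by \<open>\<complex>\<close>-strict convexity, stays away from \<open>0\<close> far from \<open>p\<close>.
  Harmonic measure then shows that a disc in \<open>\<Omega>\<close> centred at \<open>a\<close> stays near \<open>p\<close> on the disc of radius
  \<open>1 - O(\<delta> a)\<close>, where \<open>\<delta>\<close> is the distance to the boundary. So replacing \<open>\<Omega>\<close> by \<open>\<Omega> \<inter> U\<close> multiplies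
  the length of a short step of a chain at \<open>a\<close> by at most \<open>1 + O(\<delta> a)\<close>.

  The same functions give \<open>k z x \<ge> ln (1 / \<delta> z) / 2 - C\<close> for \<open>x\<close> far from \<open>p\<close>, while Dini smoothness
  provides discs that give \<open>k z w \<le> ln (1 / \<delta> z) / 2 + ln (1 / \<delta> w) / 2 - M\<close> with \<open>M\<close> arbitrarily large as
  \<open>z\<close> and \<open>w\<close> tend to \<open>p\<close>. Hence nearly minimal chains from \<open>z\<close> to \<open>w\<close> stay near \<open>p\<close>, and along them \<open>\<delta>\<close>
  decays exponentially in the length parameter measured from its maximum, so the factors \<open>1 + O(\<delta> a)\<close> cost
  only \<open>o(1)\<close> in total.\<close>


subsection \<open>The Hermitian product and analytic curves\<close>

text \<open>The Kobayashi distance is given only as a largest pseudodistance, so chains of short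
  discs play the role of nearly geodesic curves, and sums over a chain that of integrals of an
  infinitesimal metric. Shortness matters because localization replaces \<open>t\<close> by
  \<open>t / (1 - x)\<close>, which changes \<open>artanh t\<close> by a factor close to
  \<open>1\<close> only while both \<open>t\<close> and \<open>x\<close> are small. For the ratio it
  suffices that \<open>x\<close> is uniformly small on the chain. The difference is harder:
  \<open>kobayashi \<Omega> z w\<close> can be arbitrarily large for \<open>z\<close> and
  \<open>w\<close> near \<open>p\<close>, so a uniform factor leaves an unbounded error. The losses
  have to be summed, and the loss at \<open>a\<close> has to be proportional to the boundary
  distance of \<open>a\<close> itself. Therefore every step is localized with the function
  \<open>H q\<close> of the boundary point \<open>q\<close> nearest to its own centre, and all
  constants are uniform in \<open>q\<close>. Since \<open>\<Omega>\<close> may be unbounded, even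
  the positivity of \<open>kobayashi \<Omega> z w\<close> for distinct points near \<open>p\<close>
  is a consequence of the localization.\<close>

definition cdot :: "complex^'n \<Rightarrow> complex^'n \<Rightarrow> complex" where
  "cdot \<mu> v = (\<Sum>i\<in>UNIV. cnj (\<mu> $ i) * v $ i)"

text \<open>Conjugating the first argument makes \<open>cdot \<mu>\<close> complex linear in the
  second, with a real supporting functional as its real part. For a real normal \<open>\<mu>\<close>
  its kernel is the complex hyperplane inside the real one.\<close>

lemma Re_cdot: "Re (cdot \<mu> v) = inner \<mu> v"
  by (simp add: cdot_def inner_vec_def inner_complex_def)

lemma cdot_vector_scalar_mult: "cdot \<mu> (c *s v) = c * cdot \<mu> v"
  by (simp add: cdot_def sum_distrib_left algebra_simps)

lemma cdot_self: "cdot v v = of_real ((norm v)\<^sup>2)"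
  unfolding cdot_def norm_vec_def L2_set_def
  by (simp add: sum_nonneg complex_norm_square mult.commute del: of_real_power)

lemma norm_cdot_le: "cmod (cdot \<mu> v) \<le> norm \<mu> * norm v"
proof -
  have "cmod (cdot \<mu> v) \<le> (\<Sum>i\<in>UNIV. cmod (\<mu> $ i) * cmod (v $ i))"
    unfolding cdot_def by (rule order_trans[OF norm_sum]) (simp add: norm_mult)
  also have "\<dots> \<le> L2_set (\<lambda>i. cmod (\<mu> $ i)) UNIV * L2_set (\<lambda>i. cmod (v $ i)) UNIV"
    using L2_set_mult_ineq[of "\<lambda>i. cmod (\<mu> $ i)" "\<lambda>i. cmod (v $ i)" UNIV] by simp
  finally show ?thesis by (simp add: norm_vec_def)
qed

lemma norm_vector_scalar_mult: "norm (c *s v) = cmod c * norm (v :: complex^'n)"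
  by (simp add: norm_vec_def L2_set_def norm_mult power_mult_distrib real_sqrt_mult
      flip: sum_distrib_left)

lemma scaleR_eq_vector_scalar_mult: "c *\<^sub>R v = of_real c *s (v :: complex^'n)"
  by (simp add: vec_eq_iff complex_eq_iff)

lemma continuous_on_holomorphic_components:
  fixes \<phi> :: "complex \<Rightarrow> complex^'n"
  assumes "\<And>i. (\<lambda>\<zeta>. \<phi> \<zeta> $ i) holomorphic_on S"
  shows "continuous_on S \<phi>"
proof -
  have "continuous_on S (\<lambda>\<zeta>. \<chi> i. \<phi> \<zeta> $ i)"
    using assms by (intro continuous_on_vec_lambda holomorphic_on_imp_continuous_on)
  then show ?thesis by simp
qed

lemma has_derivative_vecI:
  fixes \<phi> :: "complex \<Rightarrow> complex^'n"
  assumes "\<And>i. ((\<lambda>\<zeta>. \<phi> \<zeta> $ i) has_field_derivative d $ i) (at \<zeta>)"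
  shows "(\<phi> has_derivative (\<lambda>h. h *s d)) (at \<zeta>)"
  unfolding has_derivative_componentwise_within[of \<phi>]
proof
  fix b :: "complex^'n" assume "b \<in> Basis"
  then obtain i u where b: "b = axis i u" by (auto simp: Basis_vec_def)
  have "((\<lambda>\<zeta>. \<phi> \<zeta> $ i) has_derivative (\<lambda>h. h * d $ i)) (at \<zeta>)"
    using assms[of i] by (simp add: has_field_derivative_def mult_commute_abs)
  then have "((\<lambda>\<zeta>. inner (\<phi> \<zeta> $ i) u) has_derivative (\<lambda>h. inner (h * d $ i) u)) (at \<zeta>)"
    by (rule has_derivative_inner_left)
  then show "((\<lambda>\<zeta>. inner (\<phi> \<zeta>) b) has_derivative (\<lambda>h. inner (h *s d) b)) (at \<zeta>)"
    by (simp add: b inner_axis)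
qed

text \<open>Discs are holomorphic componentwise, whereas an embedding has complex linear Frechet
  derivatives; the chain rule joins the two notions along a curve.\<close>

lemma holomorphic_on_compose_complex_differentiable:
  fixes \<phi> :: "complex \<Rightarrow> complex^'n" and \<Psi> :: "complex^'n \<Rightarrow> complex^'m"
  assumes hol: "\<And>i. (\<lambda>\<zeta>. \<phi> \<zeta> $ i) holomorphic_on S" and S: "open S" and sub: "\<phi> ` S \<subseteq> U"
    and \<Psi>: "\<And>z. z \<in> U \<Longrightarrow> \<exists>D. (\<Psi> has_derivative D) (at z) \<and> (\<forall>c v. D (c *s v) = c *s D v)"
  shows "(\<lambda>\<zeta>. \<Psi> (\<phi> \<zeta>) $ i) holomorphic_on S"
proof -
  have "(\<lambda>\<zeta>. \<Psi> (\<phi> \<zeta>) $ i) field_differentiable at \<zeta>" if \<zeta>: "\<zeta> \<in> S" for \<zeta>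
  proof -
    define d where "d = (\<chi> i. deriv (\<lambda>\<zeta>. \<phi> \<zeta> $ i) \<zeta>)"
    have "(\<phi> has_derivative (\<lambda>h. h *s d)) (at \<zeta>)"
      using holomorphic_derivI[OF hol S \<zeta>] by (intro has_derivative_vecI) (simp add: d_def)
    moreover obtain D where D: "(\<Psi> has_derivative D) (at (\<phi> \<zeta>))" "\<And>c v. D (c *s v) = c *s D v"
      using \<Psi>[of "\<phi> \<zeta>"] \<zeta> sub by blast
    ultimately have "((\<lambda>\<zeta>. \<Psi> (\<phi> \<zeta>)) has_derivative (\<lambda>h. D (h *s d))) (at \<zeta>)"
      by (intro has_derivative_compose[of \<phi> _ _ _ \<Psi>]) auto
    then have "((\<lambda>\<zeta>. \<Psi> (\<phi> \<zeta>) $ i) has_derivative (\<lambda>h. D (h *s d) $ i)) (at \<zeta>)"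
      by (rule bounded_linear.has_derivative[OF bounded_linear_vec_nth])
    then have "((\<lambda>\<zeta>. \<Psi> (\<phi> \<zeta>) $ i) has_field_derivative (D d $ i)) (at \<zeta>)"
      by (simp add: has_field_derivative_def D mult_commute_abs)
    then show ?thesis by (auto simp: field_differentiable_def)
  qed
  then show ?thesis
    by (auto simp: holomorphic_on_def intro: field_differentiable_at_within)
qed

subsection \<open>Analytic discs and chains\<close>

lemma artanh_le_artanh:
  fixes x y :: real
  assumes "0 \<le> x" "x \<le> y" "y < 1"
  shows "artanh x \<le> artanh y"
  using assms by (simp add: artanh_def frac_le)

lemma artanh_nonneg: "0 \<le> x \<Longrightarrow> x < 1 \<Longrightarrow> 0 \<le> artanh (x::real)"
  using artanh_le_artanh[of 0 x] by simp

lemma tanh_artanh: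
  fixes x :: real
  assumes "0 \<le> x" "x < 1"
  shows "tanh (artanh x) = x"
proof -
  have "exp (- 2 * artanh x) = (1 - x) / (1 + x)"
    using assms by (simp add: artanh_def exp_minus)
  then have "tanh (artanh x) = (1 - (1 - x) / (1 + x)) / (1 + (1 - x) / (1 + x))"
    by (simp add: tanh_real_altdef)
  also have "\<dots> = x" using assms by (simp add: field_simps)
  finally show ?thesis .
qed

lemma analytic_disc_compose:
  assumes "analytic_disc X \<phi>" "f holomorphic_on ball 0 1" "f ` ball 0 1 \<subseteq> ball 0 1"
  shows "analytic_disc X (\<lambda>\<zeta>. \<phi> (f \<zeta>))"
  unfolding analytic_disc_def
proof
  show "\<forall>i. (\<lambda>\<zeta>. \<phi> (f \<zeta>) $ i) holomorphic_on ball 0 1"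
  proof
    fix i
    have "(\<lambda>\<zeta>. \<phi> \<zeta> $ i) holomorphic_on ball 0 1"
      using assms(1) by (simp add: analytic_disc_def)
    from holomorphic_on_compose_gen[OF assms(2) this assms(3)]
    show "(\<lambda>\<zeta>. \<phi> (f \<zeta>) $ i) holomorphic_on ball 0 1" by (simp add: o_def)
  qed
  show "(\<lambda>\<zeta>. \<phi> (f \<zeta>)) ` ball 0 1 \<subseteq> X"
    using assms(1,3) by (auto simp: analytic_disc_def)
qed

text \<open>Keeps an actual disc with the modulus \<open>t\<close> of its parameter, instead of an
  infimum, so that a step of a chain can later be shrunk into a neighbourhood of \<open>p\<close>.
  The length of the step is \<open>artanh t\<close>.\<close>

definition disc_step ::
    "(complex^'n) set \<Rightarrow> complex^'n \<Rightarrow> complex^'n \<Rightarrow> real \<Rightarrow> bool" where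
  "disc_step X x y t \<longleftrightarrow>
     (\<exists>\<phi> \<alpha>. analytic_disc X \<phi> \<and> \<phi> 0 = x \<and> \<phi> \<alpha> = y \<and> cmod \<alpha> = t \<and> t < 1)"

lemma disc_step_imp:
  assumes "disc_step X x y t"
  shows "0 \<le> t" "t < 1" "x \<in> X" "y \<in> X"
  using assms by (auto simp: disc_step_def analytic_disc_def image_subset_iff)

lemma disc_step_mono: "disc_step X x y t \<Longrightarrow> X \<subseteq> Y \<Longrightarrow> disc_step Y x y t"
  unfolding disc_step_def analytic_disc_def by (smt (verit) subset_trans)

text \<open>The automorphism of the unit disc taking \<open>0\<close> to \<open>a\<close> recentres
  \<open>\<phi>\<close>; what remains is the pseudohyperbolic distance of \<open>a\<close> and
  \<open>b\<close>.\<close>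

lemma disc_step_between:
  assumes "analytic_disc X \<phi>" "cmod a < 1" "cmod b < 1"
  shows "disc_step X (\<phi> a) (\<phi> b) (cmod ((b - a) / (1 - cnj a * b)))"
proof -
  define m where "m = Moebius_function 0 (-a)"
  define c where "c = Moebius_function 0 a b"
  have c: "cmod c < 1" unfolding c_def using assms by (intro Moebius_function_norm_lt_1)
  have "m ` ball 0 1 \<subseteq> ball 0 1"
    using assms unfolding m_def by (auto intro!: Moebius_function_norm_lt_1)
  moreover have "m holomorphic_on ball 0 1"
    unfolding m_def using assms by (intro Moebius_function_holomorphic) auto
  ultimately have "analytic_disc X (\<lambda>\<zeta>. \<phi> (m \<zeta>))"
    using analytic_disc_compose assms(1) by blast
  moreover have "m 0 = a" by (simp add: m_def Moebius_function_simple)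
  moreover have "m c = b"
    unfolding m_def c_def using assms by (intro Moebius_function_compose) auto
  ultimately show ?thesis
    unfolding disc_step_def using c
    by (intro exI[of _ "\<lambda>\<zeta>. \<phi> (m \<zeta>)"] exI[of _ c]) (auto simp: c_def Moebius_function_simple)
qed

lemma disc_step_sym: "disc_step X x y t \<Longrightarrow> disc_step X y x t"
proof -
  assume "disc_step X x y t"
  then obtain \<phi> \<alpha> where *: "analytic_disc X \<phi>" "\<phi> 0 = x" "\<phi> \<alpha> = y" "cmod \<alpha> = t" "t < 1"
    by (auto simp: disc_step_def)
  show ?thesis
    using disc_step_between[OF *(1), of \<alpha> 0] * by simp
qed

text \<open>The lengths \<open>artanh t\<close> add up to the real argument, while
  \<open>\<eta>\<close> bounds the moduli \<open>t\<close> themselves; this forces a chain to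
  consist of short discs.\<close>

inductive reach ::
    "(complex^'n) set \<Rightarrow> real \<Rightarrow> complex^'n \<Rightarrow> real \<Rightarrow> complex^'n \<Rightarrow> bool" for X \<eta> where
  reach_refl: "x \<in> X \<Longrightarrow> reach X \<eta> x 0 x"
| reach_step: "reach X \<eta> x L y \<Longrightarrow> disc_step X y z t \<Longrightarrow> t \<le> \<eta> \<Longrightarrow> reach X \<eta> x (L + artanh t) z"

lemma reach_trans:
  assumes "reach X \<eta> y M z" "reach X \<eta> x L y"
  shows "reach X \<eta> x (L + M) z"
  using assms
proof induction
  case (reach_refl y)
  then show ?case by simp
next
  case (reach_step y M z w t)
  then show ?case
    using reach.reach_step[of X \<eta> x "L + M" z w t] by (simp add: add.assoc)
qed

lemma reach_sym: "reach X \<eta> x L y \<Longrightarrow> reach X \<eta> y L x"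
proof (induction rule: reach.induct)
  case (reach_refl x)
  then show ?case by (rule reach.reach_refl)
next
  case (reach_step x L y z t)
  have "reach X \<eta> z (0 + artanh t) y"
    using reach.reach_step[OF reach.reach_refl[OF disc_step_imp(4)[OF reach_step.hyps(2)]]
        disc_step_sym[OF reach_step.hyps(2)] reach_step.hyps(3)] .
  from reach_trans[OF reach_step.IH this] show ?case by (simp add: add.commute)
qed

lemma reach_imp:
  assumes "reach X \<eta> x L y"
  shows "0 \<le> L" "x \<in> X" "y \<in> X"
proof -
  from assms have "0 \<le> L \<and> x \<in> X \<and> y \<in> X"
    by induction (auto dest: disc_step_imp intro!: add_nonneg_nonneg artanh_nonneg)
  then show "0 \<le> L" "x \<in> X" "y \<in> X" by auto
qed

text \<open>Hyperbolic length is additive along the radius from \<open>0\<close> to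
  \<open>\<alpha>\<close>, so cutting it into \<open>N\<close> pieces of equal length
  \<open>s\<close> costs nothing, and \<open>tanh s\<close> falls below \<open>\<eta>\<close> for
  large \<open>N\<close>.\<close>

lemma reach_analytic_disc:
  assumes \<phi>: "analytic_disc X \<phi>" and \<alpha>: "cmod \<alpha> < 1" and \<eta>: "0 < \<eta>"
  shows "reach X \<eta> (\<phi> 0) (artanh (cmod \<alpha>)) (\<phi> \<alpha>)"
proof -
  define \<tau> where "\<tau> = artanh (cmod \<alpha>)"
  have \<tau>: "\<tau> \<ge> 0" "tanh \<tau> = cmod \<alpha>"
    using \<alpha> by (auto simp: \<tau>_def intro: artanh_nonneg tanh_artanh)
  define u where "u = sgn \<alpha>"
  have \<alpha>u: "\<alpha> = of_real (cmod \<alpha>) * u" by (simp add: u_def sgn_eq)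
  have u: "cmod u \<le> 1" by (simp add: u_def norm_sgn)
  have "(\<lambda>N. tanh (\<tau> / real N)) \<longlonglongrightarrow> tanh 0"
    by (intro tendsto_intros lim_const_over_n) auto
  then have "\<forall>\<^sub>F N in sequentially. tanh (\<tau> / real N) < \<eta>"
    using \<eta> by (auto dest: order_tendstoD)
  then obtain N where N: "N > 0" "tanh (\<tau> / real N) < \<eta>"
    by (metis (no_types, lifting) eventually_sequentially gt_ex less_imp_le_nat order_le_less_trans zero_le)
  define s where "s = \<tau> / real N"
  have s: "s \<ge> 0" "tanh s < \<eta>" using \<tau> N by (auto simp: s_def)
  define b where "b k = of_real (tanh (real k * s)) * u" for k
  \<comment> \<open>\<open>sgn 0 = 0\<close>, so \<open>u\<close> is a unit vector only if
    \<open>\<alpha> \<noteq> 0\<close>; for \<open>\<alpha> = 0\<close> the empty chain is used at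
    the end.\<close>
  have nu: "cmod u = 1 \<or> \<alpha> = 0" by (simp add: u_def norm_sgn)
  have "reach X \<eta> (\<phi> 0) (real k * s) (\<phi> (b k))" if "\<alpha> \<noteq> 0" for k
  proof (induction k)
    case 0
    have "\<phi> 0 \<in> X" using \<phi> by (auto simp: analytic_disc_def)
    then show ?case by (simp add: b_def reach_refl)
  next
    case (Suc k)
    have nu1: "cmod u = 1" using nu that by simp
    then have uu: "cnj u * u = 1"
      by (metis complex_norm_square mult.commute of_real_1 one_power2)
    have b1: "cmod (b j) < 1" for j
      using nu1 tanh_real_bounds[of "real j * s"] by (simp add: b_def norm_mult abs_less_iff)
    define x y where "x = tanh (real k * s)" and "y = tanh (real (Suc k) * s)"
    have "(b (Suc k) - b k) / (1 - cnj (b k) * b (Suc k)) = of_real ((y - x) / (1 - x * y)) * u"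
      using uu by (simp add: b_def x_def y_def algebra_simps)
    moreover have "(y - x) / (1 - x * y) = tanh s"
      using tanh_add[of "real (Suc k) * s" "- (real k * s)"]
      by (simp add: x_def y_def algebra_simps)
    ultimately have "cmod ((b (Suc k) - b k) / (1 - cnj (b k) * b (Suc k))) = tanh s"
      using nu1 s by (simp add: norm_mult)
    with disc_step_between[OF \<phi> b1 b1, of k "Suc k"]
    have "disc_step X (\<phi> (b k)) (\<phi> (b (Suc k))) (tanh s)" by simp
    from reach_step[OF Suc this] s show ?case
      by (simp add: artanh_tanh_real algebra_simps)
  qed
  moreover have "b N = \<alpha>"
    using \<tau> N by (subst \<alpha>u) (simp add: b_def s_def)
  moreover have "real N * s = \<tau>" using N by (simp add: s_def)
  moreover have "reach X \<eta> (\<phi> 0) \<tau> (\<phi> \<alpha>)" if "\<alpha> = 0"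
  proof -
    have "\<phi> 0 \<in> X" using \<phi> by (auto simp: analytic_disc_def)
    then show ?thesis using that by (auto simp: \<tau>_def intro: reach_refl)
  qed
  ultimately show ?thesis by (metis \<tau>_def)
qed

lemma reach_disc_step:
  assumes "disc_step X x y t" "0 < \<eta>"
  shows "reach X \<eta> x (artanh t) y"
  using assms reach_analytic_disc by (auto simp: disc_step_def)

text \<open>A polynomial path from \<open>x\<close> to \<open>y\<close> extends to a complex polynomial map which is still
  \<open>X\<close>-valued on a convex neighbourhood of \<open>[0, 1]\<close>; the Riemann map turns this into a disc.\<close>

lemma disc_step_exists:
  fixes X :: "(complex^'n) set"
  assumes X: "domain_set X" and xy: "x \<in> X" "y \<in> X"
  obtains t where "disc_step X x y t"
proof -
  obtain g where g: "polynomial_function g" "path_image g \<subseteq> X" "pathstart g = x" "pathfinish g = y"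
    using connected_open_polynomial_connected[of X x y] X xy by (auto simp: domain_set_def)
  have "\<exists>f. f holomorphic_on UNIV \<and> (\<forall>s::real. f (of_real s) = g s $ i)" for i
  proof -
    have "bounded_linear (\<lambda>v. Re (v $ i))" "bounded_linear (\<lambda>v. Im (v $ i))"
      by (intro bounded_linear_compose[OF bounded_linear_Re] bounded_linear_compose[OF bounded_linear_Im]
            bounded_linear_vec_nth)+
    then have "real_polynomial_function (\<lambda>s. Re (g s $ i))" "real_polynomial_function (\<lambda>s. Im (g s $ i))"
      using g(1) by (auto simp: polynomial_function_def o_def)
    then obtain a m b k where ab: "(\<lambda>s. Re (g s $ i)) = (\<lambda>s. \<Sum>j\<le>m. a j * s ^ j)"
        "(\<lambda>s. Im (g s $ i)) = (\<lambda>s. \<Sum>j\<le>k. b j * s ^ j)"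
      unfolding real_polynomial_function_iff_sum by blast
    let ?f = "\<lambda>\<zeta>. (\<Sum>j\<le>m. of_real (a j) * \<zeta> ^ j) + \<i> * (\<Sum>j\<le>k. of_real (b j) * \<zeta> ^ j)"
    have "?f holomorphic_on UNIV" by (intro holomorphic_intros)
    moreover have "?f (of_real s) = g s $ i" for s
    proof -
      have "?f (of_real s) = of_real (\<Sum>j\<le>m. a j * s ^ j) + \<i> * of_real (\<Sum>j\<le>k. b j * s ^ j)"
        by simp
      also have "\<dots> = of_real (Re (g s $ i)) + \<i> * of_real (Im (g s $ i))"
        using fun_cong[OF ab(1), of s] fun_cong[OF ab(2), of s] by simp
      also have "\<dots> = g s $ i" by (rule complex_eq[symmetric])
      finally show ?thesis .
    qed
    ultimately show ?thesis by blast
  qed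
  then obtain f where f: "\<And>i. f i holomorphic_on UNIV" "\<And>i s. f i (of_real s) = g s $ i"
    by metis
  define F where "F \<zeta> = (\<chi> i. f i \<zeta>)" for \<zeta>
  have Fg: "F (of_real s) = g s" for s by (simp add: F_def f vec_eq_iff)
  have "continuous_on UNIV F"
    unfolding F_def using f(1) by (intro continuous_on_vec_lambda holomorphic_on_imp_continuous_on)
  then have "open (F -` X)"
    using X by (simp add: domain_set_def continuous_on_open_vimage)
  let ?I = "closed_segment (0::complex) 1"
  have "?I \<subseteq> F -` X"
  proof
    fix \<zeta> assume "\<zeta> \<in> ?I"
    then obtain s where s: "0 \<le> s" "s \<le> 1" "\<zeta> = of_real s"
      by (auto simp: in_segment scaleR_conv_of_real)
    then have "g s \<in> X" using g(2) by (auto simp: path_image_def)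
    then show "\<zeta> \<in> F -` X" using s Fg by simp
  qed
  with compact_subset_open_imp_cball_epsilon_subset[OF compact_segment \<open>open (F -` X)\<close>]
  obtain e where e: "e > 0" "(\<Union>\<zeta>\<in>?I. cball \<zeta> e) \<subseteq> F -` X" by blast
  define S where "S = (\<Union>\<zeta>\<in>?I. \<Union>v\<in>ball 0 e. {\<zeta> + v})"
  have S1: "open S" "convex S"
    unfolding S_def by (intro open_sums convex_sums; simp)+
  have "S \<subseteq> F -` X"
  proof
    fix \<xi> assume "\<xi> \<in> S"
    then obtain \<zeta> v where "\<zeta> \<in> ?I" "v \<in> ball 0 e" "\<xi> = \<zeta> + v" by (auto simp: S_def)
    then have "\<xi> \<in> (\<Union>\<zeta>\<in>?I. cball \<zeta> e)" by (auto simp: dist_norm intro!: bexI[of _ \<zeta>])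
    then show "\<xi> \<in> F -` X" using e by blast
  qed
  have in_S: "0 \<in> S" "1 \<in> S" using e by (force simp: S_def)+
  have "bounded S"
    unfolding S_def by (intro bounded_sums) (simp_all add: bounded_closed_segment)
  then have "S \<noteq> UNIV" using not_bounded_UNIV by auto
  moreover have "simply_connected S" using S1 convex_imp_simply_connected by blast
  ultimately obtain h k where hk: "k holomorphic_on ball 0 1"
      "\<And>z. z \<in> S \<Longrightarrow> h z \<in> ball 0 1 \<and> k (h z) = z" "\<And>z. z \<in> ball 0 1 \<Longrightarrow> k z \<in> S \<and> h (k z) = z"
    using Riemann_mapping_theorem[of S] S1 in_S by blast
  have "analytic_disc X (\<lambda>\<zeta>. F (k \<zeta>))"
    unfolding analytic_disc_def
  proof
    show "\<forall>i. (\<lambda>\<zeta>. F (k \<zeta>) $ i) holomorphic_on ball 0 1"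
      using holomorphic_on_compose_gen[OF hk(1) f(1)] by (simp add: F_def o_def)
    show "(\<lambda>\<zeta>. F (k \<zeta>)) ` ball 0 1 \<subseteq> X"
      using hk(3) \<open>S \<subseteq> F -` X\<close> by blast
  qed
  from disc_step_between[OF this, of "h 0" "h 1"] hk(2) in_S
  have "disc_step X (F 0) (F 1) (cmod ((h 1 - h 0) / (1 - cnj (h 0) * h 1)))" by simp
  moreover have "F 0 = x" "F 1 = y"
    using Fg[of 0] Fg[of 1] g by (auto simp: pathstart_def pathfinish_def)
  ultimately show ?thesis using that by auto
qed

section \<open>The Lempert function and the Kobayashi distance in terms of disc steps and
  chains\<close>

lemma lempert_tilde_disc_step: "lempert_tilde X x y = Inf {t. disc_step X x y t}"
  unfolding lempert_tilde_def disc_step_def by (rule arg_cong[of _ _ Inf]) auto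

lemma lempert_tilde_bounds:
  assumes "domain_set X" "x \<in> X" "y \<in> X"
  shows "0 \<le> lempert_tilde X x y" "lempert_tilde X x y < 1"
proof -
  obtain t where t: "disc_step X x y t" using disc_step_exists assms by blast
  then show "0 \<le> lempert_tilde X x y"
    unfolding lempert_tilde_disc_step by (intro cInf_greatest) (auto dest: disc_step_imp)
  have "lempert_tilde X x y \<le> t"
    unfolding lempert_tilde_disc_step
    by (rule cInf_lower) (use t disc_step_imp in \<open>auto intro!: bdd_belowI[of _ 0]\<close>)
  then show "lempert_tilde X x y < 1" using disc_step_imp[OF t] by simp
qed

lemma lempert_le_disc_step:
  assumes "disc_step X x y t"
  shows "lempert X x y \<le> artanh t"
proof -
  have "lempert_tilde X x y \<le> t"
    unfolding lempert_tilde_disc_step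
    by (rule cInf_lower) (use assms disc_step_imp in \<open>auto intro!: bdd_belowI[of _ 0]\<close>)
  moreover have "0 \<le> lempert_tilde X x y"
    unfolding lempert_tilde_disc_step
    using assms by (intro cInf_greatest) (auto dest: disc_step_imp)
  ultimately show ?thesis
    unfolding lempert_def using disc_step_imp[OF assms] by (intro artanh_le_artanh) auto
qed

text \<open>\<open>tanh\<close> undoes the \<open>artanh\<close> of \<open>lempert\<close>, so a
  bound for all discs passes to the infimum. That some disc joins the points keeps
  \<open>Inf\<close> off the empty set.\<close>

lemma le_lempert:
  assumes "domain_set X" "x \<in> X" "y \<in> X"
    and "\<And>t. disc_step X x y t \<Longrightarrow> d \<le> artanh t"
  shows "d \<le> lempert X x y"
proof -
  have "tanh d \<le> lempert_tilde X x y"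
    unfolding lempert_tilde_disc_step
  proof (rule cInf_greatest)
    show "{t. disc_step X x y t} \<noteq> {}" using disc_step_exists assms(1-3) by blast
    fix t assume "t \<in> {t. disc_step X x y t}"
    then have t: "disc_step X x y t" by simp
    have "tanh d \<le> tanh (artanh t)" using assms(4)[OF t] by simp
    then show "tanh d \<le> t" using tanh_artanh disc_step_imp[OF t] by simp
  qed
  moreover have "tanh (artanh (lempert_tilde X x y)) = lempert_tilde X x y"
    using lempert_tilde_bounds[OF assms(1-3)] by (intro tanh_artanh)
  ultimately show ?thesis unfolding lempert_def by (metis tanh_real_le_iff)
qed

lemma kobayashi_candidate_kobayashi:
  assumes "domain_set X"
  shows "kobayashi_candidate X (kobayashi X)"
proof (rule kobayashi_greatest)
  fix x y assume "x \<in> X" "y \<in> X"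
  with lempert_tilde_bounds[OF assms this] show "0 \<le> lempert X x y"
    unfolding lempert_def by (intro artanh_nonneg)
qed

lemma kobayashi_upper:
  assumes "domain_set X" "kobayashi_candidate X d" "x \<in> X" "y \<in> X"
  shows "d x y \<le> kobayashi X x y"
proof (rule kobayashi_greatest(2)[OF _ assms(2-4)])
  fix x y assume "x \<in> X" "y \<in> X"
  with lempert_tilde_bounds[OF assms(1) this] show "0 \<le> lempert X x y"
    unfolding lempert_def by (intro artanh_nonneg)
qed

lemma kobayashi_props:
  assumes "domain_set X"
  shows kobayashi_refl: "x \<in> X \<Longrightarrow> kobayashi X x x = 0"
    and kobayashi_nonneg: "x \<in> X \<Longrightarrow> y \<in> X \<Longrightarrow> 0 \<le> kobayashi X x y"
    and kobayashi_sym: "x \<in> X \<Longrightarrow> y \<in> X \<Longrightarrow> kobayashi X x y = kobayashi X y x"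
    and kobayashi_triangle: "x \<in> X \<Longrightarrow> y \<in> X \<Longrightarrow> z \<in> X \<Longrightarrow>
      kobayashi X x z \<le> kobayashi X x y + kobayashi X y z"
    and kobayashi_le_lempert: "x \<in> X \<Longrightarrow> y \<in> X \<Longrightarrow> kobayashi X x y \<le> lempert X x y"
  using kobayashi_candidate_kobayashi[OF assms]
  by (auto simp: kobayashi_candidate_def pseudodistance_on_def)

lemma kobayashi_le_disc_step:
  assumes "domain_set X" "disc_step X x y t"
  shows "kobayashi X x y \<le> artanh t"
  using kobayashi_le_lempert[OF assms(1)] lempert_le_disc_step[OF assms(2)] disc_step_imp[OF assms(2)]
    order_trans by blast

lemma le_kobayashiI:
  assumes X: "domain_set X" and d: "pseudodistance_on X d"
    and le: "\<And>x y t. disc_step X x y t \<Longrightarrow> d x y \<le> artanh t"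
    and xy: "x \<in> X" "y \<in> X"
  shows "d x y \<le> kobayashi X x y"
  using d le le_lempert[OF X] by (intro kobayashi_upper[OF X _ xy]) (auto simp: kobayashi_candidate_def)

text \<open>The infimum of the lengths of chains is itself a pseudodistance, because chains can be
  reversed and concatenated, and it lies below every \<open>artanh t\<close>, because one disc can
  be subdivided. By maximality it is at most the Kobayashi distance.\<close>

lemma reach_near_kobayashi:
  assumes X: "domain_set X" and xy: "x \<in> X" "y \<in> X" and \<eta>: "0 < \<eta>" and \<tau>: "0 < \<tau>"
  obtains L where "reach X \<eta> x L y" "L \<le> kobayashi X x y + \<tau>"
proof -
  define S where "S u v = {L. reach X \<eta> u L v}" for u v
  define d where "d u v = Inf (S u v)" for u v
  have bdd: "bdd_below (S u v)" for u v
    by (rule bdd_belowI[of _ 0]) (auto simp: S_def dest: reach_imp)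
  have ne: "S u v \<noteq> {}" if uv: "u \<in> X" "v \<in> X" for u v
  proof -
    obtain t where "disc_step X u v t" using disc_step_exists[OF X uv] .
    from reach_disc_step[OF this \<eta>] show ?thesis by (auto simp: S_def)
  qed
  have lower: "d u v \<le> L" if "reach X \<eta> u L v" for u v L
    unfolding d_def by (rule cInf_lower) (use that bdd in \<open>auto simp: S_def\<close>)
  have ge0: "0 \<le> d u v" if "u \<in> X" "v \<in> X" for u v
    unfolding d_def by (rule cInf_greatest) (use that ne in \<open>auto simp: S_def dest: reach_imp\<close>)
  have near: "\<exists>L. reach X \<eta> u L v \<and> L < d u v + e" if "u \<in> X" "v \<in> X" "0 < e" for u v e
    using cInf_lessD[of "S u v" "d u v + e"] ne[OF that(1,2)] that(3)
    by (auto simp: S_def d_def)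
  have "pseudodistance_on X d"
    unfolding pseudodistance_on_def
  proof (intro conjI ballI)
    fix u assume u: "u \<in> X"
    show "d u u = 0" using lower[OF reach_refl[OF u]] ge0[OF u u] by simp
  next
    fix u v assume uv: "u \<in> X" "v \<in> X"
    show "0 \<le> d u v" using ge0 uv by simp
    have "S u v = S v u" using reach_sym by (auto simp: S_def)
    then show "d u v = d v u" by (simp add: d_def)
  next
    fix u v w assume uvw: "u \<in> X" "v \<in> X" "w \<in> X"
    show "d u w \<le> d u v + d v w"
    proof (rule field_le_epsilon)
      fix e :: real assume e: "0 < e"
      obtain L M where "reach X \<eta> u L v" "L < d u v + e/2" "reach X \<eta> v M w" "M < d v w + e/2"
        using near[of u v "e/2"] near[of v w "e/2"] uvw e by auto
      then show "d u w \<le> d u v + d v w + e"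
        using lower[OF reach_trans[of X \<eta> v M w u L]] by linarith
    qed
  qed
  moreover have "d u v \<le> artanh t" if "disc_step X u v t" for u v t
    using lower[OF reach_disc_step[OF that \<eta>]] .
  ultimately have "d x y \<le> kobayashi X x y" using le_kobayashiI[OF X _ _ xy] by blast
  then show ?thesis using near[OF xy \<tau>] that by fastforce
qed

subsection \<open>Localization of analytic discs\<close>

text \<open>A maximum principle for functions without boundary values: the discs need not extend to
  the unit circle. A superlevel set above the boundary bound is compact in \<open>S\<close>, so the
  maximum is attained, \<open>f\<close> is constant, and the superlevel set would be all of
  \<open>S\<close>.\<close>

lemma maximum_modulus_eventually:
  assumes hol: "f holomorphic_on S" and S: "open S" "connected S" "bounded S"
    and bd: "\<And>\<xi> e. \<xi> \<in> frontier S \<Longrightarrow> 0 < e \<Longrightarrow> \<forall>\<^sub>F \<zeta> in at \<xi> within S. cmod (f \<zeta>) \<le> M + e"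
    and \<zeta>: "\<zeta> \<in> S"
  shows "cmod (f \<zeta>) \<le> M"
proof (rule ccontr)
  assume "\<not> cmod (f \<zeta>) \<le> M"
  define e where "e = (cmod (f \<zeta>) - M) / 2"
  have e: "e > 0" "M + e < cmod (f \<zeta>)" using \<open>\<not> _\<close> by (auto simp: e_def field_simps)
  \<comment> \<open>The threshold lies strictly between \<open>M + e\<close>, the bound near the
    frontier, and \<open>cmod (f \<zeta>) = M + 2 * e\<close>.\<close>
  define K where "K = {z \<in> S. M + e + e / 2 \<le> cmod (f z)}"
  have \<zeta>K: "\<zeta> \<in> K" using \<zeta> e by (auto simp: K_def e_def field_simps)
  have cont: "continuous_on S f" using hol holomorphic_on_imp_continuous_on by blast
  have "closed K"
    unfolding closed_sequential_limits
  proof (intro allI impI, elim conjE)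
    fix x l assume x: "\<forall>n. x n \<in> K" and l: "x \<longlonglongrightarrow> l"
    have xS: "x n \<in> S" for n using x by (auto simp: K_def)
    show "l \<in> K"
    proof (cases "l \<in> S")
      case True
      then have "(\<lambda>n. cmod (f (x n))) \<longlonglongrightarrow> cmod (f l)"
        using cont l xS by (intro tendsto_norm continuous_on_tendsto_compose[OF cont]) auto
      then have "M + e + e / 2 \<le> cmod (f l)"
        by (rule LIMSEQ_le_const) (use x in \<open>auto simp: K_def\<close>)
      then show ?thesis using True by (simp add: K_def)
    next
      case False
      have "l \<in> closure S" using xS l closure_sequential by blast
      then have "l \<in> frontier S"
        using False S by (simp add: frontier_def interior_open)
      with bd e have ev: "\<forall>\<^sub>F \<zeta> in at l within S. cmod (f \<zeta>) \<le> M + e" by blast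
      have "filterlim x (at l within S) sequentially"
        unfolding filterlim_at using l xS False by (intro conjI always_eventually) auto
      from eventually_compose_filterlim[OF ev this]
      obtain n where "cmod (f (x n)) \<le> M + e"
        by (auto simp: eventually_sequentially)
      moreover have "M + e + e / 2 \<le> cmod (f (x n))" using x by (auto simp: K_def)
      ultimately show ?thesis using e by simp
    qed
  qed
  moreover have "bounded K" using S by (auto simp: K_def intro: bounded_subset)
  ultimately have "compact K" by (simp add: compact_eq_bounded_closed)
  moreover have "K \<subseteq> S" by (auto simp: K_def)
  ultimately obtain z0 where z0: "z0 \<in> K" "\<And>z. z \<in> K \<Longrightarrow> cmod (f z) \<le> cmod (f z0)"
    using continuous_attains_sup[of K "\<lambda>z. cmod (f z)"] \<zeta>K continuous_on_norm[OF continuous_on_subset[OF cont]]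
    by blast
  have max: "cmod (f z) \<le> cmod (f z0)" if "z \<in> S" for z
    using z0 that by (cases "z \<in> K") (force simp: K_def)+
  have "f constant_on S"
    using maximum_modulus_principle[OF hol S(1,2) S(1), of z0] max z0 \<open>K \<subseteq> S\<close> by blast
  then have "K = S" using \<zeta>K unfolding constant_on_def K_def by auto
  then have "S = {} \<or> S = UNIV" using \<open>closed K\<close> S(1) clopen[of S] by simp
  then show False using \<zeta> S(3) not_bounded_UNIV by auto
qed

text \<open>Testing a vector-valued map against its own value reduces this to the scalar case.\<close>

lemma maximum_norm_frontier_vec:
  fixes \<phi> :: "complex \<Rightarrow> complex^'n"
  assumes hol: "\<And>i. (\<lambda>\<zeta>. \<phi> \<zeta> $ i) holomorphic_on T" and T: "closure S \<subseteq> T"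
    and S: "bounded S" and le: "\<And>\<zeta>. \<zeta> \<in> frontier S \<Longrightarrow> norm (\<phi> \<zeta>) \<le> B" and \<xi>: "\<xi> \<in> S"
  shows "norm (\<phi> \<xi>) \<le> B"
proof (cases "\<phi> \<xi> = 0")
  case True
  have "frontier S \<noteq> {}"
    using S \<xi> by (metis empty_iff frontier_not_empty not_bounded_UNIV)
  then obtain \<zeta> where "\<zeta> \<in> frontier S" by auto
  from le[OF this] True show ?thesis by (smt (verit) norm_ge_zero norm_zero)
next
  case False
  define f where "f \<zeta> = cdot (\<phi> \<xi>) (\<phi> \<zeta>)" for \<zeta>
  have f_le: "cmod (f \<zeta>) \<le> norm (\<phi> \<xi>) * norm (\<phi> \<zeta>)" for \<zeta>
    unfolding f_def by (rule norm_cdot_le)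
  have f\<xi>: "cmod (f \<xi>) = (norm (\<phi> \<xi>))\<^sup>2" by (simp add: f_def cdot_self norm_power)
  have holT: "f holomorphic_on T" unfolding f_def cdot_def by (intro holomorphic_intros hol)
  have "cmod (f \<xi>) \<le> norm (\<phi> \<xi>) * B"
  proof (rule maximum_modulus_frontier[of f S])
    show "f holomorphic_on interior S"
      using holT T interior_subset[of S] closure_subset[of S] by (metis holomorphic_on_subset subset_trans)
    show "continuous_on (closure S) f"
      using continuous_on_subset[OF holomorphic_on_imp_continuous_on[OF holT] T] .
    show "cmod (f z) \<le> norm (\<phi> \<xi>) * B" if "z \<in> frontier S" for z
      using order_trans[OF f_le[of z] mult_left_mono[OF le[OF that] norm_ge_zero]] .
  qed (use S \<xi> in auto)
  then show ?thesis using False f\<xi> by (simp add: power2_eq_square)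
qed

text \<open>The distance from \<open>\<phi>\<close> to \<open>p\<close> obeys the maximum principle,
  so it stays below \<open>R\<close> on whatever a loop in \<open>D\<close> encloses. Hence
  \<open>D\<close> has no holes.\<close>

lemma simply_connected_component_disc_vimage_ball:
  fixes \<phi> :: "complex \<Rightarrow> complex^'n" and p :: "complex^'n" and R :: real and \<zeta>0 :: complex
  assumes hol: "\<And>i. (\<lambda>\<zeta>. \<phi> \<zeta> $ i) holomorphic_on ball 0 1"
  defines "D \<equiv> connected_component_set {\<zeta> \<in> ball 0 1. \<phi> \<zeta> \<in> ball p R} \<zeta>0"
  shows "open D" "simply_connected D"
proof -
  let ?S = "{\<zeta> \<in> ball 0 1. \<phi> \<zeta> \<in> ball p R}"
  have cont: "continuous_on (ball 0 1) \<phi>" by (rule continuous_on_holomorphic_components[OF hol])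
  have "open (ball 0 1 \<inter> \<phi> -` ball p R)"
    by (rule continuous_open_preimage[OF cont]) auto
  also have "ball 0 1 \<inter> \<phi> -` ball p R = ?S" by auto
  finally have "open ?S" .
  then show "open D" unfolding D_def by (rule open_connected_component)
  have DS: "D \<subseteq> ?S" unfolding D_def by (rule connected_component_subset)
  show "simply_connected D"
    unfolding simply_connected_eq_winding_number_zero[OF \<open>open D\<close>]
  proof (intro conjI allI impI, goal_cases)
    case 1
    show ?case unfolding D_def by simp
  next
    case (2 g z)
    then have g: "path g" "path_image g \<subseteq> D" "pathfinish g = pathstart g" and z: "z \<notin> D" by auto
    show ?case
    proof (cases "z \<in> outside (path_image g)")
      case True
      then show ?thesis using winding_number_zero_in_outside[OF g(1,3)] by simp
    next
      case False
      let ?W = "inside (path_image g)"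
      have cpt: "compact (path_image g)" using g by (simp add: compact_path_image)
      have zW: "z \<in> ?W" using False z g(2) inside_Un_outside[of "path_image g"] by blast
      have Wfr: "frontier ?W \<subseteq> path_image g"
        using cpt by (simp add: frontier_inside_subset compact_imp_closed)
      have Wbd: "bounded ?W" using cpt by (simp add: bounded_inside compact_imp_bounded)
      have gball: "path_image g \<subseteq> ball 0 1" using g(2) DS by auto
      have Wball: "?W \<subseteq> ball 0 1"
        using outside_mono[OF gball] outside_convex[OF convex_ball] inside_Int_outside[of "path_image g"]
        by blast
      have cl: "closure ?W \<subseteq> ball 0 1"
        using Wfr gball Wball closure_Un_frontier[of ?W] by auto
      have "continuous_on (path_image g) (\<lambda>\<zeta>. norm (\<phi> \<zeta> - p))"
        using gball by (intro continuous_intros continuous_on_subset[OF cont])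
      then obtain \<zeta>1 where \<zeta>1: "\<zeta>1 \<in> path_image g"
          "\<And>\<zeta>. \<zeta> \<in> path_image g \<Longrightarrow> norm (\<phi> \<zeta> - p) \<le> norm (\<phi> \<zeta>1 - p)"
        using continuous_attains_sup[OF cpt] path_image_nonempty by blast
      have lt: "norm (\<phi> \<zeta>1 - p) < R" using \<zeta>1(1) g(2) DS by (auto simp: dist_norm norm_minus_commute)
      have W\<phi>: "\<phi> \<zeta> \<in> ball p R" if "\<zeta> \<in> ?W" for \<zeta>
      proof -
        have "norm ((\<lambda>\<zeta>. \<phi> \<zeta> - p) \<zeta>) \<le> norm (\<phi> \<zeta>1 - p)"
        proof (rule maximum_norm_frontier_vec[where S = ?W and T = "ball 0 1"])
          show "(\<lambda>\<zeta>. (\<phi> \<zeta> - p) $ i) holomorphic_on ball 0 1" for i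
            using hol[of i] by (auto intro!: holomorphic_intros)
        qed (use cl Wbd Wfr \<zeta>1 that in auto)
        then show ?thesis using lt by (simp add: dist_norm norm_minus_commute)
      qed
      \<comment> \<open>The inside of the loop may be disconnected. Its component at
        \<open>z\<close> has a non-empty frontier contained in the loop, so it is connected to
        \<open>D\<close> within the preimage and must belong to \<open>D\<close>.\<close>
      obtain C where C: "C \<in> components ?W" "z \<in> C"
        using zW by (metis UnionE Union_components)
      have Cfr: "frontier C \<subseteq> path_image g"
        using C Wfr frontier_of_components_subset[OF C(1)] by blast
      have Cbd: "bounded C" using C Wbd in_components_subset bounded_subset by blast
      have "C \<noteq> UNIV" using Cbd not_bounded_UNIV by metis
      then have "frontier C \<noteq> {}" using C frontier_not_empty by blast
      then have ne: "closure C \<inter> path_image g \<noteq> {}" using Cfr frontier_def[of C] by auto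
      have "connected (closure C)" using C in_components_connected connected_imp_connected_closure by blast
      then have con: "connected (closure C \<union> D)"
        using ne g(2) unfolding D_def by (intro connected_Un) auto
      have "closure C \<subseteq> C \<union> path_image g"
        using Cfr closure_Un_frontier[of C] by auto
      moreover have "C \<subseteq> ?S" using in_components_subset[OF C(1)] W\<phi> Wball by blast
      ultimately have "closure C \<union> D \<subseteq> ?S" using g(2) DS by auto
      moreover have "D \<noteq> {}" using g(2) path_image_nonempty by blast
      then have "\<zeta>0 \<in> D"
        unfolding D_def
        by (metis connected_component_eq_empty connected_component_refl mem_Collect_eq)
      ultimately have "closure C \<union> D \<subseteq> D"
        unfolding D_def using con[unfolded D_def] by (intro connected_component_maximal) auto
      then show ?thesis using z C closure_subset by blast
    qed
  qed
qed

text \<open>In \<open>disc_localization\<close>, \<open>b\<^sup>2\<close> is the modulus of a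
  nearest point off the component and \<open>u\<close> the real part of the damping function at the
  centre. Near \<open>b = 1\<close> the logarithm of the left side is quadratic in
  \<open>1 - b\<close> and \<open>ln (1 / b)\<close> is linear, so \<open>u\<close> is at least
  linear in \<open>1 - b\<close>; for \<open>b < 1/2\<close> the two logarithms are comparable. Both
  regimes give the constant \<open>32\<close>.\<close>

lemma localization_scalar_bound:
  fixes b u :: real
  assumes b: "0 < b" "b < 1" and u: "0 \<le> u"
    and le: "(1 + b\<^sup>2) / (2 * b) \<le> exp (4 * ln (1 / b) * u)"
  shows "1 - b\<^sup>2 \<le> 32 * u"
proof -
  let ?X = "(1 + b\<^sup>2) / (2 * b)"
  define \<Lambda> where "\<Lambda> = ln (1 / b)"
  have \<Lambda>: "\<Lambda> > 0" unfolding \<Lambda>_def using b by (intro ln_gt_zero) (simp add: field_simps)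
  have pos: "0 < ?X" using b by (intro divide_pos_pos) (auto intro: add_pos_nonneg)
  from le have ln_le: "ln ?X \<le> 4 * \<Lambda> * u"
    using pos by (metis \<Lambda>_def ln_exp ln_le_cancel_iff exp_gt_zero)
  show ?thesis
  proof (cases "b \<ge> 1/2")
    case True
    have "1 - 1 / ?X \<le> ln ?X"
    proof -
      define y where "y = ?X"
      have y: "0 < y" using pos by (simp add: y_def)
      have "ln (1 / y) \<le> 1 / y - 1" by (rule ln_le_minus_one) (use y in simp)
      then have "1 - 1 / y \<le> ln y" using y by (simp add: ln_div)
      then show ?thesis by (simp add: y_def)
    qed
    moreover have "1 - 1 / ?X = (1 - b)\<^sup>2 / (1 + b\<^sup>2)"
    proof -
      have "1 + b\<^sup>2 \<noteq> 0" using zero_le_power2[of b] by linarith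
      then show ?thesis using b by (simp add: field_simps power2_eq_square)
    qed
    moreover have "(1 - b)\<^sup>2 / 2 \<le> (1 - b)\<^sup>2 / (1 + b\<^sup>2)"
      using b by (intro divide_left_mono) (auto simp: power_le_one add_pos_nonneg)
    moreover have "\<Lambda> \<le> 1 / b - 1" unfolding \<Lambda>_def using b by (intro ln_le_minus_one) simp
    moreover have "1 / b - 1 \<le> 2 * (1 - b)"
    proof -
      have "1 / b \<le> 2" using True b by (simp add: field_simps)
      then have "(1 - b) * (1 / b) \<le> (1 - b) * 2" using b by (intro mult_left_mono) auto
      then show ?thesis using b by (simp add: field_simps)
    qed
    ultimately have "(1 - b)\<^sup>2 / 2 \<le> 4 * (2 * (1 - b)) * u"
      using ln_le u by (smt (verit) mult_right_mono mult_left_mono)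
    then have "(1 - b) * (1 - b) \<le> (1 - b) * (16 * u)"
      by (simp only: power2_eq_square)
    then have "1 - b \<le> 16 * u" using b by simp
    moreover have "1 - b\<^sup>2 \<le> 2 * (1 - b)"
    proof -
      have "(1 - b) * (1 + b) \<le> (1 - b) * 2" using b by (intro mult_left_mono) auto
      then show ?thesis by (simp add: power2_eq_square algebra_simps)
    qed
    ultimately show ?thesis by simp
  next
    case False
    define X where "X = 1 / b"
    have X: "X > 2" using False b by (simp add: X_def field_simps)
    have L: "\<Lambda> = ln X" by (simp add: \<Lambda>_def X_def)
    have "ln X / 8 \<le> ln ?X"
    proof (cases "X \<ge> 4")
      case True
      have "ln X / 8 \<le> ln X / 2" using X by (simp add: ln_ge_zero)
      also have "\<dots> = ln X - ln X / 2" by simp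
      also have "\<dots> \<le> ln X - ln 4 / 2" using True by simp
      also have "ln (4::real) = 2 * ln 2" using ln_realpow[of 2 2] by simp
      also have "ln X - 2 * ln 2 / 2 = ln (X / 2)" using X by (simp add: ln_div)
      also have "\<dots> \<le> ln ?X"
        using b X pos by (subst ln_le_cancel_iff) (auto simp: X_def field_simps)
      finally show ?thesis .
    next
      case X4: False
      \<comment> \<open>\<open>5 / 4\<close> is the value of \<open>?X\<close> at
        \<open>b = 1/2\<close> and a lower bound for it when \<open>b < 1/2\<close>; its eighth
        power exceeds \<open>4\<close>, the bound on \<open>X\<close> in this case.\<close>
      have "4 \<le> (5 / 4 :: real) ^ 8" by (simp add: eval_nat_numeral)
      then have "ln X \<le> ln ((5/4) ^ 8)" using X X4 by (subst ln_le_cancel_iff) auto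
      also have "\<dots> = 8 * ln (5/4)" by (simp only: ln_realpow)
      finally have "ln X / 8 \<le> ln (5/4)" by simp
      also have "5 / 4 \<le> ?X"
      proof -
        have "0 \<le> (b - 2) * (b - 1/2)" using False by (intro mult_nonpos_nonpos) auto
        moreover have "(b - 2) * (b - 1/2) = 1 + b\<^sup>2 - 5 / 4 * (2 * b)"
          by (simp add: power2_eq_square field_simps)
        ultimately have "5 / 4 * (2 * b) \<le> 1 + b\<^sup>2" by simp
        then show ?thesis using b by (simp add: pos_le_divide_eq)
      qed
      then have "ln (5/4) \<le> ln ?X" by (subst ln_le_cancel_iff) (use pos in auto)
      finally show ?thesis .
    qed
    then have "\<Lambda> / 8 \<le> 4 * \<Lambda> * u" using ln_le L by linarith
    then have "1 \<le> 32 * u" using \<Lambda> by (simp add: field_simps)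
    then show ?thesis by (smt (verit) zero_le_power2)
  qed
qed


text \<open>The Moebius map \<open>P / (P + c)\<close> fixes \<open>0\<close> and sends the circle
  \<open>cmod P = c\<close> to the line of real part \<open>1/2\<close>. Its real part thus serves
  as a barrier that is small where \<open>P\<close> is small and bounded below where
  \<open>P\<close> is large.\<close>

lemma Re_halfplane_fraction_ge:
  fixes P :: complex
  assumes "0 < c" "c \<le> cmod P" "0 \<le> Re P"
  shows "1 / 2 \<le> Re (P / (P + of_real c))"
proof -
  have sq: "(cmod (P + of_real c))\<^sup>2 = (cmod P)\<^sup>2 + 2 * c * Re P + c\<^sup>2"
    unfolding cmod_power2 by (simp add: power2_eq_square algebra_simps)
  have pos: "0 < (cmod (P + of_real c))\<^sup>2"
    unfolding sq using assms by (intro add_nonneg_pos add_nonneg_nonneg) auto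
  have "Re (P / (P + of_real c)) = ((cmod P)\<^sup>2 + c * Re P) / (cmod (P + of_real c))\<^sup>2"
    unfolding Re_divide cmod_power2 by (simp add: power2_eq_square algebra_simps)
  moreover have "c\<^sup>2 \<le> (cmod P)\<^sup>2" using assms by (intro power_mono) auto
  ultimately show ?thesis using pos by (simp add: pos_le_divide_eq sq)
qed

text \<open>The component \<open>D\<close> of \<open>\<phi> -` ball p R\<close> is simply connected. If \<open>\<beta>\<close> is a point of the
  unit disc off \<open>D\<close> nearest to \<open>0\<close>, then the square root \<open>F\<close> of the Blaschke factor of \<open>\<beta>\<close> exists on \<open>D\<close>, and
  postcomposing it with the disc automorphism that takes \<open>F 0\<close> to \<open>0\<close> and dividing by \<open>\<zeta>\<close>
  gives \<open>N\<close> with \<open>\<bar>N 0\<bar> > 1\<close> (as in the proof of the Riemann mapping theorem). Damping \<open>N\<close> by the exponential of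
  \<open>\<psi>\<close>, whose real part is at least \<open>1/2\<close> on the part of the boundary of \<open>D\<close> inside the unit disc, makes the
  boundary values at most \<open>1\<close>, so \<open>\<psi> 0\<close> cannot be small.\<close>

lemma disc_localization:
  fixes \<phi> :: "complex \<Rightarrow> complex^'n" and H :: "complex^'n \<Rightarrow> complex"
  assumes \<phi>: "analytic_disc X \<phi>"
    and H: "(\<lambda>\<zeta>. H (\<phi> \<zeta>)) holomorphic_on {\<zeta> \<in> ball 0 1. \<phi> \<zeta> \<in> ball p R'}" and R: "R < R'"
    and neg: "\<And>x. x \<in> X \<Longrightarrow> x \<in> ball p R' \<Longrightarrow> Re (H x) < 0"
    and c: "0 < c" "\<And>x. x \<in> X \<Longrightarrow> dist p x = R \<Longrightarrow> c \<le> cmod (H x)"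
    and a: "\<phi> 0 \<in> ball p R" and \<alpha>: "cmod \<alpha> < 1" "\<phi> \<alpha> \<notin> ball p R"
  shows "1 - cmod \<alpha> \<le> 32 * (cmod (H (\<phi> 0)) / c)"
proof -
  have hol: "(\<lambda>\<zeta>. \<phi> \<zeta> $ i) holomorphic_on ball 0 1" for i
    using \<phi> by (simp add: analytic_disc_def)
  have \<phi>X: "\<phi> \<zeta> \<in> X" if "cmod \<zeta> < 1" for \<zeta>
    using \<phi> that by (auto simp: analytic_disc_def)
  have cont: "continuous_on (ball 0 1) \<phi>" by (rule continuous_on_holomorphic_components[OF hol])
  define S where "S r = {\<zeta> \<in> ball 0 1. \<phi> \<zeta> \<in> ball p r}" for r
  have "S r = ball 0 1 \<inter> \<phi> -` ball p r" for r by (auto simp: S_def)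
  then have openS: "open (S r)" for r
    using continuous_open_preimage[OF cont, of "ball p r"] by simp
  define D where "D = connected_component_set (S R) 0"
  have D: "open D" "simply_connected D"
    using simply_connected_component_disc_vimage_ball[of \<phi> p R 0] hol by (auto simp: D_def S_def)
  have DS: "D \<subseteq> S R" unfolding D_def by (rule connected_component_subset)
  have D0: "0 \<in> D" using a by (simp add: D_def S_def connected_component_refl_eq)
  have conD: "connected D" by (simp add: D_def)
  have D1: "D \<subseteq> ball 0 1" using DS by (auto simp: S_def)
  have Dbd: "bounded D" using D1 bounded_ball bounded_subset by blast
  have bdry: "dist p (\<phi> \<xi>) = R" if \<xi>: "\<xi> \<in> closure D" "\<xi> \<notin> D" "cmod \<xi> < 1" for \<xi>
  proof -
    obtain x where x: "\<And>n. x n \<in> D" "x \<longlonglongrightarrow> \<xi>" using \<xi>(1) closure_sequential by blast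
    have "(\<lambda>n. \<phi> (x n)) \<longlonglongrightarrow> \<phi> \<xi>"
      using x subsetD[OF D1 x(1)] \<xi>(3) by (intro continuous_on_tendsto_compose[OF cont] always_eventually allI) auto
    then have "(\<lambda>n. dist p (\<phi> (x n))) \<longlonglongrightarrow> dist p (\<phi> \<xi>)" by (intro tendsto_intros)
    then have "dist p (\<phi> \<xi>) \<le> R"
      by (rule LIMSEQ_le_const2) (use x DS in \<open>auto simp: S_def intro: less_imp_le\<close>)
    moreover have "\<not> dist p (\<phi> \<xi>) < R"
    proof
      assume "dist p (\<phi> \<xi>) < R"
      then have "\<xi> \<in> S R" using \<xi>(3) by (simp add: S_def)
      then obtain e where e: "e > 0" "ball \<xi> e \<subseteq> S R" using openS open_contains_ball by blast
      then obtain y where y: "y \<in> D" "y \<in> ball \<xi> e"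
        using \<xi>(1) by (auto simp: closure_approachable dist_commute)
      have "connected (D \<union> ball \<xi> e)" using conD y by (intro connected_Un) auto
      then have "D \<union> ball \<xi> e \<subseteq> D"
        unfolding D_def using D0[unfolded D_def] e(2) DS[unfolded D_def]
        by (intro connected_component_maximal) (auto simp: D_def)
      then show False using \<xi>(2) centre_in_ball[of \<xi> e] e(1) by blast
    qed
    ultimately show ?thesis by simp
  qed
  have \<alpha>D: "\<alpha> \<notin> D" using \<alpha>(2) DS by (auto simp: S_def)
  have "compact (cball 0 (cmod \<alpha>) - D)" by (intro compact_diff D) auto
  moreover have "\<alpha> \<in> cball 0 (cmod \<alpha>) - D" using \<alpha>D by simp
  ultimately obtain \<beta> where \<beta>: "\<beta> \<in> cball 0 (cmod \<alpha>) - D"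
      and \<beta>min: "\<And>\<xi>. \<xi> \<in> cball 0 (cmod \<alpha>) - D \<Longrightarrow> cmod \<beta> \<le> cmod \<xi>"
    using continuous_attains_inf[of "cball 0 (cmod \<alpha>) - D" cmod] by (metis continuous_on_norm_id empty_iff)
  have \<beta>le: "cmod \<beta> \<le> cmod \<alpha>" "cmod \<beta> < 1" using \<beta> \<alpha>(1) by auto
  have \<beta>near: "cmod \<beta> \<le> cmod \<xi>" if "\<xi> \<notin> D" for \<xi>
    using \<beta>min[of \<xi>] \<beta>le that by (cases "cmod \<xi> \<le> cmod \<alpha>") auto
  have \<beta>0: "\<beta> \<noteq> 0" using \<beta> D0 by auto
  have den: "1 - cnj \<beta> * \<zeta> \<noteq> 0" if "cmod \<zeta> < 1" for \<zeta>
  proof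
    assume "1 - cnj \<beta> * \<zeta> = 0"
    then have "cmod \<beta> * cmod \<zeta> = 1" by (metis complex_mod_cnj eq_iff_diff_eq_0 norm_mult norm_one)
    moreover have "cmod \<beta> * cmod \<zeta> < 1 * 1" using \<beta>le that by (intro mult_strict_mono') auto
    ultimately show False by simp
  qed
  define B where "B \<zeta> = (\<zeta> - \<beta>) / (1 - cnj \<beta> * \<zeta>)" for \<zeta>
  have B1: "cmod (B \<zeta>) < 1" if "cmod \<zeta> < 1" for \<zeta>
    using Moebius_function_norm_lt_1[OF \<beta>le(2) that, of 0] by (simp add: B_def Moebius_function_simple)
  have "B holomorphic_on D"
    unfolding B_def using D1 den by (intro holomorphic_intros) auto
  moreover have "B \<zeta> \<noteq> 0" if "\<zeta> \<in> D" for \<zeta>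
    using that den[of \<zeta>] D1 \<beta> by (auto simp: B_def)
  ultimately obtain F where F: "F holomorphic_on D" "\<And>\<zeta>. \<zeta> \<in> D \<Longrightarrow> B \<zeta> = (F \<zeta>)\<^sup>2"
    using D(2) unfolding simply_connected_eq_holomorphic_sqrt[OF D(1)] by blast
  have F1: "cmod (F \<zeta>) < 1" if "\<zeta> \<in> D" for \<zeta>
  proof -
    have "(cmod (F \<zeta>))\<^sup>2 < 1" using B1[of \<zeta>] F(2)[OF that] D1 that by (auto simp: norm_power)
    then show ?thesis by (simp add: power_less_one_iff abs_square_less_1)
  qed
  define w where "w = F 0"
  have w2: "w\<^sup>2 = - \<beta>" using F(2)[OF D0] by (simp add: w_def B_def)
  define b where "b = cmod w"
  have b\<beta>: "b\<^sup>2 = cmod \<beta>" using arg_cong[OF w2, of cmod] by (simp add: b_def norm_power)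
  have b: "0 < b" "b < 1" using \<beta>0 w2 F1[OF D0] by (auto simp: b_def w_def)
  have w0: "w \<noteq> 0" using b by (auto simp: b_def)
  have Fw: "F \<zeta> + w \<noteq> 0" if "\<zeta> \<in> D" for \<zeta>
  proof
    assume *: "F \<zeta> + w = 0"
    then have "(F \<zeta>)\<^sup>2 = w\<^sup>2" by (simp add: add_eq_0_iff)
    then have "B \<zeta> = - \<beta>" using F(2)[OF that] w2 by simp
    then have "\<zeta> * (1 - cnj \<beta> * \<beta>) = 0"
      using den[of \<zeta>] that D1 by (auto simp: B_def field_simps)
    moreover have "1 - cnj \<beta> * \<beta> \<noteq> 0" using den[OF \<beta>le(2)] .
    ultimately have "\<zeta> = 0" by simp
    then show False using * w0 by (simp add: w_def)
  qed
  have Fw': "1 - cnj w * F \<zeta> \<noteq> 0" if "\<zeta> \<in> D" for \<zeta>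
  proof
    assume "1 - cnj w * F \<zeta> = 0"
    then have "cmod w * cmod (F \<zeta>) = 1" by (metis complex_mod_cnj eq_iff_diff_eq_0 norm_mult norm_one)
    moreover have "cmod w * cmod (F \<zeta>) < 1 * 1"
      using b F1[OF that] by (intro mult_strict_mono') (auto simp: b_def)
    ultimately show False by simp
  qed
  \<comment> \<open>This is the automorphism applied to \<open>F\<close>, divided by
    \<open>\<zeta>\<close>, with the zero at \<open>0\<close> already cancelled:
    \<open>(F \<zeta> - w) * (F \<zeta> + w) = B \<zeta> + \<beta>\<close> contains the factor
    \<open>\<zeta>\<close>. In this form it is visibly holomorphic at \<open>0\<close>.\<close>
  define N where "N \<zeta> = (1 - cnj \<beta> * \<beta>) / ((1 - cnj \<beta> * \<zeta>) * (F \<zeta> + w) * (1 - cnj w * F \<zeta>))" for \<zeta>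
  have N: "\<zeta> * N \<zeta> = (F \<zeta> - w) / (1 - cnj w * F \<zeta>)" if "\<zeta> \<in> D" for \<zeta>
  proof -
    have d: "1 - cnj \<beta> * \<zeta> \<noteq> 0" using den that D1 by auto
    have "(F \<zeta> - w) * (F \<zeta> + w) = B \<zeta> + \<beta>"
      using F(2)[OF that] w2 by (simp add: power2_eq_square algebra_simps)
    also have "\<dots> = \<zeta> * (1 - cnj \<beta> * \<beta>) / (1 - cnj \<beta> * \<zeta>)"
      using d by (simp add: B_def field_simps)
    finally have "F \<zeta> - w = \<zeta> * (1 - cnj \<beta> * \<beta>) / (1 - cnj \<beta> * \<zeta>) / (F \<zeta> + w)"
      by (simp only: nonzero_eq_divide_eq[OF Fw[OF that]])
    then have "F \<zeta> - w = \<zeta> * (1 - cnj \<beta> * \<beta>) / ((1 - cnj \<beta> * \<zeta>) * (F \<zeta> + w))"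
      by (simp only: divide_divide_eq_left)
    then show ?thesis by (simp add: N_def)
  qed
  have N1: "cmod (N \<zeta>) \<le> 1 / cmod \<zeta>" if "\<zeta> \<in> D" "\<zeta> \<noteq> 0" for \<zeta>
  proof -
    have "cmod (\<zeta> * N \<zeta>) < 1"
      unfolding N[OF that(1)]
      using Moebius_function_norm_lt_1[of w "F \<zeta>" 0] F1[OF that(1)] b
      by (simp add: Moebius_function_simple b_def)
    then show ?thesis using that(2) by (simp add: norm_mult field_simps)
  qed
  define \<psi> where "\<psi> \<zeta> = - H (\<phi> \<zeta>) / (- H (\<phi> \<zeta>) + of_real c)" for \<zeta>
  have ReP: "0 < Re (- H (\<phi> \<zeta>))" if "\<zeta> \<in> S R'" for \<zeta>
    using neg[of "\<phi> \<zeta>"] \<phi>X that by (auto simp: S_def)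
  have Pc: "- H (\<phi> \<zeta>) + of_real c \<noteq> 0" if "\<zeta> \<in> S R'" for \<zeta>
    using ReP[OF that] c(1) by (auto simp: complex_eq_iff)
  have SR: "S R \<subseteq> S R'" using R by (auto simp: S_def)
  have hol\<psi>: "\<psi> holomorphic_on S R'"
    unfolding \<psi>_def using H Pc by (intro holomorphic_intros) (auto simp: S_def)
  \<comment> \<open>With the exponent \<open>2 * \<Lambda> * \<psi>\<close>, real part
    \<open>1/2\<close> of \<open>\<psi>\<close> means damping by \<open>cmod \<beta>\<close>. This
    offsets \<open>cmod (N \<zeta>) \<le> 1 / cmod \<zeta>\<close>, since every point off
    \<open>D\<close> has modulus at least \<open>cmod \<beta>\<close>.\<close>
  define \<Lambda> where "\<Lambda> = ln (1 / cmod \<beta>)"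
  have \<Lambda>: "\<Lambda> > 0" unfolding \<Lambda>_def using \<beta>0 \<beta>le by (intro ln_gt_zero) (simp add: field_simps)
  define J where "J \<zeta> = N \<zeta> * exp (- (2 * of_real \<Lambda> * \<psi> \<zeta>))" for \<zeta>
  have cJ: "cmod (J \<zeta>) = cmod (N \<zeta>) * exp (- (2 * \<Lambda> * Re (\<psi> \<zeta>)))" for \<zeta>
    by (simp add: J_def norm_mult)
  have Re\<psi>: "0 \<le> Re (\<psi> \<zeta>)" if "\<zeta> \<in> S R'" for \<zeta>
  proof -
    define P where "P = - H (\<phi> \<zeta>)"
    have "0 < Re P" using ReP[OF that] by (simp add: P_def)
    then have "0 \<le> Re P * (Re P + c) + Im P * Im P" using c(1) by simp
    then have "0 \<le> Re (P / (P + of_real c))"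
      unfolding Re_divide by (intro divide_nonneg_nonneg) auto
    then show ?thesis by (simp add: \<psi>_def P_def)
  qed
  have "J holomorphic_on D"
    unfolding J_def N_def
    using F(1) D1 den Fw Fw' DS SR
    by (intro holomorphic_intros holomorphic_on_subset[OF hol\<psi>]) auto
  then have "cmod (J 0) \<le> 1"
  proof (rule maximum_modulus_eventually[OF _ D(1) conD Dbd _ D0])
    fix \<xi> and e :: real assume \<xi>: "\<xi> \<in> frontier D" and e: "0 < e"
    have \<xi>cl: "\<xi> \<in> closure D" "\<xi> \<notin> D" using \<xi> D(1) by (auto simp: frontier_def interior_open)
    have "\<xi> \<noteq> 0" using \<xi>cl D0 by auto
    have "\<xi> \<in> cball 0 1" using \<xi>cl(1) D1 closure_mono[OF D1] by auto
    have ev0: "\<forall>\<^sub>F \<zeta> in at \<xi> within D. \<zeta> \<in> D \<and> \<zeta> \<noteq> 0"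
      using \<open>\<xi> \<noteq> 0\<close> by (auto simp: eventually_at dist_norm intro!: exI[of _ "cmod \<xi>"])
    show "\<forall>\<^sub>F \<zeta> in at \<xi> within D. cmod (J \<zeta>) \<le> 1 + e"
    \<comment> \<open>On the unit circle \<open>\<phi>\<close> has no values; there only
      \<open>Re (\<psi> \<zeta>) \<ge> 0\<close> is available, but \<open>1 / cmod \<zeta>\<close>
      already tends to \<open>1\<close>. Inside the disc, \<open>\<phi> \<xi>\<close> lies on the
      sphere of radius \<open>R\<close> and the barrier takes effect.\<close>
    proof (cases "cmod \<xi> < 1")
      case False
      then have \<xi>1: "cmod \<xi> = 1" using \<open>\<xi> \<in> cball 0 1\<close> by auto
      have "((\<lambda>\<zeta>. 1 / cmod \<zeta>) \<longlongrightarrow> 1 / cmod \<xi>) (at \<xi> within D)"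
        using \<open>\<xi> \<noteq> 0\<close> by (intro tendsto_intros) auto
      then have "\<forall>\<^sub>F \<zeta> in at \<xi> within D. 1 / cmod \<zeta> < 1 + e"
        using e \<xi>1 by (intro order_tendstoD(2)) auto
      with ev0 show ?thesis
      proof eventually_elim
        case (elim \<zeta>)
        have "exp (- (2 * \<Lambda> * Re (\<psi> \<zeta>))) \<le> 1"
          using \<Lambda> Re\<psi>[of \<zeta>] elim DS SR by auto
        then have "cmod (J \<zeta>) \<le> cmod (N \<zeta>)" unfolding cJ by (simp add: mult_left_le)
        then show ?case using N1[of \<zeta>] elim by linarith
      qed
    next
      case True
      have d: "dist p (\<phi> \<xi>) = R" using bdry \<xi>cl True by blast
      then have \<xi>S: "\<xi> \<in> S R'" using R True by (simp add: S_def)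
      have "1 / 2 \<le> Re (\<psi> \<xi>)"
        unfolding \<psi>_def using c ReP[OF \<xi>S] \<phi>X[OF True] d
        by (intro Re_halfplane_fraction_ge) auto
      then have "1 / cmod \<xi> * exp (- (2 * \<Lambda> * Re (\<psi> \<xi>))) \<le> 1 / cmod \<xi> * exp (- \<Lambda>)"
        using \<Lambda> by (intro mult_left_mono) auto
      also have "\<dots> = cmod \<beta> / cmod \<xi>" using \<beta>0 by (simp add: \<Lambda>_def ln_div)
      also have "\<dots> \<le> 1" using \<beta>near[OF \<xi>cl(2)] \<open>\<xi> \<noteq> 0\<close> by simp
      finally have le1: "1 / cmod \<xi> * exp (- (2 * \<Lambda> * Re (\<psi> \<xi>))) < 1 + e" using e by simp
      have "isCont \<psi> \<xi>"
        using holomorphic_on_imp_continuous_on[OF hol\<psi>] openS \<xi>S continuous_on_eq_continuous_at by blast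
      then have "(\<psi> \<longlongrightarrow> \<psi> \<xi>) (at \<xi> within D)" 
        unfolding isCont_def by (rule tendsto_within_subset) simp
      then have "((\<lambda>\<zeta>. 1 / cmod \<zeta> * exp (- (2 * \<Lambda> * Re (\<psi> \<zeta>)))) \<longlongrightarrow>
            1 / cmod \<xi> * exp (- (2 * \<Lambda> * Re (\<psi> \<xi>)))) (at \<xi> within D)"
        using \<open>\<xi> \<noteq> 0\<close> by (intro tendsto_intros) auto
      from order_tendstoD(2)[OF this le1] ev0 show ?thesis
      proof eventually_elim
        case (elim \<zeta>)
        have "cmod (J \<zeta>) \<le> 1 / cmod \<zeta> * exp (- (2 * \<Lambda> * Re (\<psi> \<zeta>)))"
          unfolding cJ using N1[of \<zeta>] elim by (intro mult_right_mono) auto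
        then show ?case using elim by linarith
      qed
    qed
  qed
  moreover have "cmod (N 0) = (1 + b\<^sup>2) / (2 * b)"
  proof -
    have sq: "cnj z * z = of_real ((cmod z)\<^sup>2)" for z
      by (simp only: complex_norm_square mult.commute)
    have "1 - cnj \<beta> * \<beta> = of_real (1 - b\<^sup>2 * b\<^sup>2)"
      unfolding sq b\<beta> by (simp add: power2_eq_square)
    moreover have "1 - cnj w * w = of_real (1 - b\<^sup>2)"
      unfolding sq b_def by simp
    ultimately have "N 0 = of_real (1 - b\<^sup>2 * b\<^sup>2) / (2 * w * of_real (1 - b\<^sup>2))"
      by (simp add: N_def w_def)
    then have "cmod (N 0) = \<bar>1 - b\<^sup>2 * b\<^sup>2\<bar> / (2 * b * \<bar>1 - b\<^sup>2\<bar>)"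
      by (simp only: norm_divide norm_mult norm_of_real b_def[symmetric]) simp
    also have "1 - b\<^sup>2 * b\<^sup>2 = (1 - b\<^sup>2) * (1 + b\<^sup>2)" by (simp add: algebra_simps)
    also have "\<bar>(1 - b\<^sup>2) * (1 + b\<^sup>2)\<bar> = \<bar>1 - b\<^sup>2\<bar> * (1 + b\<^sup>2)" by (simp add: abs_mult)
    also have "\<bar>1 - b\<^sup>2\<bar> * (1 + b\<^sup>2) / (2 * b * \<bar>1 - b\<^sup>2\<bar>) = (1 + b\<^sup>2) / (2 * b)"
      using b by (simp add: power2_eq_1_iff)
    finally show ?thesis .
  qed
  ultimately have "(1 + b\<^sup>2) / (2 * b) * exp (- (2 * \<Lambda> * Re (\<psi> 0))) \<le> 1" using cJ[of 0] by simp
  from mult_right_mono[OF this, of "exp (2 * \<Lambda> * Re (\<psi> 0))"]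
  have "(1 + b\<^sup>2) / (2 * b) \<le> exp (2 * \<Lambda> * Re (\<psi> 0))"
    by (simp add: mult.assoc flip: exp_add)
  moreover have "\<Lambda> = 2 * ln (1 / b)"
    using b by (simp add: \<Lambda>_def b\<beta>[symmetric] ln_div ln_realpow)
  ultimately have "1 - b\<^sup>2 \<le> 32 * Re (\<psi> 0)"
    using b Re\<psi>[of 0] D0 DS SR by (intro localization_scalar_bound) (auto simp: mult.commute)
  moreover have "Re (\<psi> 0) \<le> cmod (H (\<phi> 0)) / c"
  proof -
    have "0 \<in> S R'" using D0 DS SR by auto
    then have "c \<le> Re (- H (\<phi> 0) + of_real c)" using ReP[of 0] by simp
    also have "\<dots> \<le> cmod (- H (\<phi> 0) + of_real c)" by (rule complex_Re_le_cmod)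
    finally have cc: "c \<le> cmod (- H (\<phi> 0) + of_real c)" .
    with c(1) have "0 < cmod (- H (\<phi> 0) + of_real c) * c" by (intro mult_pos_pos) linarith+
    with cc have "cmod (H (\<phi> 0)) / cmod (- H (\<phi> 0) + of_real c) \<le> cmod (H (\<phi> 0)) / c"
      by (intro divide_left_mono) auto
    moreover have "Re (\<psi> 0) \<le> cmod (\<psi> 0)" by (rule complex_Re_le_cmod)
    ultimately show ?thesis by (simp add: \<psi>_def norm_divide)
  qed
  ultimately show ?thesis using b\<beta> \<beta>le by linarith
qed

subsection \<open>Supporting functions at a \<open>\<complex>\<close>-strictly convexifiable point\<close>

lemma GDERIV_imp_DERIV_along:
  fixes r :: "'a::real_inner \<Rightarrow> real"
  assumes "GDERIV r (x + s *\<^sub>R u) :> d"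
  shows "((\<lambda>t. r (x + t *\<^sub>R u)) has_real_derivative inner d u) (at s)"
proof -
  have "(r has_derivative (\<lambda>h. inner h d)) (at (x + s *\<^sub>R u))" using assms by (simp add: gderiv_def)
  moreover have "((\<lambda>t. x + t *\<^sub>R u) has_derivative (\<lambda>h. h *\<^sub>R u)) (at s)"
    by (auto intro!: derivative_eq_intros)
  ultimately have "((\<lambda>t. r (x + t *\<^sub>R u)) has_derivative (\<lambda>h. inner (h *\<^sub>R u) d)) (at s)"
    by (intro has_derivative_compose[of "\<lambda>t. x + t *\<^sub>R u" _ _ _ r]) auto
  then show ?thesis
    by (simp add: has_field_derivative_def inner_commute mult_commute_abs)
qed

text \<open>Let \<open>w\<close> be the part of \<open>b\<close> orthogonal to \<open>a\<close>. The
  vectors \<open>t *\<^sub>R w - a\<close> lie in the half-space for every \<open>t\<close>, and a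
  large \<open>t\<close> contradicts the hypothesis unless \<open>w = 0\<close>.\<close>

lemma halfspace_normals_parallel:
  fixes a b :: "'a::real_inner"
  assumes a: "a \<noteq> 0" and le: "\<And>u. inner a u < 0 \<Longrightarrow> inner b u \<le> 0"
  obtains k where "0 \<le> k" "b = k *\<^sub>R a"
proof -
  define k where "k = inner a b / inner a a"
  define w where "w = b - k *\<^sub>R a"
  have aa: "0 < inner a a" using a by simp
  have aw: "inner a w = 0" using aa by (simp add: w_def k_def inner_diff_right)
  have bw: "inner b w = inner w w" using aw by (simp add: w_def inner_diff_left inner_commute)
  have "inner w w * t \<le> inner b a" for t
  proof -
    have "inner b (t *\<^sub>R w - a) \<le> 0" using aw aa by (intro le) (simp add: inner_diff_right)
    then show ?thesis by (simp add: inner_diff_right bw mult.commute)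
  qed
  from this[of "(inner b a + 1) / inner w w"] have "w = 0" by (cases "w = 0") auto
  then have "b = k *\<^sub>R a" by (simp add: w_def)
  moreover have "0 \<le> k"
  proof -
    have "inner b (- a) \<le> 0" using aa by (intro le) simp
    then show ?thesis using aa by (simp add: k_def inner_commute)
  qed
  ultimately show ?thesis using that by blast
qed

lemma local_defining_function_direction:
  assumes ldf: "local_defining_function G V r g" and q: "q \<in> V" "q \<in> frontier G" and u: "inner (g q) u \<noteq> 0"
  obtains e where "0 < e" "\<And>t. 0 < t \<Longrightarrow> t < e \<Longrightarrow> q + t *\<^sub>R u \<in> G \<longleftrightarrow> inner (g q) u < 0"
proof -
  have V: "open V" and D: "GDERIV r q :> g q" and G: "G \<inter> V = {x\<in>V. r x < 0}" and rq: "r q = 0"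
    using ldf q by (auto simp: local_defining_function_def)
  have D': "((\<lambda>t. r (q + t *\<^sub>R u)) has_real_derivative inner (g q) u) (at 0)"
    using D by (intro GDERIV_imp_DERIV_along) simp
  obtain d where d: "d > 0" "\<And>h. 0 < h \<Longrightarrow> h < d \<Longrightarrow> r (q + h *\<^sub>R u) < 0 \<longleftrightarrow> inner (g q) u < 0"
  proof (cases "inner (g q) u < 0")
    case True
    from DERIV_neg_dec_right[OF D' True] rq that True show thesis by auto
  next
    case False
    then have "0 < inner (g q) u" using u by simp
    from DERIV_pos_inc_right[OF D' this] rq obtain d where
      "d > 0" "\<And>h. 0 < h \<Longrightarrow> h < d \<Longrightarrow> 0 < r (q + h *\<^sub>R u)" by auto
    with that[of d] False show thesis by (simp add: not_less less_imp_le)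
  qed
  have "((\<lambda>t. q + t *\<^sub>R u) \<longlongrightarrow> q + 0 *\<^sub>R u) (at 0)" by (intro tendsto_intros)
  then have "\<forall>\<^sub>F t in at 0. q + t *\<^sub>R u \<in> V"
    using V q by (intro topological_tendstoD) auto
  then obtain d' where d': "d' > 0" "\<And>t. t \<noteq> 0 \<Longrightarrow> \<bar>t\<bar> < d' \<Longrightarrow> q + t *\<^sub>R u \<in> V"
    by (auto simp: eventually_at)
  show ?thesis
  proof (rule that[of "min d d'"])
    fix t assume t: "0 < t" "t < min d d'"
    then have "q + t *\<^sub>R u \<in> V" using d' by simp
    then have "q + t *\<^sub>R u \<in> G \<longleftrightarrow> r (q + t *\<^sub>R u) < 0" using G by blast
    then show "q + t *\<^sub>R u \<in> G \<longleftrightarrow> inner (g q) u < 0" using d(2) t by simp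
  qed (use d d' in auto)
qed

text \<open>A non-zero linear functional has no maximum on an open set.\<close>

lemma open_inner_neg:
  fixes G :: "'a::real_inner set"
  assumes G: "open G" and \<mu>: "\<mu> \<noteq> 0" and le: "\<And>y. y \<in> G \<Longrightarrow> inner \<mu> (y - x) \<le> 0" and z: "z \<in> G"
  shows "inner \<mu> (z - x) < 0"
proof -
  obtain e where e: "e > 0" "ball z e \<subseteq> G" using G z open_contains_ball by blast
  define y where "y = z + (e / 2 / norm \<mu>) *\<^sub>R \<mu>"
  have "dist z y = e / 2" using \<mu> e by (simp add: y_def dist_norm)
  then have "y \<in> G" using e by (intro subsetD[OF e(2)]) simp
  from le[OF this] have "inner \<mu> (z - x) + (e / 2 / norm \<mu>) * inner \<mu> \<mu> \<le> 0"
    by (simp add: y_def inner_diff_right inner_add_right)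
  moreover have "(e / 2 / norm \<mu>) * inner \<mu> \<mu> > 0" using \<mu> e by simp
  ultimately show ?thesis by linarith
qed

lemma unit_supporting_normal_exists:
  fixes G :: "'a::euclidean_space set"
  assumes "open G" "convex G" "G \<noteq> {}" "x \<notin> G"
  obtains \<mu> where "norm \<mu> = 1" "\<And>y. y \<in> G \<Longrightarrow> inner \<mu> (y - x) < 0"
proof -
  obtain a b where a: "a \<noteq> 0" "\<And>y. y \<in> G \<Longrightarrow> inner a y \<le> b" "inner a x \<ge> b"
    using separating_hyperplane_sets[of G "{x}"] assms by auto
  have le: "inner (sgn a) (y - x) \<le> 0" if "y \<in> G" for y
    using a(2)[OF that] a(1,3)
    by (auto simp: sgn_div_norm inner_diff_right intro!: mult_nonneg_nonpos)
  show ?thesis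
    by (rule that[of "sgn a"])
       (use a(1) open_inner_neg[OF assms(1) _ le] in \<open>auto simp: norm_sgn sgn_zero_iff\<close>)
qed

lemma Schwarz_Lemma_ball:
  assumes hol: "f holomorphic_on ball 0 r" and f0: "f 0 = 0" and r: "0 < r" and B: "0 < B"
    and le: "\<And>z. cmod z < r \<Longrightarrow> cmod (f z) < B" and \<xi>: "cmod \<xi> < r"
  shows "cmod (f \<xi>) \<le> B * cmod \<xi> / r"
proof -
  define h where "h z = f (of_real r * z) / of_real B" for z
  have "h holomorphic_on ball 0 1"
    unfolding h_def
    by (intro holomorphic_intros holomorphic_on_compose_gen[OF _ hol, unfolded o_def])
       (use r B in \<open>auto simp: norm_mult\<close>)
  moreover have "h 0 = 0" by (simp add: h_def f0)
  moreover have "cmod (h z) < 1" if "cmod z < 1" for z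
    using le[of "of_real r * z"] that r B by (simp add: h_def norm_mult norm_divide)
  moreover have "cmod (\<xi> / of_real r) < 1" using \<xi> r by (simp add: norm_divide)
  ultimately have "cmod (h (\<xi> / of_real r)) \<le> cmod (\<xi> / of_real r)"
    by (rule Schwarz_Lemma(1))
  then have "cmod (f \<xi>) / B \<le> cmod \<xi> / r" using r B by (simp add: h_def norm_divide)
  then show ?thesis using B by (simp add: pos_divide_le_eq mult.commute)
qed

text \<open>\<open>H q\<close> is the complex linear form of a supporting hyperplane of the convex
  model at \<open>\<Psi> q\<close>, pulled back by \<open>\<Psi>\<close>. Holomorphy is stated along
  curves, the form in which discs use it. The last property comes from compactness: a sequence of
  violations produces in the limit a frontier point other than \<open>\<Psi> p\<close> in the
  complex tangent space at \<open>\<Psi> p\<close>, contrary to \<open>\<complex>\<close>-strict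
  convexity.\<close>

lemma supporting_functions_exist:
  fixes \<Omega> :: "(complex^'n) set"
  assumes "C_strictly_convexifiable_point \<Omega> p" and openW: "open W" and pW: "p \<in> W"
  obtains R L and H :: "complex^'n \<Rightarrow> complex^'n \<Rightarrow> complex" where
    "0 < R" "0 < L" "ball p R \<subseteq> W"
    "\<And>q (\<phi> :: complex \<Rightarrow> complex^'n) S. (\<And>i. (\<lambda>\<zeta>. \<phi> \<zeta> $ i) holomorphic_on S) \<Longrightarrow> open S \<Longrightarrow> \<phi> ` S \<subseteq> ball p R \<Longrightarrow>
        (\<lambda>\<zeta>. H q (\<phi> \<zeta>)) holomorphic_on S"
    "\<And>q x. q \<in> frontier \<Omega> \<Longrightarrow> q \<in> ball p R \<Longrightarrow> x \<in> \<Omega> \<Longrightarrow> x \<in> ball p R \<Longrightarrow> Re (H q x) < 0"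
    "\<And>q x. q \<in> frontier \<Omega> \<Longrightarrow> q \<in> ball p R \<Longrightarrow> x \<in> ball p R \<Longrightarrow> cmod (H q x) \<le> L * dist q x"
    "\<And>\<epsilon> R'. 0 < \<epsilon> \<Longrightarrow> R' < R \<Longrightarrow> \<exists>c>0. \<exists>\<eta>>0. \<eta> \<le> R \<and>
        (\<forall>q x. q \<in> frontier \<Omega> \<longrightarrow> q \<in> ball p \<eta> \<longrightarrow> x \<in> \<Omega> \<longrightarrow> \<epsilon> \<le> dist p x \<longrightarrow> dist p x \<le> R' \<longrightarrow> c \<le> cmod (H q x))"
proof -
  obtain U \<Psi> where U: "open U" "p \<in> U" and emb: "holomorphic_embedding U \<Psi>"
    and G: "domain_set (\<Psi> ` (\<Omega> \<inter> U))" "convex (\<Psi> ` (\<Omega> \<inter> U))"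
    and strict: "C_strictly_convex_point (\<Psi> ` (\<Omega> \<inter> U)) (\<Psi> p)"
    using assms(1) unfolding C_strictly_convexifiable_point_def by blast
  have pfr: "p \<in> frontier \<Omega>" using assms(1) by (simp add: C_strictly_convexifiable_point_def)
  define G where "G = \<Psi> ` (\<Omega> \<inter> U)"
  have G: "open G" "convex G" "G \<noteq> {}" using G by (auto simp: G_def domain_set_def)
  have \<Psi>d: "\<exists>D. (\<Psi> has_derivative D) (at z) \<and> (\<forall>c v. D (c *s v) = c *s D v)" if "z \<in> U" for z
    using emb that unfolding holomorphic_embedding_def by blast
  have \<Psi>inj: "inj_on \<Psi> U"
    using emb unfolding holomorphic_embedding_def homeomorphism_def by (metis inj_on_inverseI)
  have \<Psi>cont: "continuous_on U \<Psi>"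
    using emb unfolding holomorphic_embedding_def homeomorphism_def by blast
  have openUW: "open (U \<inter> W)" "p \<in> U \<inter> W" using U openW pW by auto
  obtain e where e: "e > 0" "cball p e \<subseteq> U \<inter> W" using openUW open_contains_cball by blast
  have eU: "cball p e \<subseteq> U" using e by auto
  define R where "R = e / 2"
  have R: "R > 0" "ball p R \<subseteq> W" "ball p R \<subseteq> U" using e by (auto simp: R_def)
  have "compact (\<Psi> ` cball p e)"
    using \<Psi>cont eU by (intro compact_continuous_image) (auto intro: continuous_on_subset)
  then obtain M where M: "M > 0" "\<And>x. x \<in> cball p e \<Longrightarrow> norm (\<Psi> x) \<le> M"
    by (auto dest!: compact_imp_bounded simp: bounded_pos)
  have notG: "\<Psi> q \<notin> G" if "q \<in> U" "q \<notin> \<Omega>" for q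
    using that \<Psi>inj by (auto simp: G_def inj_on_def)
  \<comment> \<open>The choice of normals has no continuity in \<open>q\<close>; limits are taken
    only along subsequences, using that the normals are unit vectors.\<close>
  define \<mu> where "\<mu> q = (SOME m. norm m = 1 \<and> (\<forall>y\<in>G. inner m (y - \<Psi> q) < 0))" for q
  have \<mu>: "norm (\<mu> q) = 1" "\<And>y. y \<in> G \<Longrightarrow> inner (\<mu> q) (y - \<Psi> q) < 0" if "q \<in> U" "q \<notin> \<Omega>" for q
  proof -
    have "\<exists>m. norm m = 1 \<and> (\<forall>y\<in>G. inner m (y - \<Psi> q) < 0)"
      using unit_supporting_normal_exists[OF G notG[OF that]] by metis
    from someI_ex[OF this] show "norm (\<mu> q) = 1" "\<And>y. y \<in> G \<Longrightarrow> inner (\<mu> q) (y - \<Psi> q) < 0"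
      by (auto simp: \<mu>_def)
  qed
  define H where "H q x = cdot (\<mu> q) (\<Psi> x - \<Psi> q)" for q x
  have H\<phi>: "(\<lambda>\<zeta>. H q (\<phi> \<zeta>)) holomorphic_on S"
    if "\<And>i. (\<lambda>\<zeta>. \<phi> \<zeta> $ i) holomorphic_on S" "open S" "\<phi> ` S \<subseteq> U" for q S and \<phi> :: "complex \<Rightarrow> complex^'n"
  proof -
    have "(\<lambda>\<zeta>. \<Psi> (\<phi> \<zeta>) $ i) holomorphic_on S" for i
      using holomorphic_on_compose_complex_differentiable[OF that \<Psi>d] .
    then show ?thesis
      unfolding H_def cdot_def by (auto intro!: holomorphic_intros)
  qed
  have frnot: "q \<notin> \<Omega>" if "q \<in> frontier \<Omega>" "q \<in> U" for q
  proof
    assume q: "q \<in> \<Omega>"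
    have "\<Omega> \<inter> U = U \<inter> \<Psi> -` G" using \<Psi>inj by (auto simp: G_def inj_on_def)
    then have "open (\<Omega> \<inter> U)" using continuous_open_preimage[OF \<Psi>cont U(1) G(1)] by simp
    then have "q \<in> interior \<Omega>" using q that(2) by (meson IntI Int_lower1 interior_maximal subsetD)
    then show False using that(1) by (simp add: frontier_def)
  qed
  \<comment> \<open>\<open>L\<close> is \<open>(2 * M + 1) / R\<close>: a bound for
    \<open>H q\<close> on \<open>cball p e\<close> over the radius \<open>R = e / 2\<close> of the
    complex discs about \<open>q\<close> that stay in that ball. The summand \<open>1\<close> makes
    the bound strict, as the Schwarz lemma requires.\<close>
  define L where "L = (2 * M + 1) * 2 / e"
  have L: "L > 0" using M e by (simp add: L_def)
  have lip: "cmod (H q x) \<le> L * dist q x" if q: "q \<in> frontier \<Omega>" "q \<in> ball p R" and x: "x \<in> ball p R" for q x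
  proof -
    have qe: "q \<in> cball p e" "x \<in> cball p e" using q(2) x e(1) by (auto simp: R_def)
    have bd: "cmod (H q y) < 2 * M + 1" if "y \<in> cball p e" for y
    proof -
      have "cmod (H q y) \<le> norm (\<mu> q) * norm (\<Psi> y - \<Psi> q)" unfolding H_def by (rule norm_cdot_le)
      also have "\<dots> = norm (\<Psi> y - \<Psi> q)" using \<mu>(1)[of q] frnot q(1) qe(1) eU by auto
      also have "\<dots> \<le> M + M" using M(2)[OF that] M(2)[OF qe(1)] by norm
      finally show ?thesis by simp
    qed
    show ?thesis
    proof (cases "x = q")
      case True
      then show ?thesis by (simp add: H_def cdot_def)
    next
      case False
      define u where "u = of_real (1 / dist q x) *s (x - q)"
      have d: "dist q x > 0" using False by simp
      have u: "norm u = 1"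
        using d unfolding u_def norm_vector_scalar_mult 
        by (simp add: dist_norm norm_minus_commute norm_divide)
      define \<phi> where "\<phi> \<zeta> = q + \<zeta> *s u" for \<zeta>
      have \<phi>ball: "\<phi> \<zeta> \<in> cball p e" if "cmod \<zeta> < R" for \<zeta>
      proof -
        have "dist p (\<phi> \<zeta>) \<le> dist p q + dist q (\<phi> \<zeta>)" by (rule dist_triangle)
        also have "dist q (\<phi> \<zeta>) = cmod \<zeta>" by (simp add: \<phi>_def dist_norm norm_vector_scalar_mult u)
        finally show ?thesis using that q(2) by (simp add: R_def)
      qed
      have \<phi>d: "\<phi> (of_real (dist q x)) = x"
        using d by (simp add: \<phi>_def u_def vector_smult_assoc flip: of_real_mult)
      show ?thesis
      proof (cases "dist q x < R")
        case True
        have "cmod (H q (\<phi> (of_real (dist q x)))) \<le> (2 * M + 1) * cmod (of_real (dist q x)) / R"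
        proof (rule Schwarz_Lemma_ball[where f = "\<lambda>\<zeta>. H q (\<phi> \<zeta>)"])
          show "(\<lambda>\<zeta>. H q (\<phi> \<zeta>)) holomorphic_on ball 0 R"
            by (rule H\<phi>) (use \<phi>ball eU in \<open>auto simp: \<phi>_def intro!: holomorphic_intros\<close>)
          show "H q (\<phi> 0) = 0" by (simp add: H_def \<phi>_def cdot_def)
        qed (use M R True bd \<phi>ball in auto)
        then show ?thesis unfolding \<phi>d by (simp add: L_def R_def algebra_simps)
      next
        case False
        have "cmod (H q x) \<le> 2 * M + 1" using bd[OF qe(2)] by simp
        also have "\<dots> = L * R" using e by (simp add: L_def R_def)
        also have "\<dots> \<le> L * dist q x" using False L by (intro mult_left_mono) auto
        finally show ?thesis .
      qed
    qed
  qed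
  \<comment> \<open>The tangent space would be empty for a boundary that is not
    \<open>C\<^sup>1\<close> near \<open>\<Psi> p\<close>. As it contains \<open>\<Psi> p\<close>, a
    local defining function exists.\<close>
  obtain V r g where ldf: "local_defining_function G V r g" and PV: "\<Psi> p \<in> V" "\<Psi> p \<in> frontier G"
    and tang: "frontier G \<inter> complex_tangent_space G (\<Psi> p) = {\<Psi> p}"
  proof -
    have *: "\<Psi> p \<in> frontier G" "frontier G \<inter> complex_tangent_space G (\<Psi> p) = {\<Psi> p}"
      using strict by (auto simp: C_strictly_convex_point_def G_def)
    then have "\<Psi> p \<in> complex_tangent_space G (\<Psi> p)" by blast
    then show ?thesis
      using that * unfolding complex_tangent_space_def real_tangent_vectors_def by blast
  qed
  have g0: "g (\<Psi> p) \<noteq> 0" using ldf PV by (auto simp: local_defining_function_def)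
  have away: "\<exists>c>0. \<exists>\<eta>>0. \<eta> \<le> R \<and>
        (\<forall>q x. q \<in> frontier \<Omega> \<longrightarrow> q \<in> ball p \<eta> \<longrightarrow> x \<in> \<Omega> \<longrightarrow> \<epsilon> \<le> dist p x \<longrightarrow> dist p x \<le> R' \<longrightarrow> c \<le> cmod (H q x))"
    if \<epsilon>: "0 < \<epsilon>" and R': "R' < R" for \<epsilon> R'
  proof (rule ccontr)
    assume neg: "\<not> ?thesis"
    define h where "h n = min R (1 / real (Suc n))" for n
    have h: "h n > 0" "h n \<le> R" "h n \<le> 1 / real (Suc n)" for n using R by (auto simp: h_def)
    have "\<exists>q x. q \<in> frontier \<Omega> \<and> q \<in> ball p (h n) \<and> x \<in> \<Omega> \<and> \<epsilon> \<le> dist p x \<and> dist p x \<le> R' \<and>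
        cmod (H q x) < 1 / real (Suc n)" for n
    proof (rule ccontr)
      assume "\<not> ?thesis"
      then have "\<forall>q x. q \<in> frontier \<Omega> \<longrightarrow> q \<in> ball p (h n) \<longrightarrow> x \<in> \<Omega> \<longrightarrow> \<epsilon> \<le> dist p x \<longrightarrow>
          dist p x \<le> R' \<longrightarrow> 1 / real (Suc n) \<le> cmod (H q x)"
        by (meson not_le)
      moreover have "1 / real (Suc n) > 0" by simp
      ultimately show False using neg h by blast
    qed
    then obtain q x where qx: "\<And>n. q n \<in> frontier \<Omega>" "\<And>n. q n \<in> ball p (h n)" "\<And>n. x n \<in> \<Omega>"
        "\<And>n. \<epsilon> \<le> dist p (x n)" "\<And>n. dist p (x n) \<le> R'" "\<And>n. cmod (H (q n) (x n)) < 1 / real (Suc n)"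
      by metis
    have qU: "q n \<in> U" "q n \<notin> \<Omega>" for n
    proof -
      show "q n \<in> U" using qx(2)[of n] h(2)[of n] R(3) by (auto simp: subset_iff)
      then show "q n \<notin> \<Omega>" using frnot qx(1) by blast
    qed
    have lim0: "(\<lambda>n. 1 / real (Suc n)) \<longlonglongrightarrow> 0" using LIMSEQ_inverse_real_of_nat by (simp add: inverse_eq_divide)
    have "(\<lambda>n. dist (q n) p) \<longlonglongrightarrow> 0"
    proof (rule tendsto_sandwich[OF _ _ tendsto_const lim0])
      show "\<forall>\<^sub>F n in sequentially. dist (q n) p \<le> 1 / real (Suc n)"
      proof (intro always_eventually allI)
        show "dist (q n) p \<le> 1 / real (Suc n)" for n
          using qx(2)[of n] h(3)[of n] unfolding mem_ball dist_commute[of _ p] by linarith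
      qed
    qed auto
    then have qlim: "q \<longlonglongrightarrow> p" using tendsto_dist_iff by blast
    have "compact (cball p R' \<times> sphere (0 :: complex^'n) 1)" by (intro compact_Times) auto
    then have "seq_compact (cball p R' \<times> sphere (0 :: complex^'n) 1)"
      by (simp add: compact_eq_seq_compact_metric)
    moreover have "\<forall>n. (x n, \<mu> (q n)) \<in> cball p R' \<times> sphere 0 1"
      using qx(5) \<mu>(1)[OF qU] by simp
    ultimately obtain l \<sigma> where l: "l \<in> cball p R' \<times> sphere 0 1" and \<sigma>: "strict_mono \<sigma>"
        and lim: "((\<lambda>n. (x n, \<mu> (q n))) \<circ> \<sigma>) \<longlonglongrightarrow> l"
      by (rule seq_compactE)
    obtain x0 m where lm: "l = (x0, m)" by (cases l)
    have xlim: "(\<lambda>n. x (\<sigma> n)) \<longlonglongrightarrow> x0" and mlim: "(\<lambda>n. \<mu> (q (\<sigma> n))) \<longlonglongrightarrow> m"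
      using tendsto_fst[OF lim] tendsto_snd[OF lim] by (auto simp: lm o_def)
    have m1: "norm m = 1" "x0 \<in> cball p R'" using l lm by auto
    have x0U: "x0 \<in> U" using m1(2) R' R(3) by (auto simp: subset_iff)
    have qlim': "(\<lambda>n. q (\<sigma> n)) \<longlonglongrightarrow> p"
      using LIMSEQ_subseq_LIMSEQ[OF qlim \<sigma>] by (simp add: o_def)
    have isC: "isCont \<Psi> y" if "y \<in> U" for y
      using \<Psi>cont U(1) that continuous_on_eq_continuous_at by blast
    have \<Psi>x: "(\<lambda>n. \<Psi> (x (\<sigma> n))) \<longlonglongrightarrow> \<Psi> x0" and \<Psi>q: "(\<lambda>n. \<Psi> (q (\<sigma> n))) \<longlonglongrightarrow> \<Psi> p"
      using isCont_tendsto_compose[OF isC[OF x0U] xlim] isCont_tendsto_compose[OF isC[OF U(2)] qlim'] by auto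
    have "(\<lambda>n. cmod (H (q (\<sigma> n)) (x (\<sigma> n)))) \<longlonglongrightarrow> cmod (cdot m (\<Psi> x0 - \<Psi> p))"
      unfolding H_def cdot_def using mlim \<Psi>x \<Psi>q by (intro tendsto_intros)
    moreover have "(\<lambda>n. cmod (H (q (\<sigma> n)) (x (\<sigma> n)))) \<longlonglongrightarrow> 0"
    proof (rule tendsto_sandwich[OF _ _ tendsto_const])
      show "(\<lambda>n. 1 / real (Suc (\<sigma> n))) \<longlonglongrightarrow> 0"
        using LIMSEQ_subseq_LIMSEQ[OF lim0 \<sigma>] by (simp add: o_def)
    qed (use qx(6) in \<open>auto intro!: always_eventually less_imp_le\<close>)
    ultimately have zero: "cdot m (\<Psi> x0 - \<Psi> p) = 0" using LIMSEQ_unique by fastforce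
    have mle: "inner m (y - \<Psi> p) \<le> 0" if "y \<in> G" for y
    proof (rule LIMSEQ_le_const2)
      show "(\<lambda>n. inner (\<mu> (q (\<sigma> n))) (y - \<Psi> (q (\<sigma> n)))) \<longlonglongrightarrow> inner m (y - \<Psi> p)"
        using mlim \<Psi>q by (intro tendsto_intros)
    qed (use \<mu>(2)[OF qU that] in \<open>auto intro: less_imp_le\<close>)
    have m0: "m \<noteq> 0" using m1(1) by auto
    have "\<Psi> x0 \<in> closure G"
    proof (rule closed_sequentially[OF closed_closure _ \<Psi>x])
      fix n
      have "x (\<sigma> n) \<in> U" using qx(5)[of "\<sigma> n"] R' R(3) by (auto simp: subset_iff)
      then show "\<Psi> (x (\<sigma> n)) \<in> closure G" 
        using qx(3) closure_subset[of G] by (auto simp: G_def)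
    qed
    moreover have "\<Psi> x0 \<notin> G"
      using open_inner_neg[OF G(1) m0 mle, of "\<Psi> x0"] Re_cdot[of m "\<Psi> x0 - \<Psi> p"] zero by auto
    ultimately have fr: "\<Psi> x0 \<in> frontier G" using G(1) by (simp add: frontier_def interior_open)
    \<comment> \<open>Directions along which the defining function decreases enter \<open>G\<close>,
      where \<open>inner m\<close> is non-positive. So \<open>m\<close> is a multiple of the
      gradient, and \<open>zero\<close> places \<open>\<Psi> x0\<close> in the complex tangent
      space.\<close>
    obtain k where k: "0 \<le> k" "m = k *\<^sub>R g (\<Psi> p)"
    proof (rule halfspace_normals_parallel[OF g0])
      fix u assume u: "inner (g (\<Psi> p)) u < 0"
      then have "inner (g (\<Psi> p)) u \<noteq> 0" by simp
      from local_defining_function_direction[OF ldf PV this] u obtain d where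
        d: "0 < d" "\<And>t. 0 < t \<Longrightarrow> t < d \<Longrightarrow> \<Psi> p + t *\<^sub>R u \<in> G" by metis
      have "inner m ((\<Psi> p + (d/2) *\<^sub>R u) - \<Psi> p) \<le> 0" using d by (intro mle) auto
      then show "inner m u \<le> 0" using d by (simp add: mult_le_0_iff)
    qed blast
    have "k \<noteq> 0" using k(2) m0 by auto
    have tv: "v \<in> real_tangent_vectors G (\<Psi> p)" if "inner m v = 0" for v
      using that k \<open>k \<noteq> 0\<close> ldf PV unfolding real_tangent_vectors_def by auto
    have "\<Psi> x0 - \<Psi> p \<in> real_tangent_vectors G (\<Psi> p)"
      "\<i> *s (\<Psi> x0 - \<Psi> p) \<in> real_tangent_vectors G (\<Psi> p)"
      using zero cdot_vector_scalar_mult[of m \<i> "\<Psi> x0 - \<Psi> p"] by (auto intro!: tv simp flip: Re_cdot)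
    then have "\<Psi> p + (\<Psi> x0 - \<Psi> p) \<in> complex_tangent_space G (\<Psi> p)"
      unfolding complex_tangent_space_def by blast
    then have "\<Psi> x0 = \<Psi> p" using fr tang by auto
    then have "x0 = p" using \<Psi>inj x0U U(2) by (auto simp: inj_on_def)
    moreover have "\<epsilon> \<le> dist p x0"
      using xlim by (intro LIMSEQ_le_const[where X = "\<lambda>n. dist p (x (\<sigma> n))"] tendsto_intros) (use qx in auto)
    ultimately show False using \<epsilon> by simp
  qed
  show ?thesis
  proof (rule that[OF R(1) L R(2)])
    show "(\<lambda>\<zeta>. H q (\<phi> \<zeta>)) holomorphic_on S"
      if "\<And>i. (\<lambda>\<zeta>. \<phi> \<zeta> $ i) holomorphic_on S" "open S" "\<phi> ` S \<subseteq> ball p R"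
      for q S and \<phi> :: "complex \<Rightarrow> complex^'n"
      using H\<phi> that R(3) by blast
    show "Re (H q x) < 0" if "q \<in> frontier \<Omega>" "q \<in> ball p R" "x \<in> \<Omega>" "x \<in> ball p R" for q x
      unfolding H_def Re_cdot using that R(3) frnot by (intro \<mu>) (auto simp: G_def)
  qed (use lip away in blast)+
qed

subsection \<open>The Dini condition\<close>

text \<open>The integral becomes a dyadic sum: on the interval from \<open>1 / 2 ^ Suc k\<close> to
  \<open>1 / 2 ^ k\<close> the integrand is at least
  \<open>\<omega> (1 / 2 ^ Suc k) * 2 ^ k\<close>, which contributes at least
  \<open>\<omega> (1 / 2 ^ Suc k) / 2\<close>. The bound \<open>B\<close> keeps the modulus finite,
  so that it can be real-valued.\<close>

lemma dini_modulus:
  fixes f :: "'a::metric_space \<Rightarrow> 'b::metric_space"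
  assumes dini: "dini_continuous_on S f" and bd: "\<And>x y. x \<in> S \<Longrightarrow> y \<in> S \<Longrightarrow> dist (f x) (f y) \<le> B"
  obtains \<omega> :: "real \<Rightarrow> real" where "mono \<omega>" "\<And>t. 0 \<le> \<omega> t"
    "\<And>x y. x \<in> S \<Longrightarrow> y \<in> S \<Longrightarrow> dist (f x) (f y) \<le> \<omega> (dist x y)"
    "summable (\<lambda>k. \<omega> (1 / 2 ^ k))"
proof -
  define m where "m t = modulus_of_continuity S f t" for t
  define \<omega> where "\<omega> t = enn2real (m t)" for t
  have mB: "m t \<le> ennreal B" for t
    unfolding m_def modulus_of_continuity_def using bd by (intro SUP_least) (auto intro: ennreal_leI)
  have m\<omega>: "m t = ennreal (\<omega> t)" for t
    using mB[of t] unfolding \<omega>_def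
    by (metis ennreal_enn2real ennreal_less_top order_le_less_trans)
  have mono_m: "m s \<le> m t" if "s \<le> t" for s t
    unfolding m_def modulus_of_continuity_def using that by (intro SUP_subset_mono) auto
  have \<omega>0: "0 \<le> \<omega> t" for t by (simp add: \<omega>_def)
  have mono: "mono \<omega>"
    using mono_m \<omega>0 by (intro monoI) (simp add: m\<omega>)
  have le: "dist (f x) (f y) \<le> \<omega> (dist x y)" if "x \<in> S" "y \<in> S" for x y
  proof -
    have "ennreal (dist (f x) (f y)) \<le> m (dist x y)"
      unfolding m_def modulus_of_continuity_def
      by (rule SUP_upper2[of "(x, y)"]) (use that in auto)
    then show ?thesis using \<omega>0 by (simp add: m\<omega>)
  qed
  define I where "I k = {1 / 2 ^ Suc k <.. 1 / 2 ^ k :: real}" for k :: nat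
  have "I i \<inter> I j = {}" if "i < j" for i j
  proof -
    have "(1 / 2 :: real) ^ j \<le> (1 / 2) ^ Suc i" using that by (intro power_decreasing) auto
    then show ?thesis by (auto simp: I_def power_one_over)
  qed
  then have dis: "disjoint_family I"
    unfolding disjoint_family_on_def by (metis Int_commute nat_neq_iff)
  let ?w = "\<lambda>k. \<omega> (1 / 2 ^ Suc k)"
  have "(\<Sum>k. ennreal (?w k / 2)) \<le> (\<integral>\<^sup>+t\<in>{0<..1}. (m t / ennreal t) \<partial>lborel)"
  proof -
    define c where "c k = ennreal (?w k * 2 ^ k)" for k
    have ck: "(\<integral>\<^sup>+t. c k * indicator (I k) t \<partial>lborel) = ennreal (?w k / 2)" for k
    proof -
      have "(\<integral>\<^sup>+t. c k * indicator (I k) t \<partial>lborel) = c k * emeasure lborel (I k)"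
        by (rule nn_integral_cmult_indicator) (simp add: I_def)
      also have "emeasure lborel (I k) = ennreal (1 / 2 ^ k - 1 / 2 ^ Suc k)"
        unfolding I_def by (rule emeasure_lborel_Ioc) (simp add: field_simps)
      also have "c k * ennreal (1 / 2 ^ k - 1 / 2 ^ Suc k) =
          ennreal (?w k * 2 ^ k * (1 / 2 ^ k - 1 / 2 ^ Suc k))"
        unfolding c_def using \<omega>0 by (intro ennreal_mult[symmetric]) (auto simp: field_simps)
      also have "?w k * 2 ^ k * (1 / 2 ^ k - 1 / 2 ^ Suc k) = ?w k / 2"
        by (simp add: field_simps)
      finally show ?thesis .
    qed
    have "(\<Sum>k. c k * indicator (I k) t) \<le> m t / ennreal t * indicator {0<..1} t" for t
    proof (cases "\<exists>k. t \<in> I k")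
      case True
      then obtain k where k: "t \<in> I k" by blast
      have t: "1 / 2 ^ Suc k < t" "t \<le> 1 / 2 ^ k" using k by (auto simp: I_def)
      have t0: "0 < t" using t(1) by (meson less_trans zero_less_divide_1_iff zero_less_numeral zero_less_power)
      have t1: "t \<le> 1" using t(2) order_trans[of t "1 / 2 ^ k" 1] by (simp add: field_simps)
      have "(\<Sum>k. c k * indicator (I k) t) = c k" by (rule suminf_cmult_indicator[OF dis k])
      also have "?w k * 2 ^ k \<le> \<omega> t / t"
      proof -
        have "2 ^ k \<le> 1 / t" using t(2) t0 by (simp add: field_simps)
        then have "?w k * 2 ^ k \<le> \<omega> t * (1 / t)"
          using monoD[OF mono less_imp_le[OF t(1)]] \<omega>0 by (intro mult_mono) auto
        then show ?thesis by simp
      qed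
      then have "c k \<le> ennreal (\<omega> t / t)" unfolding c_def by (rule ennreal_leI)
      also have "\<dots> = m t / ennreal t * indicator {0<..1} t"
        using t0 t1 \<omega>0 by (simp add: m\<omega> divide_ennreal)
      finally show ?thesis .
    next
      case False
      then have "(\<Sum>k. c k * indicator (I k) t) = 0" by (simp add: indicator_def)
      then show ?thesis by simp
    qed
    then have "(\<integral>\<^sup>+t. (\<Sum>k. c k * indicator (I k) t) \<partial>lborel) \<le>
        (\<integral>\<^sup>+t\<in>{0<..1}. (m t / ennreal t) \<partial>lborel)"
      by (intro nn_integral_mono)
    also have "(\<integral>\<^sup>+t. (\<Sum>k. c k * indicator (I k) t) \<partial>lborel) = (\<Sum>k. \<integral>\<^sup>+t. c k * indicator (I k) t \<partial>lborel)"
      by (rule nn_integral_suminf) (simp add: I_def)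
    finally show ?thesis by (simp only: ck)
  qed
  also have "\<dots> < \<infinity>" using dini by (simp add: dini_continuous_on_def m_def)
  finally have "(\<Sum>k. ennreal (?w k / 2)) \<noteq> top" by auto
  then have "summable (\<lambda>k. ?w k / 2)"
    using \<omega>0 by (intro summable_suminf_not_top) auto
  then have "summable (\<lambda>k. 2 * (?w k / 2))" by (rule summable_mult)
  then have "summable (\<lambda>k. ?w k)" by simp
  then have "summable (\<lambda>k. \<omega> (1 / 2 ^ k))" by (subst (asm) summable_Suc_iff)
  with that mono \<omega>0 le show ?thesis by blast
qed

text \<open>\<open>f \<zeta> = \<zeta> * (1 + g \<zeta>)\<close> with \<open>g \<zeta> = 40 * (\<Sum>j. \<omega> (4 / 2 ^ j) / (1 - 2 ^ j * \<zeta>))\<close>, summed over large \<open>j\<close>: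
  the \<open>j\<close>-th term bends the image of the half-plane inwards at scale \<open>2 ^ -j\<close>, and the Dini condition is
  exactly what keeps \<open>g\<close> bounded.\<close>

lemma dini_halfplane_function:
  fixes \<omega> :: "real \<Rightarrow> real"
  assumes mono: "mono \<omega>" and \<omega>0: "\<And>t. 0 \<le> \<omega> t" and sum: "summable (\<lambda>k. \<omega> (1 / 2 ^ k))"
  obtains \<rho> :: real and f :: "complex \<Rightarrow> complex" and h :: "real \<Rightarrow> real" where "0 < \<rho>"
    "f holomorphic_on {\<zeta>. Re \<zeta> < 0}"
    "continuous_on {0<..} h" "\<And>x. 0 < x \<Longrightarrow> x \<le> h x \<and> h x \<le> 2 * x"
    "\<And>x. 0 < x \<Longrightarrow> f (- of_real x) = - of_real (h x)"
    "\<And>\<zeta>. Re \<zeta> < 0 \<Longrightarrow> cmod (f \<zeta>) \<le> 2 * cmod \<zeta>"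
    "\<And>\<zeta>. Re \<zeta> < 0 \<Longrightarrow> cmod \<zeta> < \<rho> \<Longrightarrow> cmod (f \<zeta>) * \<omega> (cmod (f \<zeta>)) < - Re (f \<zeta>)"
proof -
  \<comment> \<open>The argument has to dominate \<open>cmod (f \<zeta>)\<close>, which is at most
    three times the dyadic scale of \<open>\<zeta>\<close> in question; with the power of two
    \<open>4\<close> the Dini sum is merely shifted by two indices.\<close>
  define c where "c j = \<omega> (4 / 2 ^ j)" for j
  have "c (j + 2) = \<omega> (1 / 2 ^ j)" for j by (simp add: c_def)
  then have c_sum: "summable c" using sum summable_iff_shift[of c 2] by simp
  have "\<forall>\<^sub>F n in sequentially. (\<Sum>j. c (j + n)) < 1 / 80"
    using suminf_exist_split2[OF c_sum] by (rule order_tendstoD) simp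
  then obtain K where K: "(\<Sum>j. c (j + K)) < 1 / 80"
    by (auto simp: eventually_sequentially)
  \<comment> \<open>The factor \<open>40\<close> makes the gain
    \<open>a j * \<bar>y\<bar> / 10\<close> below exceed
    \<open>3 * \<bar>y\<bar> * \<omega>\<close>. Against it, the tail bound \<open>1 / 80\<close>
    gives a sum of at most \<open>1/2\<close>, so that \<open>f\<close> stays comparable to the
    identity.\<close>
  define a where "a j = 40 * c (j + K)" for j
  define b :: "nat \<Rightarrow> real" where "b j = 2 ^ (j + K)" for j
  have a0: "0 \<le> a j" for j using \<omega>0 by (simp add: a_def c_def)
  have b0: "0 < b j" for j by (simp add: b_def)
  have c_sum': "summable (\<lambda>j. c (j + K))" using c_sum summable_iff_shift by blast
  have a_sum: "summable a" unfolding a_def by (intro summable_mult c_sum')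
  have a_le: "(\<Sum>j. a j) \<le> 1 / 2"
    unfolding a_def using suminf_mult[OF c_sum', of 40] K by simp
  define T where "T j \<zeta> = of_real (a j) / (1 - of_real (b j) * \<zeta>)" for j and \<zeta> :: complex
  define g where "g \<zeta> = (\<Sum>j. T j \<zeta>)" for \<zeta>
  let ?d = "\<lambda>j \<zeta>. 1 - of_real (b j) * \<zeta> :: complex"
  have den: "1 \<le> cmod (?d j \<zeta>)" if "Re \<zeta> < 0" for j \<zeta>
  proof -
    have "1 \<le> Re (?d j \<zeta>)"
      using that b0[of j] by (simp add: mult_nonneg_nonpos)
    also have "\<dots> \<le> cmod (?d j \<zeta>)" by (rule complex_Re_le_cmod)
    finally show ?thesis .
  qed
  have T_le: "cmod (T j \<zeta>) \<le> a j" if "Re \<zeta> < 0" for j \<zeta>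
    using den[OF that, of j] a0[of j] by (simp add: T_def norm_divide divide_le_eq mult_le_cancel_left1)
  have T_sum: "summable (\<lambda>j. T j \<zeta>)" if "Re \<zeta> < 0" for \<zeta>
    by (rule summable_comparison_test'[OF a_sum, of 0]) (use T_le[OF that] in auto)
  have g_le: "cmod (g \<zeta>) \<le> 1 / 2" if "Re \<zeta> < 0" for \<zeta>
  proof -
    have ns: "summable (\<lambda>j. cmod (T j \<zeta>))"
      by (rule summable_comparison_test'[OF a_sum, of 0]) (use T_le[OF that] in auto)
    have "cmod (g \<zeta>) \<le> (\<Sum>j. cmod (T j \<zeta>))" unfolding g_def by (rule summable_norm[OF ns])
    also have "\<dots> \<le> (\<Sum>j. a j)" using T_le[OF that] ns a_sum by (intro suminf_le) auto
    finally show ?thesis using a_le by simp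
  qed
  let ?L = "{\<zeta>. Re \<zeta> < 0}"
  have L: "open ?L" by (rule open_halfspace_Re_lt)
  have Thol: "T j holomorphic_on ?L" for j
    unfolding T_def 
  proof (intro holomorphic_intros)
    fix \<zeta> assume "\<zeta> \<in> {\<zeta>. Re \<zeta> < 0}"
    then have "1 \<le> cmod (?d j \<zeta>)" using den by simp
    then show "?d j \<zeta> \<noteq> 0" by auto
  qed
  have g_hol: "g holomorphic_on ?L"
  proof (rule holomorphic_uniform_sequence[OF L])
    show "(\<lambda>\<zeta>. \<Sum>j<n. T j \<zeta>) holomorphic_on ?L" for n by (intro holomorphic_intros Thol)
    fix x assume "x \<in> ?L"
    then obtain d where d: "0 < d" "cball x d \<subseteq> ?L" using L open_contains_cball by blast
    have "uniform_limit (cball x d) (\<lambda>n \<zeta>. \<Sum>j<n. T j \<zeta>) (\<lambda>\<zeta>. \<Sum>j. T j \<zeta>) sequentially"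
      by (rule Weierstrass_m_test[OF _ a_sum]) (use T_le d in blast)
    then show "\<exists>d>0. cball x d \<subseteq> ?L \<and> uniform_limit (cball x d) (\<lambda>n \<zeta>. \<Sum>j<n. T j \<zeta>) g sequentially"
      using d unfolding g_def by blast
  qed
  define f where "f \<zeta> = \<zeta> * (1 + g \<zeta>)" for \<zeta>
  have f_hol: "f holomorphic_on ?L" unfolding f_def by (intro holomorphic_intros g_hol)
  have f_le: "cmod (f \<zeta>) \<le> 3 / 2 * cmod \<zeta>" if "Re \<zeta> < 0" for \<zeta>
  proof -
    have "cmod (1 + g \<zeta>) \<le> 3 / 2" using g_le[OF that] norm_triangle_ineq[of 1 "g \<zeta>"] by simp
    then have "cmod \<zeta> * cmod (1 + g \<zeta>) \<le> cmod \<zeta> * (3 / 2)" by (intro mult_left_mono) auto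
    then show ?thesis by (simp add: f_def norm_mult mult.commute)
  qed
  have ReT: "Re (T j \<zeta>) = a j * (1 - b j * Re \<zeta>) / (cmod (?d j \<zeta>))\<^sup>2"
    and ImT: "Im (T j \<zeta>) = a j * (b j * Im \<zeta>) / (cmod (?d j \<zeta>))\<^sup>2" for j \<zeta>
    unfolding T_def Re_divide Im_divide cmod_power2 by simp_all
  have Re_g: "0 \<le> Re (g \<zeta>)" if "Re \<zeta> < 0" for \<zeta>
  proof -
    have "Re (g \<zeta>) = (\<Sum>j. Re (T j \<zeta>))" unfolding g_def by (rule bounded_linear.suminf[OF bounded_linear_Re T_sum[OF that]])
    also have "\<dots> \<ge> 0"
    proof (rule suminf_nonneg)
      show "summable (\<lambda>j. Re (T j \<zeta>))" using summable_Re T_sum that by blast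
      show "0 \<le> Re (T j \<zeta>)" for j
        unfolding ReT using a0[of j] b0[of j] that
        by (intro divide_nonneg_nonneg mult_nonneg_nonneg) (auto simp: mult_nonneg_nonpos intro: order_trans[of _ 0])
    qed
    finally show ?thesis .
  qed
  have Im_g: "Im \<zeta> * Im (T k \<zeta>) \<le> Im \<zeta> * Im (g \<zeta>)" "0 \<le> Im \<zeta> * Im (T k \<zeta>)" if "Re \<zeta> < 0" for \<zeta> k
  proof -
    have nn: "0 \<le> Im \<zeta> * Im (T j \<zeta>)" for j
    proof -
      have "Im \<zeta> * Im (T j \<zeta>) = a j * b j * (Im \<zeta>)\<^sup>2 / (cmod (?d j \<zeta>))\<^sup>2"
        unfolding ImT by (simp add: power2_eq_square algebra_simps)
      also have "\<dots> \<ge> 0" using a0[of j] b0[of j] by simp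
      finally show ?thesis .
    qed
    then show "0 \<le> Im \<zeta> * Im (T k \<zeta>)" .
    have smI: "summable (\<lambda>j. Im (T j \<zeta>))" using summable_Im T_sum that by blast
    have sm: "summable (\<lambda>j. Im \<zeta> * Im (T j \<zeta>))" by (rule summable_mult[OF smI])
    have "Im \<zeta> * Im (T k \<zeta>) = (\<Sum>j\<in>{k}. Im \<zeta> * Im (T j \<zeta>))" by simp
    also have "\<dots> \<le> (\<Sum>j. Im \<zeta> * Im (T j \<zeta>))" by (rule sum_le_suminf[OF sm]) (use nn in auto)
    also have "\<dots> = Im \<zeta> * (\<Sum>j. Im (T j \<zeta>))" by (rule suminf_mult[OF smI])
    also have "(\<Sum>j. Im (T j \<zeta>)) = Im (g \<zeta>)" unfolding g_def by (rule bounded_linear.suminf[OF bounded_linear_Im T_sum[OF that], symmetric])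
    finally show "Im \<zeta> * Im (T k \<zeta>) \<le> Im \<zeta> * Im (g \<zeta>)" .
  qed
  define h where "h x = x * (1 + Re (g (- of_real x)))" for x :: real
  have main: "cmod (f \<zeta>) * \<omega> (cmod (f \<zeta>)) < - Re (f \<zeta>)" if \<zeta>: "Re \<zeta> < 0" "cmod \<zeta> < 1 / 2 ^ K" for \<zeta>
  proof -
    define x y where "x = - Re \<zeta>" and "y = Im \<zeta>"
    have x: "0 < x" using \<zeta> by (simp add: x_def)
    have "- Re (f \<zeta>) = x + x * Re (g \<zeta>) + y * Im (g \<zeta>)"
      by (simp add: f_def x_def y_def algebra_simps)
    then have Ref: "x + y * Im (g \<zeta>) \<le> - Re (f \<zeta>)" using x Re_g[OF \<zeta>(1)] by simp
    have nz: "cmod \<zeta> \<le> x + \<bar>y\<bar>" using cmod_le[of \<zeta>] x by (simp add: x_def y_def)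
    show ?thesis
    proof (cases "\<bar>y\<bar> \<le> x")
      case True
      have "cmod (f \<zeta>) \<le> 3 * x" using f_le[OF \<zeta>(1)] nz True by linarith
      moreover have "\<omega> (cmod (f \<zeta>)) \<le> 1 / 80"
      proof -
        have "cmod (f \<zeta>) \<le> 4 * (1 / 2 ^ K)"
          using f_le[OF \<zeta>(1)] \<zeta>(2) norm_ge_zero[of \<zeta>] by linarith
        then have "cmod (f \<zeta>) \<le> 4 / 2 ^ (0 + K)" by simp
        then have "\<omega> (cmod (f \<zeta>)) \<le> a 0 / 40" using monoD[OF mono] by (simp add: a_def c_def)
        also have "a 0 \<le> (\<Sum>j. a j)" using sum_le_suminf[OF a_sum, of "{0}"] a0 by simp
        finally show ?thesis using a_le by simp
      qed
      ultimately have "cmod (f \<zeta>) * \<omega> (cmod (f \<zeta>)) \<le> 3 * x * (1 / 80)"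
        using \<omega>0 x by (intro mult_mono) auto
      also have "\<dots> < x" using x by simp
      also have "\<dots> \<le> - Re (f \<zeta>)" using Ref Im_g[OF \<zeta>(1), of 0] by (simp add: y_def)
      finally show ?thesis .
    next
      case False
      then have y: "0 < \<bar>y\<bar>" using x by auto
      have "\<bar>y\<bar> \<le> cmod \<zeta>" unfolding y_def by (rule abs_Im_le_cmod)
      then have yK: "\<bar>y\<bar> < 1 / 2 ^ K" using \<zeta>(2) by simp
      obtain N where N: "1 / 2 ^ (N + K) < \<bar>y\<bar>"
      proof -
        obtain N where "(1 / 2) ^ N < \<bar>y\<bar>" using real_arch_pow_inv[OF y, of "1/2"] by auto
        moreover have "1 / 2 ^ (N + K) \<le> (1 / 2 :: real) ^ N"
          by (simp add: power_add power_one_over field_simps)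
        ultimately show ?thesis using that by (meson order_le_less_trans)
      qed
      \<comment> \<open>The predecessor \<open>j\<close> of \<open>k\<close> is the scale with
        \<open>1/2 < b j * \<bar>y\<bar> \<le> 1\<close>. There the single term \<open>T j\<close>
        bends the image enough, because the contributions
        \<open>Im \<zeta> * Im (T i \<zeta>)\<close> of all other terms have the same sign.\<close>
      define k where "k = (LEAST k. 1 / 2 ^ (k + K) < \<bar>y\<bar>)"
      have k1: "1 / 2 ^ (k + K) < \<bar>y\<bar>" unfolding k_def by (rule LeastI[of _ N]) (rule N)
      have "k \<noteq> 0" using k1 yK by (metis add_0 less_asym)
      then obtain j where j: "k = Suc j" using not0_implies_Suc by blast
      have "\<not> 1 / 2 ^ (j + K) < \<bar>y\<bar>" using not_less_Least[of j "\<lambda>k. 1 / 2 ^ (k + K) < \<bar>y\<bar>"] j by (simp add: k_def)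
      then have byl: "b j * \<bar>y\<bar> \<le> 1" using b0[of j] by (simp add: b_def field_simps)
      have byg: "1 / 2 < b j * \<bar>y\<bar>" using k1 by (simp add: j b_def field_simps)
      have bx: "b j * x < 1" using byl False b0[of j] by (smt (verit) mult_strict_left_mono)
      define D where "D = (cmod (?d j \<zeta>))\<^sup>2"
      have D: "D = (1 + b j * x)\<^sup>2 + (b j * \<bar>y\<bar>)\<^sup>2"
        by (simp add: D_def cmod_power2 x_def y_def power_mult_distrib)
      have "D \<le> 2\<^sup>2 + 1\<^sup>2"
        unfolding D using bx byl byg x b0[of j] by (intro add_mono power_mono) auto
      moreover have "0 < D" unfolding D using byg by (intro add_nonneg_pos) auto
      moreover have "Im \<zeta> * Im (T j \<zeta>) = a j * ((b j * \<bar>y\<bar>) * \<bar>y\<bar>) / D"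
        unfolding ImT by (simp add: D_def y_def algebra_simps)
      ultimately have T5: "a j * ((b j * \<bar>y\<bar>) * \<bar>y\<bar>) / 5 \<le> Im \<zeta> * Im (T j \<zeta>)"
        using divide_left_mono[of D 5 "a j * ((b j * \<bar>y\<bar>) * \<bar>y\<bar>)"] a0[of j] b0[of j]
        by (simp add: mult_nonneg_nonneg)
      have "a j * (1 / 2 * \<bar>y\<bar>) / 5 \<le> a j * ((b j * \<bar>y\<bar>) * \<bar>y\<bar>) / 5"
        using byg y a0[of j] by (intro divide_right_mono mult_left_mono mult_right_mono) auto
      then have lower: "x + a j * \<bar>y\<bar> / 10 \<le> - Re (f \<zeta>)"
        using Ref T5 Im_g(1)[OF \<zeta>(1), of j] unfolding y_def by simp
      have f3: "cmod (f \<zeta>) \<le> 3 * \<bar>y\<bar>" using f_le[OF \<zeta>(1)] nz False by linarith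
      moreover have "\<omega> (cmod (f \<zeta>)) \<le> a j / 40"
      proof -
        have "\<bar>y\<bar> \<le> 1 / 2 ^ (j + K)" using byl b0[of j] by (simp add: b_def field_simps)
        then have "cmod (f \<zeta>) \<le> 4 / 2 ^ (j + K)" using f3 y by simp
        then show ?thesis using monoD[OF mono] by (simp add: a_def c_def)
      qed
      ultimately have "cmod (f \<zeta>) * \<omega> (cmod (f \<zeta>)) \<le> 3 * \<bar>y\<bar> * (a j / 40)"
        using \<omega>0 by (intro mult_mono) auto
      also have "\<dots> \<le> a j * \<bar>y\<bar> / 10" using a0[of j] y by simp
      also have "\<dots> < - Re (f \<zeta>)" using lower x by simp
      finally show ?thesis .
    qed
  qed
  show ?thesis
  proof (rule that[of "1 / 2 ^ K" f h])
    show "f holomorphic_on ?L" by (rule f_hol)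
    have "continuous_on {0<..} (\<lambda>x. g (- of_real x))"
      by (rule continuous_on_compose2[OF holomorphic_on_imp_continuous_on[OF g_hol]])
         (auto intro!: continuous_intros)
    then show "continuous_on {0<..} h" unfolding h_def by (intro continuous_intros)
    fix x :: real assume x: "0 < x"
    then have Rex: "Re (- of_real x :: complex) < 0" by simp
    have "Re (g (- of_real x)) \<le> 1 / 2" using g_le[OF Rex] complex_Re_le_cmod order_trans by blast
    then have "x * (1 + Re (g (- of_real x))) \<le> x * 2" using x by (intro mult_left_mono) auto
    then show "x \<le> h x \<and> h x \<le> 2 * x" using x Re_g[OF Rex] by (simp add: h_def)
    have "Im (g (- of_real x)) = (\<Sum>j. Im (T j (- of_real x)))"
      unfolding g_def by (rule bounded_linear.suminf[OF bounded_linear_Im T_sum[OF Rex]])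
    also have "\<dots> = 0" by (simp add: ImT)
    finally show "f (- of_real x) = - of_real (h x)"
      by (simp add: f_def h_def complex_eq_iff)
  next
    show "cmod (f \<zeta>) \<le> 2 * cmod \<zeta>" if "Re \<zeta> < 0" for \<zeta> 
      using f_le[OF that] norm_ge_zero[of \<zeta>] by linarith
  qed (use main in auto)
qed

subsection \<open>Upper bounds for the Kobayashi distance\<close>

text \<open>The segment from \<open>q\<close> to \<open>q + v\<close> starts inside; at its first exit point the
  derivative of \<open>r\<close> along \<open>v\<close> would be non-negative.\<close>

lemma dini_cone:
  assumes ldf: "local_defining_function \<Omega> V r g" and q: "q \<in> frontier \<Omega>"
    and seg: "\<And>s. 0 \<le> s \<Longrightarrow> s \<le> 1 \<Longrightarrow> q + s *\<^sub>R v \<in> V"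
    and \<omega>: "mono \<omega>" "\<And>x y. x \<in> frontier \<Omega> \<inter> V \<Longrightarrow> y \<in> frontier \<Omega> \<inter> V \<Longrightarrow> dist (sgn (g x)) (sgn (g y)) \<le> \<omega> (dist x y)"
    and v: "norm v * \<omega> (norm v) < - inner (sgn (g q)) v" "0 \<le> \<omega> (norm v)"
  shows "q + v \<in> \<Omega>"
proof (rule ccontr)
  assume nin: "q + v \<notin> \<Omega>"
  have qV: "q \<in> V" using seg[of 0] by simp
  have ldf': "\<And>x. x \<in> V \<Longrightarrow> GDERIV r x :> g x" "\<Omega> \<inter> V = {x\<in>V. r x < 0}"
      "frontier \<Omega> \<inter> V = {x\<in>V. r x = 0}" "\<And>x. x \<in> V \<Longrightarrow> g x \<noteq> 0"
    using ldf by (auto simp: local_defining_function_def)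
  have inn: "inner (g x) v = norm (g x) * inner (sgn (g x)) v" for x
    by (cases "g x = 0") (auto simp: sgn_div_norm)
  have "0 \<le> norm v * \<omega> (norm v)" using v(2) by simp
  then have "inner (sgn (g q)) v < 0" using v(1) by linarith
  then have "inner (g q) v < 0" unfolding inn using ldf'(4)[OF qV] by (simp add: mult_pos_neg)
  with local_defining_function_direction[OF ldf qV q, of v] obtain e where
    e: "0 < e" "\<And>t. 0 < t \<Longrightarrow> t < e \<Longrightarrow> q + t *\<^sub>R v \<in> \<Omega>" by (metis less_irrefl)
  \<comment> \<open>At \<open>q\<close> itself \<open>h\<close> vanishes, so the search for the
    first exit starts at a parameter \<open>d > 0\<close> where the segment is already
    inside.\<close>
  define d where "d = min (e / 2) 1"
  have d: "0 < d" "d < e" "d \<le> 1" using e by (auto simp: d_def)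
  define h where "h s = r (q + s *\<^sub>R v)" for s
  have hD: "(h has_real_derivative inner (g (q + s *\<^sub>R v)) v) (at s)" if "0 \<le> s" "s \<le> 1" for s
    unfolding h_def by (rule GDERIV_imp_DERIV_along) (use ldf'(1) seg that in auto)
  have hcont: "continuous_on {0..1} h"
    using hD by (intro continuous_at_imp_continuous_on ballI) (auto intro: DERIV_isCont)
  have hin: "h s < 0 \<longleftrightarrow> q + s *\<^sub>R v \<in> \<Omega>" if "0 \<le> s" "s \<le> 1" for s
    using ldf'(2) seg[OF that] by (auto simp: h_def)
  define S where "S = {s \<in> {d..1}. 0 \<le> h s}"
  have "closed S"
  proof -
    have "closed ({d..1} \<inter> h -` {0..})"
      using d by (intro continuous_closed_preimage continuous_on_subset[OF hcont]) auto
    moreover have "{d..1} \<inter> h -` {0..} = S" by (auto simp: S_def)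
    ultimately show ?thesis by simp
  qed
  have S1: "1 \<in> S" using hin[of 1] nin d by (simp add: S_def not_less)
  have bdd: "bdd_below S" by (rule bdd_belowI[of _ d]) (auto simp: S_def)
  define s1 where "s1 = Inf S"
  have s1S: "s1 \<in> S" unfolding s1_def using closed_contains_Inf[OF _ bdd \<open>closed S\<close>] S1 by blast
  have s1: "d \<le> s1" "s1 \<le> 1" "0 \<le> h s1" using s1S by (auto simp: S_def)
  have before: "h s < 0" if "0 < s" "s < s1" for s
  proof (cases "d \<le> s")
    case True
    have "s \<notin> S" using that(2) cInf_lower[OF _ bdd, of s] by (auto simp: s1_def)
    then show ?thesis using True that s1 by (auto simp: S_def)
  next
    case False
    then show ?thesis using hin[of s] e(2)[of s] that d by auto
  qed
  have hd: "h d < 0" using hin[of d] e(2)[of d] d by auto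
  then have "d < s1" using s1 by (cases "s1 = d") auto
  obtain s where s: "d \<le> s" "s \<le> s1" "h s = 0"
    using IVT'[of h d 0 s1] hd s1 d continuous_on_subset[OF hcont, of "{d..s1}"] by auto
  then have hs1: "h s1 = 0" using before[of s] d by (cases "s = s1") auto
  define x1 where "x1 = q + s1 *\<^sub>R v"
  have x1V: "x1 \<in> V" unfolding x1_def using s1 d seg by auto
  have "x1 \<in> frontier \<Omega>" using ldf'(3) x1V hs1 by (auto simp: h_def x1_def)
  have "0 \<le> inner (g x1) v"
  proof (rule ccontr)
    assume "\<not> ?thesis"
    then obtain t where t: "0 < t" "\<And>u. 0 < u \<Longrightarrow> u < t \<Longrightarrow> h s1 < h (s1 - u)"
      using DERIV_neg_dec_left[OF hD[of s1]] s1 d by (auto simp: x1_def)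
    have "h s1 < h (s1 - min (t/2) (s1/2))" using t s1 d by (intro t(2)) auto
    moreover have "h (s1 - min (t/2) (s1/2)) < 0" using t s1 d by (intro before) auto
    ultimately show False using hs1 by simp
  qed
  then have n1: "0 \<le> inner (sgn (g x1)) v"
    unfolding inn using ldf'(4)[OF x1V] by (simp add: zero_le_mult_iff)
  have dx: "dist x1 q \<le> norm v"
    using s1 d by (simp add: x1_def dist_norm mult_left_le_one_le)
  have "- inner (sgn (g q)) v = inner (sgn (g x1) - sgn (g q)) v - inner (sgn (g x1)) v"
    by (simp add: inner_diff_left)
  also have "\<dots> \<le> norm (sgn (g x1) - sgn (g q)) * norm v"
    using norm_cauchy_schwarz[of "sgn (g x1) - sgn (g q)" v] n1 by linarith
  also have "\<dots> \<le> \<omega> (norm v) * norm v"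
  proof (rule mult_right_mono)
    have "norm (sgn (g x1) - sgn (g q)) \<le> \<omega> (dist x1 q)"
      using \<omega>(2)[of x1 q] \<open>x1 \<in> frontier \<Omega>\<close> x1V q qV by (simp add: dist_norm)
    also have "\<dots> \<le> \<omega> (norm v)" using \<omega>(1) dx by (rule monoD)
    finally show "norm (sgn (g x1) - sgn (g q)) \<le> \<omega> (norm v)" .
  qed simp
  finally show False using v(1) by (simp add: mult.commute)
qed

lemma dist_frontier_le:
  fixes z :: "'a::euclidean_space"
  assumes "z \<in> \<Omega>" "y \<notin> \<Omega>" and le: "\<And>x. x \<in> frontier \<Omega> \<Longrightarrow> d \<le> dist z x"
  shows "d \<le> dist z y"
proof -
  have "closed_segment z y \<inter> frontier \<Omega> \<noteq> {}"
    using assms(1,2) by (intro connected_Int_frontier) auto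
  then obtain x where x: "x \<in> closed_segment z y" "x \<in> frontier \<Omega>" by blast
  have "d \<le> dist z x" using le x by blast
  also have "dist z x \<le> dist z y" using dist_in_closed_segment[OF x(1)] by (simp add: dist_commute)
  finally show ?thesis .
qed

text \<open>Moving from \<open>q\<close> in an outward direction \<open>u\<close> leaves
  \<open>\<Omega>\<close>, hence cannot come closer to \<open>z\<close>. Expanding the squared
  distance to first order in the step gives \<open>inner (z - q) u \<le> 0\<close> for all such
  \<open>u\<close>, which makes \<open>z - q\<close> a non-negative multiple of
  \<open>- g q\<close>.\<close>

lemma nearest_frontier_point_normal:
  assumes ldf: "local_defining_function \<Omega> V r g" and q: "q \<in> frontier \<Omega>" "q \<in> V"
    and z: "z \<in> \<Omega>" and near: "\<And>x. x \<in> frontier \<Omega> \<Longrightarrow> dist z q \<le> dist z x"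
  shows "z = q - dist z q *\<^sub>R sgn (g q)"
proof -
  have g0: "g q \<noteq> 0" using ldf q by (auto simp: local_defining_function_def)
  obtain k where k: "0 \<le> k" "z - q = k *\<^sub>R (- g q)"
  proof (rule halfspace_normals_parallel[of "- g q" "z - q"])
    fix u assume "inner (- g q) u < 0"
    then have "inner (g q) u \<noteq> 0" "\<not> inner (g q) u < 0" by auto
    with local_defining_function_direction[OF ldf q(2,1), of u] obtain e where
      e: "0 < e" "\<And>t. 0 < t \<Longrightarrow> t < e \<Longrightarrow> q + t *\<^sub>R u \<notin> \<Omega>" by metis
    have *: "2 * inner (z - q) u \<le> t * inner u u" if t: "0 < t" "t < e" for t
    proof -
      have "dist z q \<le> dist z (q + t *\<^sub>R u)" by (rule dist_frontier_le[OF z e(2)[OF t] near])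
      then have "(norm (z - q))\<^sup>2 \<le> (norm ((z - q) - t *\<^sub>R u))\<^sup>2"
        by (intro power_mono) (simp_all add: dist_norm diff_diff_eq)
      also have "\<dots> = (norm (z - q))\<^sup>2 - 2 * t * inner (z - q) u + t * t * inner u u"
        by (simp add: power2_norm_eq_inner inner_diff_left inner_diff_right inner_commute algebra_simps)
      finally have "t * (2 * inner (z - q) u) \<le> t * (t * inner u u)" by (simp add: algebra_simps)
      then show ?thesis using t by simp
    qed
    show "inner (z - q) u \<le> 0"
    proof (rule ccontr)
      assume n: "\<not> ?thesis"
      have uu: "0 \<le> inner u u" by simp
      define t where "t = min (e / 2) (inner (z - q) u / (inner u u + 1))"
      have "0 < inner u u + 1" using uu by linarith
      then have t: "0 < t" "t < e" using e n by (auto simp: t_def intro!: divide_pos_pos)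
      have "t * inner u u \<le> t * (inner u u + 1)" using t by simp
      also have "\<dots> \<le> inner (z - q) u / (inner u u + 1) * (inner u u + 1)"
        using uu by (intro mult_right_mono) (auto simp: t_def)
      also have "\<dots> = inner (z - q) u" using uu by (simp add: add_nonneg_eq_0_iff)
      finally show False using *[OF t] n by linarith
    qed
  qed (use g0 in auto)
  have "dist z q = k * norm (g q)" using k by (simp add: dist_norm)
  then have "dist z q *\<^sub>R sgn (g q) = k *\<^sub>R g q" using g0 by (simp add: sgn_div_norm)
  then show ?thesis using k(2) by (simp add: algebra_simps)
qed

lemma artanh_one_minus_le:
  fixes x :: real
  assumes "0 < x" "x < 1"
  shows "artanh (1 - x) \<le> ln (2 / x) / 2"
  unfolding artanh_def using assms by (intro divide_right_mono) (auto simp: field_simps)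

lemma kobayashi_le_ball:
  fixes X :: "(complex^'n) set"
  assumes X: "domain_set X" and b: "ball y s \<subseteq> X" and x: "dist y x \<le> s / 2" and s: "0 < s"
  shows "kobayashi X y x \<le> artanh (1 / 2)"
proof (cases "x = y")
  case True
  have "y \<in> X" using b s by auto
  then show ?thesis using True kobayashi_refl[OF X] by (simp add: artanh_nonneg)
next
  case False
  define u where "u = of_real (s / dist y x) *s (x - y)"
  have d: "0 < dist y x" using False by simp
  have nu: "norm u = s"
    using d s unfolding u_def norm_vector_scalar_mult
    by (simp add: norm_divide dist_norm norm_minus_commute)
  define \<phi> where "\<phi> \<zeta> = y + \<zeta> *s u" for \<zeta>
  have "analytic_disc X \<phi>"
    unfolding analytic_disc_def
  proof
    show "\<forall>i. (\<lambda>\<zeta>. \<phi> \<zeta> $ i) holomorphic_on ball 0 1"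
      by (auto simp: \<phi>_def intro!: holomorphic_intros)
    have "dist y (\<phi> \<zeta>) < s" if "cmod \<zeta> < 1" for \<zeta>
      using that s by (simp add: \<phi>_def dist_norm norm_vector_scalar_mult nu)
    then show "\<phi> ` ball 0 1 \<subseteq> X" using b by auto
  qed
  moreover have "\<phi> 0 = y" by (simp add: \<phi>_def)
  moreover have "\<phi> (of_real (dist y x / s)) = x"
  proof -
    have "of_real (dist y x / s) * of_real (s / dist y x) = (1 :: complex)"
      using d s by simp
    then show ?thesis by (simp add: \<phi>_def u_def vector_smult_assoc del: of_real_divide)
  qed
  moreover have "cmod (of_real (dist y x / s)) = dist y x / s" using s by (simp only: norm_of_real) simp
  moreover have xs: "dist y x / s \<le> 1 / 2" using x s by (simp add: field_simps)
  moreover from xs have "dist y x / s < 1" by linarith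
  ultimately have "disc_step X y x (dist y x / s)"
    unfolding disc_step_def by (intro exI[of _ \<phi>] exI[of _ "of_real (dist y x / s)"] conjI)
  then have "kobayashi X y x \<le> artanh (dist y x / s)" by (rule kobayashi_le_disc_step[OF X])
  also have "\<dots> \<le> artanh (1 / 2)" using xs s by (intro artanh_le_artanh) auto
  finally show ?thesis .
qed

text \<open>The scale \<open>\<rho>\<close> of the discs is free. A disc of this scale joins
  \<open>z\<close> to a base point on the inner normal at its nearest boundary point
  \<open>q\<close>, at cost \<open>ln (4 * \<rho> / dist z q) / 2\<close>, and moving from there to
  the base point over \<open>p\<close> costs at most \<open>C\<close> once \<open>q\<close> is close
  to \<open>p\<close>. Joining \<open>z\<close> to \<open>w\<close> thus contributes
  \<open>2 * C + ln (4 * \<rho>)\<close>, which is below \<open>- M\<close> for small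
  \<open>\<rho>\<close>.\<close>

lemma kobayashi_upper_bound_near:
  fixes \<Omega> :: "(complex^'n) set"
  assumes \<Omega>: "domain_set \<Omega>" and p: "p \<in> frontier \<Omega>" and dini: "dini_smooth_near \<Omega> p"
  obtains \<eta> where "0 < \<eta>"
    "\<And>z w. z \<in> \<Omega> \<Longrightarrow> w \<in> \<Omega> \<Longrightarrow> dist p z < \<eta> \<Longrightarrow> dist p w < \<eta> \<Longrightarrow>
       kobayashi \<Omega> z w \<le> ln (1 / infdist z (frontier \<Omega>)) / 2 + ln (1 / infdist w (frontier \<Omega>)) / 2 - M"
proof -
  obtain V r g where pV: "p \<in> V" and ldf: "local_defining_function \<Omega> V r g"
    and dc: "dini_continuous_on (frontier \<Omega> \<inter> V) (\<lambda>x. sgn (g x))"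
    using dini unfolding dini_smooth_near_def by blast
  define n where "n x = sgn (g x)" for x
  have V: "open V" and gcont: "continuous_on V g" and g0: "\<And>x. x \<in> V \<Longrightarrow> g x \<noteq> 0"
    using ldf by (auto simp: local_defining_function_def)
  have n1: "norm (n x) = 1" if "x \<in> V" for x using g0[OF that] by (simp add: n_def norm_sgn)
  have "dist (n x) (n y) \<le> 2" if "x \<in> frontier \<Omega> \<inter> V" "y \<in> frontier \<Omega> \<inter> V" for x y
    using norm_triangle_ineq4[of "n x" "n y"] n1 that by (simp add: dist_norm)
  from dini_modulus[OF dc this[unfolded n_def]] obtain \<omega> where
    \<omega>: "mono \<omega>" "\<And>t. 0 \<le> \<omega> t"
      "\<And>x y. x \<in> frontier \<Omega> \<inter> V \<Longrightarrow> y \<in> frontier \<Omega> \<inter> V \<Longrightarrow> dist (sgn (g x)) (sgn (g y)) \<le> \<omega> (dist x y)"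
      "summable (\<lambda>k. \<omega> (1 / 2 ^ k))" by blast
  from dini_halfplane_function[OF \<omega>(1,2,4)] obtain \<rho>0 f h where \<rho>0: "0 < \<rho>0"
    and f: "f holomorphic_on {\<zeta>. Re \<zeta> < 0}" and hcont: "continuous_on {0<..} h"
    and h: "\<And>x. 0 < x \<Longrightarrow> x \<le> h x \<and> h x \<le> 2 * x"
    and fh: "\<And>x. 0 < x \<Longrightarrow> f (- of_real x) = - of_real (h x)"
    and f2: "\<And>\<zeta>. Re \<zeta> < 0 \<Longrightarrow> cmod (f \<zeta>) \<le> 2 * cmod \<zeta>"
    and f\<omega>: "\<And>\<zeta>. Re \<zeta> < 0 \<Longrightarrow> cmod \<zeta> < \<rho>0 \<Longrightarrow> cmod (f \<zeta>) * \<omega> (cmod (f \<zeta>)) < - Re (f \<zeta>)"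
    by blast
  obtain e where e: "0 < e" "ball p e \<subseteq> V" using V pV open_contains_ball by blast
  define C where "C = artanh (1 / 2 :: real)"
  \<comment> \<open>The bound by \<open>e / 4\<close> keeps the segments of length up to
    \<open>2 * \<rho>\<close> in \<open>V\<close>; the exponential bound says
    \<open>2 * C + ln (4 * \<rho>) \<le> - M\<close>.\<close>
  define \<rho> where "\<rho> = min (min \<rho>0 (e / 4)) (exp (- M - 2 * C) / 4)"
  have \<rho>: "0 < \<rho>" "\<rho> \<le> \<rho>0" "\<rho> \<le> e / 4" "\<rho> \<le> exp (- M - 2 * C) / 4"
    using \<rho>0 e by (auto simp: \<rho>_def)
  have inside: "q + f \<zeta> *s n q \<in> \<Omega>"
    if q: "q \<in> frontier \<Omega>" "dist p q < e / 2" and \<zeta>: "Re \<zeta> < 0" "cmod \<zeta> < \<rho>" for q \<zeta>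
  proof -
    have qV: "q \<in> V" using q e by auto
    have nv: "norm (f \<zeta> *s n q) = cmod (f \<zeta>)" using n1[OF qV] by (simp add: norm_vector_scalar_mult)
    show ?thesis
    proof (rule dini_cone[OF ldf q(1) _ \<omega>(1,3)])
      fix s :: real assume s: "0 \<le> s" "s \<le> 1"
      have "dist p (q + s *\<^sub>R (f \<zeta> *s n q)) \<le> dist p q + dist q (q + s *\<^sub>R (f \<zeta> *s n q))"
        by (rule dist_triangle)
      also have "dist q (q + s *\<^sub>R (f \<zeta> *s n q)) = s * cmod (f \<zeta>)"
        using s by (simp add: dist_norm nv)
      also have "s * cmod (f \<zeta>) \<le> 1 * (2 * \<rho>)"
        using s f2[OF \<zeta>(1)] \<zeta>(2) by (intro mult_mono) auto
      also have "dist p q + 1 * (2 * \<rho>) < e" using q(2) \<rho>(3) by simp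
      finally show "q + s *\<^sub>R (f \<zeta> *s n q) \<in> V" using e by auto
    next
      have "cdot (n q) (f \<zeta> *s n q) = f \<zeta>"
        using n1[OF qV] by (simp add: cdot_vector_scalar_mult cdot_self)
      then have "inner (n q) (f \<zeta> *s n q) = Re (f \<zeta>)" by (metis Re_cdot)
      then show "norm (f \<zeta> *s n q) * \<omega> (norm (f \<zeta> *s n q)) < - inner (sgn (g q)) (f \<zeta> *s n q)"
        using f\<omega>[OF \<zeta>(1)] \<zeta>(2) \<rho>(2) by (simp add: nv flip: n_def)
    qed (use \<omega>(2) in auto)
  qed
  let ?y = "\<lambda>q. q - h (\<rho> / 2) *\<^sub>R n q"
  have push: "kobayashi \<Omega> (?y q) z \<le> ln (4 * \<rho> / dist z q) / 2"
    if q: "q \<in> frontier \<Omega>" "dist p q < e / 2" and z: "z \<in> \<Omega>"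
      and near: "\<And>x. x \<in> frontier \<Omega> \<Longrightarrow> dist z q \<le> dist z x" and small: "0 < dist z q" "dist z q < \<rho> / 2" for q z
  proof -
    define \<delta> where "\<delta> = dist z q"
    have qV: "q \<in> V" using q e by auto
    have zq: "z = q - \<delta> *\<^sub>R n q"
      unfolding \<delta>_def n_def by (rule nearest_frontier_point_normal[OF ldf q(1) qV z near])
    have \<delta>: "0 < \<delta>" "\<delta> < \<rho> / 2" using small by (auto simp: \<delta>_def)
    \<comment> \<open>Since \<open>h\<close> is only comparable to the identity, the parameter at
      which the disc meets \<open>z\<close> comes from the intermediate value theorem.\<close>
    have "h (\<delta> / 2) \<le> \<delta>" "\<delta> \<le> h \<delta>" using h[of "\<delta> / 2"] h[of \<delta>] \<delta> by auto
    moreover have "continuous_on {\<delta> / 2..\<delta>} h" using \<delta> by (intro continuous_on_subset[OF hcont]) auto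
    ultimately obtain x where x: "\<delta> / 2 \<le> x" "x \<le> \<delta>" "h x = \<delta>"
      using IVT'[of h "\<delta> / 2" \<delta> \<delta>] \<delta> by auto
    \<comment> \<open>\<open>A\<close> maps the unit disc onto the disc of radius
      \<open>\<rho> / 2\<close> in the left half-plane that touches the imaginary axis at
      \<open>0\<close>; the radius to \<open>1\<close> becomes the normal segment towards
      \<open>q\<close>.\<close>
    define A where "A \<zeta> = of_real (\<rho> / 2) * (\<zeta> - 1)" for \<zeta> :: complex
    have A: "Re (A \<zeta>) < 0" "cmod (A \<zeta>) < \<rho>" if "cmod \<zeta> < 1" for \<zeta>
    proof -
      have "Re \<zeta> < 1" using that complex_Re_le_cmod[of \<zeta>] by linarith
      then show "Re (A \<zeta>) < 0" using \<rho> by (simp add: A_def mult_pos_neg)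
      have "cmod (\<zeta> - 1) < 2" using norm_triangle_ineq4[of \<zeta> 1] that by simp
      then have "\<rho> / 2 * cmod (\<zeta> - 1) < \<rho> / 2 * 2" using \<rho> by (intro mult_strict_left_mono) auto
      then show "cmod (A \<zeta>) < \<rho>" using \<rho> by (simp add: A_def norm_mult)
    qed
    define \<phi> where "\<phi> \<zeta> = q + f (A \<zeta>) *s n q" for \<zeta>
    have "analytic_disc \<Omega> \<phi>"
      unfolding analytic_disc_def
    proof
      have "A holomorphic_on ball 0 1" unfolding A_def by (intro holomorphic_intros)
      moreover have "A ` ball 0 1 \<subseteq> {\<zeta>. Re \<zeta> < 0}" using A by auto
      ultimately have "(\<lambda>\<zeta>. f (A \<zeta>)) holomorphic_on ball 0 1"
        using holomorphic_on_compose_gen[OF _ f, of A] by (simp add: o_def)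
      then show "\<forall>i. (\<lambda>\<zeta>. \<phi> \<zeta> $ i) holomorphic_on ball 0 1"
        by (auto simp: \<phi>_def intro!: holomorphic_intros)
      show "\<phi> ` ball 0 1 \<subseteq> \<Omega>" using inside[OF q] A by (auto simp: \<phi>_def)
    qed
    moreover have "\<phi> 0 = ?y q"
      using fh[of "\<rho> / 2"] \<rho> by (simp add: \<phi>_def A_def scaleR_eq_vector_scalar_mult)
    moreover have "\<phi> (of_real (1 - 2 * x / \<rho>)) = z"
    proof -
      have "A (of_real (1 - 2 * x / \<rho>)) = - of_real x" using \<rho> by (simp add: A_def)
      then show ?thesis using fh[of x] x \<delta> by (simp add: \<phi>_def zq scaleR_eq_vector_scalar_mult)
    qed
    moreover have x\<rho>: "0 < 2 * x / \<rho>" "2 * x / \<rho> < 1" using x \<delta> \<rho> by (auto simp: field_simps)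
    then have "cmod (of_real (1 - 2 * x / \<rho>)) = 1 - 2 * x / \<rho>" by (simp only: norm_of_real)
    ultimately have "disc_step \<Omega> (?y q) z (1 - 2 * x / \<rho>)"
      unfolding disc_step_def using x\<rho>
      by (intro exI[of _ \<phi>] exI[of _ "of_real (1 - 2 * x / \<rho>)"]) auto
    then have "kobayashi \<Omega> (?y q) z \<le> artanh (1 - 2 * x / \<rho>)"
      by (rule kobayashi_le_disc_step[OF \<Omega>])
    also have "\<dots> \<le> ln (2 / (2 * x / \<rho>)) / 2" using x\<rho> by (intro artanh_one_minus_le)
    also have "\<dots> \<le> ln (4 * \<rho> / \<delta>) / 2"
      using x \<delta> \<rho> by (intro divide_right_mono) (auto simp: field_simps)
    finally show ?thesis by (simp add: \<delta>_def)
  qed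
  define y where "y = p - h (\<rho> / 2) *\<^sub>R n p"
  have "y \<in> \<Omega>"
  proof -
    have "p + f (- of_real (\<rho> / 2)) *s n p \<in> \<Omega>" using p e \<rho> by (intro inside) auto
    moreover have "f (- of_real (\<rho> / 2)) *s n p = - (h (\<rho> / 2) *\<^sub>R n p)"
      using fh[of "\<rho> / 2"] \<rho> by (simp add: scaleR_eq_vector_scalar_mult vec_eq_iff)
    ultimately show ?thesis by (simp add: y_def)
  qed
  then obtain s where s: "0 < s" "ball y s \<subseteq> \<Omega>" using \<Omega> open_contains_ball by (metis domain_set_def)
  have "isCont n p"
  proof -
    have "isCont g p" using gcont V pV continuous_on_eq_continuous_at by blast
    then show ?thesis unfolding n_def using g0[OF pV] by (intro continuous_intros)
  qed
  then have "(?y \<longlongrightarrow> y) (at p)"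
    unfolding y_def isCont_def by (intro tendsto_intros)
  from tendstoD[OF this, of "s / 2"] s obtain \<eta>0 where
    \<eta>0: "0 < \<eta>0" "\<And>q. q \<noteq> p \<Longrightarrow> dist q p < \<eta>0 \<Longrightarrow> dist (?y q) y < s / 2"
    by (auto simp: eventually_at)
  have near_y: "dist y (?y q) \<le> s / 2" if "dist q p < \<eta>0" for q
    using \<eta>0(2)[of q] that s by (cases "q = p") (auto simp: y_def dist_commute less_imp_le)
  define \<eta> where "\<eta> = min (min (\<eta>0 / 2) (e / 4)) (\<rho> / 2)"
  have \<eta>: "0 < \<eta>" "\<eta> \<le> \<eta>0 / 2" "\<eta> \<le> e / 4" "\<eta> \<le> \<rho> / 2" using \<eta>0 e \<rho> by (auto simp: \<eta>_def)
  have fr: "frontier \<Omega> \<noteq> {}" "closed (frontier \<Omega>)" using p by auto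
  have one: "kobayashi \<Omega> y z \<le> C + ln (4 * \<rho> / infdist z (frontier \<Omega>)) / 2"
    "0 < infdist z (frontier \<Omega>)" if z: "z \<in> \<Omega>" "dist p z < \<eta>" for z
  proof -
    obtain q where q: "q \<in> frontier \<Omega>" "infdist z (frontier \<Omega>) = dist z q"
      using infdist_attains_inf[OF fr(2,1)] by metis
    have near: "dist z q \<le> dist z x" if "x \<in> frontier \<Omega>" for x
      using infdist_le[OF that, of z] q by simp
    have zp: "dist z q < \<eta>" using near[OF p] z(2) by (simp add: dist_commute)
    have pq: "dist p q < 2 * \<eta>" using dist_triangle[of p q z] zp z(2) by simp
    have "z \<noteq> q" using z(1) q(1) \<Omega> by (auto simp: domain_set_def frontier_def interior_open)
    then have pos: "0 < dist z q" by simp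
    then show "0 < infdist z (frontier \<Omega>)" using q by simp
    have P: "kobayashi \<Omega> (?y q) z \<le> ln (4 * \<rho> / dist z q) / 2"
      using pq zp \<eta> by (intro push q z near pos) auto
    have yq: "dist y (?y q) \<le> s / 2" using pq \<eta> by (intro near_y) (simp add: dist_commute)
    then have "?y q \<in> \<Omega>" using s by (intro subsetD[OF s(2)]) simp
    then have "kobayashi \<Omega> y z \<le> kobayashi \<Omega> y (?y q) + kobayashi \<Omega> (?y q) z"
      using kobayashi_triangle[OF \<Omega> \<open>y \<in> \<Omega>\<close>] z(1) by blast
    moreover have "kobayashi \<Omega> y (?y q) \<le> C"
      unfolding C_def using kobayashi_le_ball[OF \<Omega> s(2) yq s(1)] .
    ultimately show "kobayashi \<Omega> y z \<le> C + ln (4 * \<rho> / infdist z (frontier \<Omega>)) / 2"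
      using P q(2) by simp
  qed
  have \<rho>M: "2 * C + ln (4 * \<rho>) \<le> - M"
  proof -
    have "4 * \<rho> \<le> exp (- M - 2 * C)" using \<rho>(4) by simp
    then have "ln (4 * \<rho>) \<le> ln (exp (- M - 2 * C))" using \<rho>(1) by (subst ln_le_cancel_iff) auto
    then show ?thesis by simp
  qed
  show ?thesis
  proof (rule that[OF \<eta>(1)])
    fix z w assume zw: "z \<in> \<Omega>" "w \<in> \<Omega>" "dist p z < \<eta>" "dist p w < \<eta>"
    have lnx: "ln (4 * \<rho> / infdist x (frontier \<Omega>)) = ln (4 * \<rho>) + ln (1 / infdist x (frontier \<Omega>))"
      if "x \<in> \<Omega>" "dist p x < \<eta>" for x
      using one(2)[OF that] \<rho>(1) by (simp add: ln_div)
    have "kobayashi \<Omega> z w \<le> kobayashi \<Omega> y z + kobayashi \<Omega> y w"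
      using kobayashi_triangle[OF \<Omega> zw(1) \<open>y \<in> \<Omega>\<close> zw(2)] kobayashi_sym[OF \<Omega> zw(1) \<open>y \<in> \<Omega>\<close>] by simp
    then show "kobayashi \<Omega> z w \<le>
        ln (1 / infdist z (frontier \<Omega>)) / 2 + ln (1 / infdist w (frontier \<Omega>)) / 2 - M"
      using one(1)[OF zw(1,3)] one(1)[OF zw(2,4)] lnx[OF zw(1,3)] lnx[OF zw(2,4)] \<rho>M by linarith
  qed
qed

subsection \<open>Localization of chains\<close>

lemma le_of_approx:
  fixes X k :: real
  assumes \<tau>0: "0 < \<tau>0" and le: "\<And>\<tau>. 0 < \<tau> \<Longrightarrow> \<tau> \<le> \<tau>0 \<Longrightarrow> X \<le> k + \<tau> * B"
  shows "X \<le> k"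
proof (rule field_le_epsilon)
  fix e :: real assume e: "0 < e"
  define \<tau> where "\<tau> = min \<tau>0 (e / (\<bar>B\<bar> + 1))"
  have \<tau>: "0 < \<tau>" "\<tau> \<le> \<tau>0" "\<tau> \<le> e / (\<bar>B\<bar> + 1)" using \<tau>0 e by (auto simp: \<tau>_def)
  have "\<tau> * B \<le> \<tau> * (\<bar>B\<bar> + 1)" using \<tau>(1) by (intro mult_left_mono) auto
  also have "\<dots> \<le> e" using \<tau>(3) by (simp add: pos_le_divide_eq)
  finally show "X \<le> k + e" using le[OF \<tau>(1,2)] by linarith
qed

lemma le_artanh:
  fixes t :: real
  assumes "0 \<le> t" "t < 1"
  shows "t \<le> artanh t"
proof -
  have "artanh 0 - 0 \<le> artanh t - t"
  proof (rule DERIV_nonneg_imp_nondecreasing[OF assms(1)])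
    fix x assume x: "0 \<le> x" "x \<le> t"
    have x1: "\<bar>x\<bar> < 1" using x assms by auto
    have "((\<lambda>x. artanh x - x) has_real_derivative (1 / (1 - x\<^sup>2) - 1)) (at x)"
      using x1 by (auto intro!: derivative_eq_intros)
    moreover have "0 \<le> 1 / (1 - x\<^sup>2) - 1"
    proof -
      have "x\<^sup>2 < 1" using x1 by (simp add: abs_square_less_1)
      then show ?thesis by (simp add: le_divide_eq)
    qed
    ultimately show "\<exists>y. ((\<lambda>x. artanh x - x) has_real_derivative y) (at x) \<and> 0 \<le> y" by blast
  qed
  then show ?thesis by simp
qed

lemma artanh_le_fraction:
  fixes s :: real
  assumes "0 \<le> s" "s < 1"
  shows "artanh s \<le> s / (1 - s)"
proof -
  have "ln ((1 + s) / (1 - s)) \<le> (1 + s) / (1 - s) - 1"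
    using assms by (intro ln_le_minus_one) simp
  also have "\<dots> = 2 * (s / (1 - s))" using assms by (simp add: field_simps)
  finally show ?thesis unfolding artanh_def by linarith
qed

text \<open>The cost of restricting a disc to radius \<open>1 - x\<close>. The relative loss is
  linear in \<open>x + \<tau>\<close> because \<open>t / (1 - x)\<close> stays away from
  \<open>1\<close>.\<close>

lemma artanh_rescale_le:
  fixes t x :: real
  assumes "0 \<le> t" "t \<le> \<tau>" "\<tau> \<le> 1 / 8" "0 \<le> x" "x \<le> 1 / 4"
  shows "artanh (t / (1 - x)) \<le> (1 + 2 * (x + \<tau>)) * artanh t"
proof -
  define u where "u = x + t"
  have u: "0 \<le> u" "u \<le> 1 / 2" "u \<le> x + \<tau>" using assms by (auto simp: u_def)
  have "artanh (t / (1 - x)) \<le> t / (1 - x) / (1 - t / (1 - x))"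
    using assms by (intro artanh_le_fraction) (auto simp: field_simps)
  also have "1 - t / (1 - x) = (1 - u) / (1 - x)" using assms by (simp add: u_def field_simps)
  also have "t / (1 - x) / ((1 - u) / (1 - x)) = t * (1 / (1 - u))" using assms by simp
  also have "\<dots> \<le> t * (1 + 2 * u)"
  proof (rule mult_left_mono)
    have "0 \<le> u * (1 - 2 * u)" using u by simp
    then have "1 \<le> (1 + 2 * u) * (1 - u)" by (simp add: algebra_simps)
    then show "1 / (1 - u) \<le> 1 + 2 * u" using u by (simp add: pos_divide_le_eq)
  qed (use assms in auto)
  also have "\<dots> \<le> artanh t * (1 + 2 * (x + \<tau>))"
    using assms u le_artanh[of t] by (intro mult_mono) auto
  finally show ?thesis by (simp add: mult.commute)
qed

text \<open>A discrete form of \<open>\<integral> exp (- \<bar>s\<bar> / 2) ds\<close> being finite.\<close>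

lemma exponential_chain_sum_le:
  fixes l :: "nat \<Rightarrow> real"
  assumes l: "\<And>i. 0 \<le> l i" "\<And>i. l i \<le> 1"
  defines "T \<equiv> \<lambda>i. \<Sum>m<i. l m"
  shows "(\<Sum>i<N. exp (- \<bar>T i - T j\<bar> / 2) * l i) \<le> 8"
proof -
  \<comment> \<open>Twice an antiderivative of \<open>exp (- \<bar>s\<bar> / 2)\<close>, running
    from \<open>0\<close> to \<open>8\<close>. The factor two absorbs the excess of left endpoint
    sums where the function decreases, which is controlled by \<open>l i \<le> 1\<close>.\<close>
  define P where "P i = (if i \<le> j then 4 * exp (- (T j - T i) / 2) else 8 - 4 * exp (- (T i - T j) / 2))" for i
  have TSuc: "T (Suc i) = T i + l i" for i by (simp add: T_def)
  have Tmono: "T i \<le> T k" if "i \<le> k" for i k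
    unfolding T_def using that l by (intro sum_mono2) auto
  have "exp (- \<bar>T i - T j\<bar> / 2) * l i \<le> P (Suc i) - P i" for i
  proof (cases "i < j")
    case True
    have Tij: "T i \<le> T j" using True Tmono by auto
    define E where "E = exp (- (T j - T i) / 2)"
    have "exp (- (T j - T (Suc i)) / 2) = E * exp (l i / 2)"
      unfolding E_def TSuc by (simp add: field_simps flip: exp_add)
    then have "P (Suc i) - P i = E * (4 * (exp (l i / 2) - 1))"
      using True by (simp add: P_def E_def algebra_simps)
    also have "\<dots> \<ge> E * l i"
    proof (rule mult_left_mono)
      define y where "y = exp (l i / 2)"
      have "1 + l i / 2 \<le> y" by (simp add: y_def)
      then have "l i \<le> 4 * (y - 1)" using l(1)[of i] by simp
      then show "l i \<le> 4 * (exp (l i / 2) - 1)" by (simp add: y_def)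
    qed (simp add: E_def)
    finally show ?thesis using Tij by (simp add: E_def)
  next
    case False
    have Tij: "T j \<le> T i" using False Tmono by auto
    define E where "E = exp (- (T i - T j) / 2)"
    have Pi: "P i = 8 - 4 * E" using False by (cases "i = j") (auto simp: P_def E_def)
    have "exp (- (T (Suc i) - T j) / 2) = E * exp (- (l i / 2))"
      unfolding E_def TSuc by (simp add: field_simps flip: exp_add)
    then have "P (Suc i) - P i = E * (4 * (1 - exp (- (l i / 2))))"
      using False unfolding Pi by (simp add: P_def algebra_simps)
    also have "\<dots> \<ge> E * l i"
    proof (rule mult_left_mono)
      define u where "u = l i / 2"
      have u: "0 \<le> u" "u \<le> 1 / 2" using l[of i] by (auto simp: u_def)
      have "exp (- u) * (1 + u) \<le> exp (- u) * exp u" by (intro mult_left_mono exp_ge_add_one_self) auto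
      also have "\<dots> = 1" by (simp flip: exp_add)
      also have "1 \<le> (1 - u / 2) * (1 + u)"
        using u mult_nonneg_nonneg[of u "1 - u"] by (simp add: algebra_simps)
      finally have "exp (- u) \<le> 1 - u / 2" using u by (simp add: mult_le_cancel_right)
      then show "l i \<le> 4 * (1 - exp (- (l i / 2)))" by (simp add: u_def)
    qed (simp add: E_def)
    finally show ?thesis using Tij by (simp add: E_def)
  qed
  then have "(\<Sum>i<N. exp (- \<bar>T i - T j\<bar> / 2) * l i) \<le> (\<Sum>i<N. P (Suc i) - P i)" by (intro sum_mono)
  also have "\<dots> = P N - P 0" by (rule sum_lessThan_telescope)
  also have "\<dots> \<le> 8"
  proof -
    have "P N \<le> 8"
    proof (cases "N \<le> j")
      case True
      then have "exp (- (T j - T N) / 2) \<le> 1" using Tmono by simp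
      moreover have "P N = 4 * exp (- (T j - T N) / 2)" using True by (simp add: P_def)
      ultimately show ?thesis by linarith
    qed (simp add: P_def)
    moreover have "0 \<le> P 0" by (simp add: P_def)
    ultimately show ?thesis by simp
  qed
  finally show ?thesis .
qed

lemma reach_imp_sequence:
  assumes "reach X \<eta> x L y"
  shows "\<exists>N a t. a 0 = x \<and> a N = y \<and> (\<forall>i<N. disc_step X (a i) (a (Suc i)) (t i) \<and> t i \<le> \<eta>) \<and>
    L = (\<Sum>i<N. artanh (t i))"
  using assms
proof induction
  case (reach_refl x)
  show ?case by (rule exI[of _ 0], rule exI[of _ "\<lambda>_. x"]) simp
next
  case (reach_step x L y z s)
  then obtain N a t where *: "a 0 = x" "a N = y" "\<And>i. i < N \<Longrightarrow> disc_step X (a i) (a (Suc i)) (t i)"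
      "\<And>i. i < N \<Longrightarrow> t i \<le> \<eta>" "L = (\<Sum>i<N. artanh (t i))" by blast
  show ?case
  proof (intro exI[of _ "Suc N"] exI[of _ "a(Suc N := z)"] exI[of _ "t(N := s)"] conjI allI impI)
    fix i assume i: "i < Suc N"
    show "disc_step X ((a(Suc N := z)) i) ((a(Suc N := z)) (Suc i)) ((t(N := s)) i)"
      using i * reach_step.hyps by (cases "i = N") auto
    show "(t(N := s)) i \<le> \<eta>" using i * reach_step.hyps by (cases "i = N") auto
  qed (use * in auto)
qed

text \<open>The image of a disc is connected, so a localized step never changes the component. This
  is how a chain shows that its endpoints share a component.\<close>

lemma disc_step_component:
  assumes "disc_step Y a b s" "Y \<subseteq> X" "a \<in> connected_component_set X z"
  shows "disc_step (connected_component_set X z) a b s"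
proof -
  obtain \<phi> \<alpha> where \<phi>: "analytic_disc Y \<phi>" "\<phi> 0 = a" "\<phi> \<alpha> = b" "cmod \<alpha> = s" "s < 1"
    using assms(1) by (auto simp: disc_step_def)
  have "continuous_on (ball 0 1) \<phi>"
    using \<phi>(1) by (intro continuous_on_holomorphic_components) (simp add: analytic_disc_def)
  then have "connected (\<phi> ` ball 0 1)" by (intro connected_continuous_image) auto
  moreover have "a \<in> \<phi> ` ball 0 1" using \<phi>(2) by (metis centre_in_ball image_eqI zero_less_one)
  moreover have "\<phi> ` ball 0 1 \<subseteq> X" using \<phi>(1) assms(2) by (auto simp: analytic_disc_def)
  ultimately have "\<phi> ` ball 0 1 \<subseteq> connected_component_set X a" by (intro connected_component_maximal)
  also have "\<dots> = connected_component_set X z"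
    using assms(3) by (metis connected_component_eq)
  finally have "analytic_disc (connected_component_set X z) \<phi>" using \<phi>(1) by (simp add: analytic_disc_def)
  then show ?thesis using \<phi> by (auto simp: disc_step_def)
qed

text \<open>The Schwarz-Pick lemma for the left half-plane, where the pseudohyperbolic distance is
  the modulus of \<open>(h \<zeta> - h 0) / (h \<zeta> + cnj (h 0))\<close>; triangle inequalities
  reduce it to moduli.\<close>

lemma disc_step_left_halfplane:
  assumes step: "disc_step Y a b s"
    and hol: "\<And>\<phi>. analytic_disc Y \<phi> \<Longrightarrow> (\<lambda>\<zeta>. H (\<phi> \<zeta>)) holomorphic_on ball 0 1"
    and neg: "\<And>x. x \<in> Y \<Longrightarrow> Re (H x) < 0"
  shows "cmod (H b) - cmod (H a) \<le> s * (cmod (H a) + cmod (H b))"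
proof -
  obtain \<phi> \<alpha> where \<phi>: "analytic_disc Y \<phi>" "\<phi> 0 = a" "\<phi> \<alpha> = b" "cmod \<alpha> = s" "s < 1"
    using step by (auto simp: disc_step_def)
  define h where "h \<zeta> = H (\<phi> \<zeta>)" for \<zeta>
  have h: "Re (h \<zeta>) < 0" if "cmod \<zeta> < 1" for \<zeta>
    using \<phi>(1) neg that by (simp add: h_def analytic_disc_def image_subset_iff)
  define k where "k \<zeta> = (h \<zeta> - h 0) / (h \<zeta> + cnj (h 0))" for \<zeta>
  have den: "h \<zeta> + cnj (h 0) \<noteq> 0" if "cmod \<zeta> < 1" for \<zeta>
  proof -
    have "Re (h \<zeta> + cnj (h 0)) < 0" using h[OF that] h[of 0] by simp
    then show ?thesis by (metis less_irrefl zero_complex.simps(1))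
  qed
  have "k holomorphic_on ball 0 1"
    unfolding k_def using hol[OF \<phi>(1)] den by (intro holomorphic_intros) (auto simp: h_def)
  moreover have "k 0 = 0" by (simp add: k_def)
  moreover have "cmod (k \<zeta>) < 1" if \<zeta>: "cmod \<zeta> < 1" for \<zeta>
  proof -
    have "(cmod (h \<zeta> + cnj (h 0)))\<^sup>2 - (cmod (h \<zeta> - h 0))\<^sup>2 = 4 * (Re (h \<zeta>) * Re (h 0))"
      unfolding cmod_power2 by (simp add: power2_eq_square algebra_simps)
    also have "\<dots> > 0" using h[OF \<zeta>] h[of 0] by (simp add: mult_neg_neg)
    finally have "cmod (h \<zeta> - h 0) < cmod (h \<zeta> + cnj (h 0))"
      by (intro power2_less_imp_less[of _ "cmod (h \<zeta> + cnj (h 0))"]) auto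
    then show ?thesis using den[OF \<zeta>] by (simp add: k_def norm_divide)
  qed
  moreover have \<alpha>: "cmod \<alpha> < 1" using \<phi> by simp
  ultimately have "cmod (k \<alpha>) \<le> cmod \<alpha>" by (rule Schwarz_Lemma(1))
  then have "cmod (h \<alpha> - h 0) \<le> s * cmod (h \<alpha> + cnj (h 0))"
    using den[OF \<alpha>] \<phi> by (simp add: k_def norm_divide pos_divide_le_eq)
  also have "\<dots> \<le> s * (cmod (h 0) + cmod (h \<alpha>))"
    using norm_triangle_ineq[of "h \<alpha>" "cnj (h 0)"] \<phi>(4) by (intro mult_left_mono) auto
  finally have "cmod (h \<alpha>) - cmod (h 0) \<le> s * (cmod (h 0) + cmod (h \<alpha>))"
    using norm_triangle_ineq2[of "h \<alpha>" "h 0"] by linarith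
  then show ?thesis using \<phi> by (simp add: h_def)
qed

text \<open>A disc centred where \<open>\<bar>H\<bar> = A\<close> can be localized to radius \<open>1 - C * A\<close> only; adding \<open>2 * C\<close> to \<open>1 / \<bar>H\<bar>\<close>
  in the potential \<open>ln (1 / \<bar>H\<bar>) / 2\<close> compensates for the loss.\<close>

lemma halfplane_potential_step:
  fixes A B C t :: real
  assumes A: "0 < A" "A \<le> B" and C: "0 < C" "C * A \<le> 1 / 2" and t: "0 \<le> t" "t \<le> \<tau>" "\<tau> \<le> 1 / 8"
    and le: "B - A \<le> t / (1 - C * A) * (A + B)"
  shows "ln (1 / A + 2 * C) / 2 - ln (1 / B + 2 * C) / 2 \<le> artanh t / (1 - 2 * \<tau>)"
proof -
  define s where "s = t / (1 - C * A)"
  have r: "1 / 2 \<le> 1 - C * A" using C by simp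
  have s: "0 \<le> s" "s \<le> 2 * t"
  proof -
    show "0 \<le> s" using t r by (simp add: s_def)
    have "t * 1 \<le> t * (2 * (1 - C * A))" using t r by (intro mult_left_mono) auto
    then show "s \<le> 2 * t" using r by (simp add: s_def pos_divide_le_eq algebra_simps)
  qed
  have s1: "1 - 2 * \<tau> \<le> 1 - s" "3 / 4 \<le> 1 - s" using s t by auto
  have B: "0 < B" using A by simp
  have pos: "0 < 1 / A + 2 * C" "0 < 1 / B + 2 * C" using A B C by (auto intro: add_pos_pos)
  \<comment> \<open>For \<open>x = C * A \<le> 1/2\<close> this reads
    \<open>(1 - x) * (1 + 2 * x) \<ge> 1\<close>: the second factor, due to the summand
    \<open>2 * C\<close>, cancels the denominator of \<open>s\<close>.\<close>
  have KA: "1 \<le> (1 - C * A) * (1 + 2 * C * A)"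
  proof -
    have "0 \<le> (C * A) * (1 - 2 * (C * A))" using A C by (intro mult_nonneg_nonneg) auto
    then show ?thesis by (simp add: algebra_simps)
  qed
  define Q where "Q = (1 / A + 2 * C) / (1 / B + 2 * C)"
  have "ln (1 / A + 2 * C) / 2 - ln (1 / B + 2 * C) / 2 = ln Q / 2"
    using pos by (simp add: Q_def ln_div diff_divide_distrib)
  also have "ln Q \<le> Q - 1" using pos by (intro ln_le_minus_one) (simp add: Q_def)
  also have "Q - 1 = (B - A) / (A * (1 + 2 * C * B))"
  proof -
    have "Q = (B * (1 + 2 * C * A)) / (A * (1 + 2 * C * B))"
      using A B by (simp add: Q_def field_simps)
    moreover have "0 < A * (1 + 2 * C * B)" using A B C by (intro mult_pos_pos add_pos_pos) auto
    ultimately show ?thesis by (simp add: field_simps)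
  qed
  also have "\<dots> \<le> (B - A) / (A * (1 + 2 * C * A))"
    using A B C by (intro divide_left_mono mult_left_mono add_left_mono mult_pos_pos add_pos_pos) auto
  also have "\<dots> \<le> (2 * s * A / (1 - s)) / (A * (1 + 2 * C * A))"
  proof (rule divide_right_mono)
    have "B - A \<le> s * (A + B)" using le by (simp add: s_def)
    then have "(B - A) * (1 - s) \<le> 2 * s * A" by (simp add: algebra_simps)
    then show "B - A \<le> 2 * s * A / (1 - s)" using s1 by (simp add: pos_le_divide_eq)
  qed (use A C in auto)
  also have "\<dots> = 2 * (t / (1 - s)) / ((1 - C * A) * (1 + 2 * C * A))"
    using A s1 r by (simp add: s_def)
  also have "\<dots> \<le> 2 * (t / (1 - s))"
  proof -
    have "x / D \<le> x" if "0 \<le> x" "1 \<le> D" for x D :: real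
      using that divide_left_mono[of 1 D x] by simp
    moreover have "0 \<le> 2 * (t / (1 - s))" using t s1 by simp
    ultimately show ?thesis using KA by blast
  qed
  also have "2 * (t / (1 - s)) / 2 = t / (1 - s)" by (rule nonzero_mult_div_cancel_left) simp
  also have "\<dots> \<le> artanh t / (1 - 2 * \<tau>)"
    using t s1 le_artanh[of t] by (intro frac_le) auto
  finally show ?thesis by simp
qed

section \<open>Estimates that see the convex model only through the functions
  \<open>H q\<close>\<close>

locale supported_point =
  fixes \<Omega> :: "(complex^'n) set" and p :: "complex^'n" and R L :: real
    and H :: "complex^'n \<Rightarrow> complex^'n \<Rightarrow> complex"
  assumes dom: "domain_set \<Omega>" and pfr: "p \<in> frontier \<Omega>"
    and R: "0 < R" and L: "0 < L"
    and H_hol: "\<And>q (\<phi> :: complex \<Rightarrow> complex^'n) S. (\<And>i. (\<lambda>\<zeta>. \<phi> \<zeta> $ i) holomorphic_on S) \<Longrightarrow> open S \<Longrightarrow>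
        \<phi> ` S \<subseteq> ball p R \<Longrightarrow> (\<lambda>\<zeta>. H q (\<phi> \<zeta>)) holomorphic_on S"
    and H_neg: "\<And>q x. q \<in> frontier \<Omega> \<Longrightarrow> q \<in> ball p R \<Longrightarrow> x \<in> \<Omega> \<Longrightarrow> x \<in> ball p R \<Longrightarrow> Re (H q x) < 0"
    and H_lip: "\<And>q x. q \<in> frontier \<Omega> \<Longrightarrow> q \<in> ball p R \<Longrightarrow> x \<in> ball p R \<Longrightarrow> cmod (H q x) \<le> L * dist q x"
    and H_away: "\<And>\<epsilon> R'. 0 < \<epsilon> \<Longrightarrow> R' < R \<Longrightarrow> \<exists>c>0. \<exists>\<eta>>0. \<eta> \<le> R \<and>
        (\<forall>q x. q \<in> frontier \<Omega> \<longrightarrow> q \<in> ball p \<eta> \<longrightarrow> x \<in> \<Omega> \<longrightarrow> \<epsilon> \<le> dist p x \<longrightarrow> dist p x \<le> R' \<longrightarrow> c \<le> cmod (H q x))"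

definition (in supported_point) \<delta> :: "complex^'n \<Rightarrow> real" where "\<delta> x = infdist x (frontier \<Omega>)"

lemma (in supported_point) nearest:
  assumes "x \<in> \<Omega>"
  obtains q where "q \<in> frontier \<Omega>" "dist q x = \<delta> x" "dist p q \<le> 2 * dist p x"
proof -
  obtain q where q: "q \<in> frontier \<Omega>" "infdist x (frontier \<Omega>) = dist x q"
    using infdist_attains_inf[OF frontier_closed, of \<Omega> x] pfr by (metis empty_iff)
  have "dist x q \<le> dist x p" using infdist_le[OF pfr, of x] q(2) by simp
  then have "dist p q \<le> 2 * dist p x" using dist_triangle[of p q x] by (simp add: dist_commute)
  with that q show ?thesis by (simp add: \<delta>_def dist_commute)
qed

lemma (in supported_point) \<delta>_pos: "x \<in> \<Omega> \<Longrightarrow> 0 < \<delta> x"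
proof -
  assume x: "x \<in> \<Omega>"
  obtain q where q: "q \<in> frontier \<Omega>" "dist q x = \<delta> x" by (rule nearest[OF x])
  have "q \<noteq> x" using q(1) x dom by (auto simp: domain_set_def frontier_def interior_open)
  then show ?thesis using q(2) by (metis zero_less_dist_iff)
qed

lemma (in supported_point) \<delta>_le: "\<delta> x \<le> dist p x"
  using infdist_le[OF pfr, of x] by (simp add: \<delta>_def dist_commute)

text \<open>By \<open>disc_localization\<close>, a parameter sent out of the half-size ball lies
  within \<open>C * cmod (H q a)\<close> of the unit circle. Restricting the disc to the remaining
  radius and rescaling divides \<open>t\<close> by that radius. \<open>C\<close> is
  \<open>32\<close> over the lower bound for \<open>cmod (H q x)\<close> on the sphere of radius
  \<open>R / 2\<close>.\<close>

lemma (in supported_point) disc_step_localize: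
  obtains C \<eta> where "0 < C" "0 < \<eta>" "\<eta> \<le> R / 2"
    "\<And>q a b t. q \<in> frontier \<Omega> \<Longrightarrow> q \<in> ball p \<eta> \<Longrightarrow> a \<in> ball p (R / 2) \<Longrightarrow> disc_step \<Omega> a b t \<Longrightarrow>
       t < 1 - C * cmod (H q a) \<Longrightarrow> disc_step (\<Omega> \<inter> ball p (R / 2)) a b (t / (1 - C * cmod (H q a)))"
proof -
  obtain c \<eta> where c: "0 < c" and \<eta>: "0 < \<eta>" "\<eta> \<le> R"
    and away: "\<And>q x. q \<in> frontier \<Omega> \<Longrightarrow> q \<in> ball p \<eta> \<Longrightarrow> x \<in> \<Omega> \<Longrightarrow> dist p x = R / 2 \<Longrightarrow> c \<le> cmod (H q x)"
    using H_away[of "R / 2" "R / 2"] R by fastforce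
  define C where "C = 32 / c"
  show ?thesis
  proof (rule that[of C "min \<eta> (R / 2)"])
    show "0 < C" using c by (simp add: C_def)
    fix q a b t
    assume q: "q \<in> frontier \<Omega>" "q \<in> ball p (min \<eta> (R / 2))" and a: "a \<in> ball p (R / 2)"
      and step: "disc_step \<Omega> a b t" and t: "t < 1 - C * cmod (H q a)"
    obtain \<phi> \<alpha> where \<phi>: "analytic_disc \<Omega> \<phi>" "\<phi> 0 = a" "\<phi> \<alpha> = b" "cmod \<alpha> = t" "t < 1"
      using step by (auto simp: disc_step_def)
    define r where "r = 1 - C * cmod (H q a)"
    have t0: "0 \<le> t" using \<phi>(4) by auto
    have "t < r" "r \<le> 1" using t c by (auto simp: r_def C_def)
    then have r: "t < r" "0 < r" "r \<le> 1" using t0 by auto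
    have hol: "(\<lambda>\<zeta>. \<phi> \<zeta> $ i) holomorphic_on ball 0 1" for i
      using \<phi>(1) by (simp add: analytic_disc_def)
    let ?S = "{\<zeta> \<in> ball 0 1. \<phi> \<zeta> \<in> ball p R}"
    have "continuous_on (ball 0 1) \<phi>" by (rule continuous_on_holomorphic_components[OF hol])
    then have "open (ball 0 1 \<inter> \<phi> -` ball p R)" by (intro continuous_open_preimage) auto
    moreover have "ball 0 1 \<inter> \<phi> -` ball p R = ?S" by auto
    ultimately have openS: "open ?S" by simp
    have Hhol: "(\<lambda>\<zeta>. H q (\<phi> \<zeta>)) holomorphic_on ?S"
    proof (rule H_hol[where \<phi> = \<phi>])
      show "(\<lambda>\<zeta>. \<phi> \<zeta> $ i) holomorphic_on ?S" for i
        by (rule holomorphic_on_subset[OF hol]) auto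
    qed (use openS in auto)
    have inb: "\<phi> \<zeta> \<in> ball p (R / 2)" if "cmod \<zeta> < r" for \<zeta>
    proof (rule ccontr)
      assume out: "\<phi> \<zeta> \<notin> ball p (R / 2)"
      have "1 - cmod \<zeta> \<le> 32 * (cmod (H q (\<phi> 0)) / c)"
      proof (rule disc_localization[where H = "H q" and p = p and R = "R / 2", OF \<phi>(1) Hhol])
        show "Re (H q x) < 0" if "x \<in> \<Omega>" "x \<in> ball p R" for x
          using H_neg q that R by auto
        show "c \<le> cmod (H q x)" if "x \<in> \<Omega>" "dist p x = R / 2" for x
          using away q that by auto
      qed (use a R c that r \<phi>(2) out in auto)
      then show False using that by (simp add: r_def C_def \<phi>(2))
    qed
    define \<psi> where "\<psi> \<zeta> = \<phi> (of_real r * \<zeta>)" for \<zeta>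
    have sc: "cmod (of_real r * \<zeta>) < r" if "cmod \<zeta> < 1" for \<zeta>
      using that r by (simp add: norm_mult)
    have "analytic_disc \<Omega> \<psi>"
      unfolding \<psi>_def
    proof (rule analytic_disc_compose[OF \<phi>(1)])
      show "(\<lambda>\<zeta> :: complex. of_real r * \<zeta>) holomorphic_on ball 0 1" by (intro holomorphic_intros)
      show "(\<lambda>\<zeta> :: complex. of_real r * \<zeta>) ` ball 0 1 \<subseteq> ball 0 1"
      proof (rule image_subsetI)
        show "of_real r * \<zeta> \<in> ball 0 1" if "\<zeta> \<in> ball 0 1" for \<zeta> :: complex
          using sc[of \<zeta>] that r by simp
      qed
    qed
    then have "analytic_disc (\<Omega> \<inter> ball p (R / 2)) \<psi>"
      using inb sc by (auto simp: analytic_disc_def \<psi>_def)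
    moreover have "\<psi> 0 = a" "\<psi> (\<alpha> / of_real r) = b" using \<phi> r by (auto simp: \<psi>_def)
    moreover have "cmod (\<alpha> / of_real r) = t / r" using \<phi>(4) r by (simp add: norm_divide)
    moreover have "t / r < 1" using r by simp
    ultimately have "disc_step (\<Omega> \<inter> ball p (R / 2)) a b (t / r)"
      unfolding disc_step_def by blast
    then show "disc_step (\<Omega> \<inter> ball p (R / 2)) a b (t / (1 - C * cmod (H q a)))" by (simp add: r_def)
  qed (use \<eta> R in auto)
qed

text \<open>With \<open>q\<close> nearest to \<open>z\<close>, the corrected potential
  \<open>F\<close> drops by at most \<open>artanh t / (1 - 2 * \<tau>)\<close> along a disc step. It
  is at least \<open>ln (1 / \<delta> z) / 2 - ln L / 2\<close> at \<open>z\<close> and equals the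
  constant \<open>K\<close> far from \<open>p\<close>; the tolerance \<open>\<tau>\<close> tends to
  \<open>0\<close> at the end.\<close>

lemma (in supported_point) kobayashi_lower_bound:
  assumes \<epsilon>: "0 < \<epsilon>" "\<epsilon> \<le> R / 2"
  obtains C \<eta> where "0 < \<eta>"
    "\<And>z x. z \<in> \<Omega> \<Longrightarrow> dist p z < \<eta> \<Longrightarrow> x \<in> \<Omega> \<Longrightarrow> \<epsilon> \<le> dist p x \<Longrightarrow> ln (1 / \<delta> z) / 2 - C \<le> kobayashi \<Omega> z x"
proof -
  obtain C \<eta>1 where C: "0 < C" and \<eta>1: "0 < \<eta>1" "\<eta>1 \<le> R / 2"
    and loc: "\<And>q a b t. q \<in> frontier \<Omega> \<Longrightarrow> q \<in> ball p \<eta>1 \<Longrightarrow> a \<in> ball p (R / 2) \<Longrightarrow> disc_step \<Omega> a b t \<Longrightarrow>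
       t < 1 - C * cmod (H q a) \<Longrightarrow> disc_step (\<Omega> \<inter> ball p (R / 2)) a b (t / (1 - C * cmod (H q a)))"
    using disc_step_localize by blast
  obtain c \<eta>2 where c: "0 < c" and \<eta>2: "0 < \<eta>2" "\<eta>2 \<le> R"
    and away: "\<And>q x. q \<in> frontier \<Omega> \<Longrightarrow> q \<in> ball p \<eta>2 \<Longrightarrow> x \<in> \<Omega> \<Longrightarrow> \<epsilon> \<le> dist p x \<Longrightarrow> dist p x \<le> R / 2 \<Longrightarrow> c \<le> cmod (H q x)"
    using H_away[OF \<epsilon>(1), of "R / 2"] R by fastforce
  define c0 where "c0 = min c (1 / (2 * C))"
  have c0: "0 < c0" "c0 \<le> c" "C * c0 \<le> 1 / 2"
    using c C by (auto simp: c0_def min_def field_simps)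
  define K where "K = ln (1 / c0 + 2 * C) / 2"
  define \<eta> where "\<eta> = min (min \<eta>1 \<eta>2 / 2) \<epsilon>"
  show ?thesis
  proof (rule that[of \<eta> "K + ln L / 2"])
    show "0 < \<eta>" using \<eta>1 \<eta>2 \<epsilon> by (simp add: \<eta>_def)
    fix z x assume z: "z \<in> \<Omega>" "dist p z < \<eta>" and x: "x \<in> \<Omega>" "\<epsilon> \<le> dist p x"
    obtain q where q: "q \<in> frontier \<Omega>" "dist q z = \<delta> z" "dist p q \<le> 2 * dist p z"
      by (rule nearest[OF z(1)])
    have q12: "q \<in> ball p \<eta>1" "q \<in> ball p \<eta>2" "q \<in> ball p R"
      using q(3) z(2) \<eta>1 \<eta>2 by (auto simp: \<eta>_def)
    \<comment> \<open>Truncating at \<open>c0\<close> extends the potential to all of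
      \<open>\<Omega>\<close>. Only steps that increase \<open>m\<close> matter; they start within
      \<open>\<epsilon>\<close> of \<open>p\<close>, where \<open>m\<close> is
      \<open>cmod (H q y)\<close> and below \<open>c0\<close>, so the localization applies.\<close>
    define m where "m y = (if dist p y < \<epsilon> then min (cmod (H q y)) c0 else c0)" for y
    define F where "F y = ln (1 / m y + 2 * C) / 2" for y
    have Hpos: "0 < cmod (H q y)" if "y \<in> \<Omega>" "y \<in> ball p R" for y
      using H_neg[OF q(1) q12(3) that] by auto
    have m: "0 < m y" "m y \<le> c0" if "y \<in> \<Omega>" for y
      using c0 Hpos[OF that] \<epsilon> R by (auto simp: m_def)
    have F_anti: "F a \<le> F b" if "a \<in> \<Omega>" "b \<in> \<Omega>" "m b \<le> m a" for a b
      using m[OF that(1)] m[OF that(2)] that(3) C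
      by (auto simp: F_def frac_le add_pos_pos intro!: divide_right_mono ln_mono)
    have F_step: "F a - F b \<le> artanh t / (1 - 2 * \<tau>)"
      if step: "disc_step \<Omega> a b t" and t: "t \<le> \<tau>" "\<tau> \<le> 1 / 8" for a b t \<tau>
    proof -
      note st = disc_step_imp[OF step]
      have nn: "0 \<le> artanh t / (1 - 2 * \<tau>)" using st t by (intro divide_nonneg_nonneg artanh_nonneg) auto
      show ?thesis
      proof (cases "m b \<le> m a")
        case True
        then show ?thesis using F_anti[OF st(3,4)] nn by fastforce
      next
        case False
        then have lt: "m a < m b" by simp
        have "m a < c0" using lt m(2)[OF st(4)] by simp
        then have a: "dist p a < \<epsilon>" and mA: "m a = cmod (H q a)" by (auto simp: m_def min_def split: if_splits)
        define A B where "A = cmod (H q a)" and "B = cmod (H q b)"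
        have aR: "a \<in> ball p (R / 2)" using a \<epsilon> by simp
        have A: "0 < A" "A < c0" using m(1)[OF st(3)] mA \<open>m a < c0\<close> by (auto simp: A_def)
        have CA: "C * A \<le> 1 / 2" using A c0(3) C mult_left_mono[of A c0 C] by linarith
        have "t < 1 - C * A" using CA t by linarith
        then have step': "disc_step (\<Omega> \<inter> ball p (R / 2)) a b (t / (1 - C * A))"
          unfolding A_def by (intro loc[OF q(1) q12(1) aR step])
        have bR: "b \<in> ball p (R / 2)" using disc_step_imp(4)[OF step'] by simp
        \<comment> \<open>The endpoint may leave the ball of radius \<open>\<epsilon>\<close> but
          not that of radius \<open>R / 2\<close>; in between, \<open>away\<close> gives
          \<open>c0 \<le> c \<le> B\<close>.\<close>
        have mB: "m b \<le> B" using away[OF q(1) q12(2) st(4)] bR c0(2) by (auto simp: m_def B_def)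
        have "B - A \<le> t / (1 - C * A) * (A + B)"
          unfolding A_def B_def
        proof (rule disc_step_left_halfplane[OF step'[unfolded A_def]])
          show "(\<lambda>\<zeta>. H q (\<phi> \<zeta>)) holomorphic_on ball 0 1" if "analytic_disc (\<Omega> \<inter> ball p (R / 2)) \<phi>" for \<phi>
            using that R by (intro H_hol) (auto simp: analytic_disc_def)
          show "Re (H q y) < 0" if "y \<in> \<Omega> \<inter> ball p (R / 2)" for y
            using that R by (intro H_neg[OF q(1) q12(3)]) auto
        qed
        then have "ln (1 / A + 2 * C) / 2 - ln (1 / B + 2 * C) / 2 \<le> artanh t / (1 - 2 * \<tau>)"
          using A C CA st t lt mA mB by (intro halfplane_potential_step) (auto simp: A_def)
        moreover have "ln (1 / B + 2 * C) / 2 \<le> F b"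
          using mB m(1)[OF st(4)] C
          by (auto simp: F_def frac_le add_pos_pos intro!: divide_right_mono ln_mono)
        ultimately show ?thesis using mA by (simp add: F_def A_def)
      qed
    qed
    have F_reach: "F z' - F y \<le> \<Lambda> / (1 - 2 * \<tau>)" if "reach \<Omega> \<tau> z' \<Lambda> y" "\<tau> \<le> 1 / 8" for z' y \<Lambda> \<tau>
      using that
    proof induction
      case (reach_step z' \<Lambda> y y' t)
      from F_step[OF reach_step.hyps(2,3) reach_step.prems] reach_step.IH[OF reach_step.prems]
      show ?case by (simp add: add_divide_distrib)
    qed simp
    have "F z - F x \<le> kobayashi \<Omega> z x"
    proof (rule le_of_approx[of "1 / 8" _ _ "1 + 2 * (F z - F x)"])
      fix \<tau> :: real assume \<tau>: "0 < \<tau>" "\<tau> \<le> 1 / 8"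
      obtain \<Lambda> where \<Lambda>: "reach \<Omega> \<tau> z \<Lambda> x" "\<Lambda> \<le> kobayashi \<Omega> z x + \<tau>"
        using reach_near_kobayashi[OF dom z(1) x(1) \<tau>(1) \<tau>(1)] by blast
      have "(F z - F x) * (1 - 2 * \<tau>) \<le> \<Lambda>"
        using F_reach[OF \<Lambda>(1) \<tau>(2)] \<tau> by (simp add: pos_le_divide_eq)
      then show "F z - F x \<le> kobayashi \<Omega> z x + \<tau> * (1 + 2 * (F z - F x))"
        using \<Lambda>(2) by (simp add: algebra_simps)
    qed simp
    moreover have "F x = K" using x(2) by (simp add: F_def m_def K_def)
    moreover have "ln (1 / \<delta> z) / 2 - ln L / 2 \<le> F z"
    proof -
      have "m z \<le> cmod (H q z)" using z(2) by (simp add: m_def \<eta>_def)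
      also have "\<dots> \<le> L * \<delta> z"
        using H_lip[OF q(1) q12(3), of z] z(2) \<epsilon> R q(2) by (auto simp: \<eta>_def)
      finally have mz: "m z \<le> L * \<delta> z" .
      have "1 / (L * \<delta> z) \<le> 1 / m z" using mz m(1)[OF z(1)] by (intro divide_left_mono) auto
      then have "1 / (L * \<delta> z) \<le> 1 / m z + 2 * C" using C by simp
      then have "ln (1 / (L * \<delta> z)) \<le> ln (1 / m z + 2 * C)"
        using L \<delta>_pos[OF z(1)] by (intro ln_mono) auto
      moreover have "ln (1 / (L * \<delta> z)) = ln (1 / \<delta> z) - ln L"
        using L \<delta>_pos[OF z(1)] by (simp add: ln_div ln_mult)
      ultimately show ?thesis by (simp add: F_def)
    qed
    ultimately show "ln (1 / \<delta> z) / 2 - (K + ln L / 2) \<le> kobayashi \<Omega> z x" by linarith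
  qed
qed

text \<open>One nearly minimal chain in \<open>\<Omega>\<close> serves all three claims: its
  localized steps remain in the component of \<open>z\<close>, the uniform bound on
  \<open>\<delta>\<close> gives the factor, and the summable decay of \<open>\<delta>\<close> gives
  the additive error.\<close>

lemma (in supported_point) localization:
  assumes dini: "dini_smooth_near \<Omega> p" and W: "open W" "ball p (R / 2) \<subseteq> W" and \<sigma>: "0 < \<sigma>"
  obtains \<eta> where "0 < \<eta>"
    "\<And>z w. z \<in> \<Omega> \<Longrightarrow> w \<in> \<Omega> \<Longrightarrow> dist p z < \<eta> \<Longrightarrow> dist p w < \<eta> \<Longrightarrow> connected_component (\<Omega> \<inter> W) z w \<and>
       kobayashi_comp (\<Omega> \<inter> W) z w \<le> (1 + \<sigma>) * kobayashi \<Omega> z w \<and>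
       kobayashi_comp (\<Omega> \<inter> W) z w \<le> kobayashi \<Omega> z w + \<sigma>"
proof -
  obtain C \<eta>1 where C: "0 < C" and \<eta>1: "0 < \<eta>1" "\<eta>1 \<le> R / 2"
    and loc: "\<And>q a b t. q \<in> frontier \<Omega> \<Longrightarrow> q \<in> ball p \<eta>1 \<Longrightarrow> a \<in> ball p (R / 2) \<Longrightarrow> disc_step \<Omega> a b t \<Longrightarrow>
       t < 1 - C * cmod (H q a) \<Longrightarrow> disc_step (\<Omega> \<inter> ball p (R / 2)) a b (t / (1 - C * cmod (H q a)))"
    using disc_step_localize by blast
  obtain \<eta>U where \<eta>U: "0 < \<eta>U"
    and upper: "\<And>z w. z \<in> \<Omega> \<Longrightarrow> w \<in> \<Omega> \<Longrightarrow> dist p z < \<eta>U \<Longrightarrow> dist p w < \<eta>U \<Longrightarrow>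
       kobayashi \<Omega> z w \<le> ln (1 / \<delta> z) / 2 + ln (1 / \<delta> w) / 2"
    using kobayashi_upper_bound_near[OF dom pfr dini, of 0] unfolding \<delta>_def by auto
  define B where "B = C * L"
  have B: "0 < B" using C L by (simp add: B_def)
  \<comment> \<open>The bound \<open>1 / (4 * B)\<close> keeps the loss of each step at most
    \<open>1/4\<close>, \<open>\<sigma> / (2 * B)\<close> serves the factor, and the square serves
    the additive error, whose total is at most \<open>2 * B * (16 * sqrt \<epsilon>)\<close> plus
    terms that vanish with \<open>\<tau>\<close>.\<close>
  define \<epsilon> where "\<epsilon> = min (min (min (R / 2) (\<eta>1 / 2)) (min \<eta>U (1 / (4 * B)))) (min (\<sigma> / (2 * B)) ((\<sigma> / (32 * B))\<^sup>2))"
  have \<epsilon>: "0 < \<epsilon>" "\<epsilon> \<le> R / 2" "\<epsilon> \<le> \<eta>1 / 2" "\<epsilon> \<le> \<eta>U" "\<epsilon> \<le> 1 / (4 * B)" "\<epsilon> \<le> \<sigma> / (2 * B)" "\<epsilon> \<le> (\<sigma> / (32 * B))\<^sup>2"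
    using R \<eta>1 \<eta>U B \<sigma> by (auto simp: \<epsilon>_def)
  have B\<epsilon>: "B * \<epsilon> \<le> 1 / 4" "2 * B * \<epsilon> \<le> \<sigma>" "32 * B * sqrt \<epsilon> \<le> \<sigma>"
  proof -
    show "B * \<epsilon> \<le> 1 / 4" "2 * B * \<epsilon> \<le> \<sigma>" using \<epsilon>(5,6) B by (simp_all add: field_simps)
    have "sqrt \<epsilon> \<le> sqrt ((\<sigma> / (32 * B))\<^sup>2)" using \<epsilon>(7) by (rule real_sqrt_le_mono)
    also have "\<dots> = \<sigma> / (32 * B)" using \<sigma> B by simp
    finally show "32 * B * sqrt \<epsilon> \<le> \<sigma>" using B by (simp add: field_simps)
  qed
  obtain C' \<eta>D where \<eta>D: "0 < \<eta>D"
    and lower: "\<And>z x. z \<in> \<Omega> \<Longrightarrow> dist p z < \<eta>D \<Longrightarrow> x \<in> \<Omega> \<Longrightarrow> \<epsilon> \<le> dist p x \<Longrightarrow> ln (1 / \<delta> z) / 2 - C' \<le> kobayashi \<Omega> z x"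
    by (rule kobayashi_lower_bound[OF \<epsilon>(1,2)]) blast
  obtain \<eta>M where \<eta>M: "0 < \<eta>M"
    and upperM: "\<And>z w. z \<in> \<Omega> \<Longrightarrow> w \<in> \<Omega> \<Longrightarrow> dist p z < \<eta>M \<Longrightarrow> dist p w < \<eta>M \<Longrightarrow>
       kobayashi \<Omega> z w \<le> ln (1 / \<delta> z) / 2 + ln (1 / \<delta> w) / 2 - (2 * C' + 1)"
    using kobayashi_upper_bound_near[OF dom pfr dini, of "2 * C' + 1"] unfolding \<delta>_def by auto
  define \<eta> where "\<eta> = min \<epsilon> (min \<eta>D \<eta>M)"
  show ?thesis
  proof (rule that[of \<eta>])
    show "0 < \<eta>" using \<epsilon> \<eta>D \<eta>M by (simp add: \<eta>_def)
    fix z w assume z: "z \<in> \<Omega>" "dist p z < \<eta>" and w: "w \<in> \<Omega>" "dist p w < \<eta>"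
    define D where "D = connected_component_set (\<Omega> \<inter> W) z"
    have zW: "z \<in> \<Omega> \<inter> W" using z W(2) \<epsilon>(2) by (auto simp: \<eta>_def)
    have zD: "z \<in> D" using zW by (simp add: D_def connected_component_refl_eq)
    have domD: "domain_set D"
    proof -
      have "open (\<Omega> \<inter> W)" using dom W(1) by (simp add: domain_set_def open_Int)
      then show ?thesis
        unfolding domain_set_def using zD by (auto simp only: D_def connected_connected_component open_connected_component)
    qed
    define k where "k = kobayashi \<Omega> z w"
    have key: "w \<in> D \<and> kobayashi D z w \<le> (1 + 2 * (B * \<epsilon> + \<tau>)) * (k + \<tau>) \<and>
        kobayashi D z w \<le> (1 + 2 * \<tau>) * (k + \<tau>) + \<sigma>" if \<tau>: "0 < \<tau>" "\<tau> \<le> 1 / 8" for \<tau>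
    proof -
      obtain \<Lambda> where \<Lambda>: "reach \<Omega> \<tau> z \<Lambda> w" "\<Lambda> \<le> k + \<tau>"
        using reach_near_kobayashi[OF dom z(1) w(1) \<tau>(1) \<tau>(1)] unfolding k_def by blast
      obtain N a t where a: "a 0 = z" "a N = w" and st: "\<And>i. i < N \<Longrightarrow> disc_step \<Omega> (a i) (a (Suc i)) (t i)"
        and t\<tau>: "\<And>i. i < N \<Longrightarrow> t i \<le> \<tau>" and \<Lambda>N: "\<Lambda> = (\<Sum>i<N. artanh (t i))"
        using reach_imp_sequence[OF \<Lambda>(1)] by blast
      have t0: "0 \<le> t i" if "i < N" for i using disc_step_imp(1)[OF st[OF that]] .
      define l where "l i = (if i < N then artanh (t i) else 0)" for i
      have l: "0 \<le> l i" "l i \<le> 1" for i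
      proof -
        have "0 \<le> artanh (t i) \<and> artanh (t i) \<le> 1" if "i < N"
        proof -
          have ti: "0 \<le> t i" "t i \<le> 1 / 8" using t0[OF that] t\<tau>[OF that] \<tau> by auto
          have "artanh (t i) \<le> t i / (1 - t i)" using ti by (intro artanh_le_fraction) auto
          also have "\<dots> \<le> 1" using ti by (simp add: field_simps)
          finally show ?thesis using ti by (simp add: artanh_nonneg)
        qed
        then show "0 \<le> l i" "l i \<le> 1" by (auto simp: l_def)
      qed
      define T where "T i = (\<Sum>m<i. l m)" for i
      have TSuc: "T (Suc i) = T i + l i" for i by (simp add: T_def)
      have TN: "T N = \<Lambda>" by (simp add: T_def \<Lambda>N l_def)
      have a\<Omega>: "a i \<in> \<Omega>" if "i \<le> N" for i
        using that disc_step_imp(3)[OF st, of i] w(1) a(2) by (cases "i = N") auto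
      have kd: "kobayashi \<Omega> (a i) (a j) \<le> T j - T i" if "i \<le> j" "j \<le> N" for i j
        using that
      proof (induction j rule: dec_induct)
        case base
        then show ?case using kobayashi_refl[OF dom a\<Omega>] by simp
      next
        case (step j)
        have "kobayashi \<Omega> (a i) (a (Suc j)) \<le> kobayashi \<Omega> (a i) (a j) + kobayashi \<Omega> (a j) (a (Suc j))"
          using step by (intro kobayashi_triangle[OF dom] a\<Omega>) auto
        moreover have "kobayashi \<Omega> (a j) (a (Suc j)) \<le> l j"
          using kobayashi_le_disc_step[OF dom st, of j] step by (simp add: l_def)
        ultimately show ?case using step by (simp add: TSuc)
      qed
      have T0: "T 0 = 0" by (simp add: T_def)
      \<comment> \<open>An excursion to distance \<open>\<epsilon>\<close> would cost at least both
        lower bounds together. That exceeds \<open>k\<close> by at least \<open>1\<close>, the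
        summand in \<open>2 * C' + 1\<close>, and so beats the tolerance
        \<open>\<tau>\<close>.\<close>
      have near: "dist p (a i) < \<epsilon>" if i: "i \<le> N" for i
      proof (rule ccontr)
        assume "\<not> dist p (a i) < \<epsilon>"
        then have far: "\<epsilon> \<le> dist p (a i)" by simp
        have "ln (1 / \<delta> z) / 2 - C' \<le> T i"
          using lower[OF z(1) _ a\<Omega>[OF i] far] z(2) kd[of 0 i] i a(1) T0 by (simp add: \<eta>_def)
        moreover have "ln (1 / \<delta> w) / 2 - C' \<le> T N - T i"
          using lower[OF w(1) _ a\<Omega>[OF i] far] w(2) kd[OF i] a(2) kobayashi_sym[OF dom w(1) a\<Omega>[OF i]]
          by (simp add: \<eta>_def)
        moreover have "k \<le> ln (1 / \<delta> z) / 2 + ln (1 / \<delta> w) / 2 - (2 * C' + 1)"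
          unfolding k_def using z w by (intro upperM) (auto simp: \<eta>_def)
        ultimately show False using TN \<Lambda>(2) \<tau> by linarith
      qed
      \<comment> \<open>Near minimality is inherited by sections: a saving of more than
        \<open>\<tau>\<close> between two points of the chain would be one for the whole
        chain.\<close>
      have nk: "\<bar>T i - T j\<bar> \<le> kobayashi \<Omega> (a i) (a j) + \<tau>" if ij: "i \<le> N" "j \<le> N" for i j
      proof -
        have *: "T j - T i \<le> kobayashi \<Omega> (a i) (a j) + \<tau>" if "i \<le> j" "j \<le> N" for i j
        proof -
          have i: "i \<le> N" using that by simp
          have "k \<le> kobayashi \<Omega> z (a i) + kobayashi \<Omega> (a i) w"
            unfolding k_def using z w i by (intro kobayashi_triangle[OF dom] a\<Omega>)
          moreover have "kobayashi \<Omega> (a i) w \<le> kobayashi \<Omega> (a i) (a j) + kobayashi \<Omega> (a j) w"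
            using w i that by (intro kobayashi_triangle[OF dom] a\<Omega>)
          moreover have "kobayashi \<Omega> z (a i) \<le> T i" using kd[of 0 i] i a(1) T0 by simp
          moreover have "kobayashi \<Omega> (a j) w \<le> T N - T j" using kd[of j N] that a(2) by simp
          ultimately show ?thesis using TN \<Lambda>(2) by linarith
        qed
        have mono: "T i \<le> T j" if "i \<le> j" for i j
          unfolding T_def using that l by (intro sum_mono2) auto
        show ?thesis
        proof (cases "i \<le> j")
          case True
          then show ?thesis using *[of i j] mono[of i j] ij by simp
        next
          case False
          then show ?thesis using *[of j i] mono[of j i] ij kobayashi_sym[OF dom a\<Omega>[OF ij(1)] a\<Omega>[OF ij(2)]] by simp
        qed
      qed
      have "Max ((\<lambda>i. \<delta> (a i)) ` {..N}) \<in> (\<lambda>i. \<delta> (a i)) ` {..N}" by (rule Max_in) auto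
      then obtain j where "Max ((\<lambda>i. \<delta> (a i)) ` {..N}) = \<delta> (a j)" "j \<in> {..N}" by (rule imageE)
      then have j: "j \<le> N" "\<delta> (a j) = Max ((\<lambda>i. \<delta> (a i)) ` {..N})" by auto
      have jmax: "\<delta> (a i) \<le> \<delta> (a j)" if "i \<le> N" for i unfolding j(2) using that by (intro Max_ge) auto
      have \<delta>0: "0 < \<delta> (a i)" if "i \<le> N" for i using \<delta>_pos[OF a\<Omega>[OF that]] .
      have \<delta>\<epsilon>: "\<delta> (a i) \<le> \<epsilon>" if "i \<le> N" for i using \<delta>_le[of "a i"] near[OF that] by simp
      let ?E = "\<lambda>i. exp (- \<bar>T i - T j\<bar> / 2)"
      \<comment> \<open>Since \<open>\<delta>\<close> is largest at \<open>a j\<close>, the upper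
        bound for the distance of \<open>a i\<close> and \<open>a j\<close> is at most
        \<open>- ln (\<delta> (a i))\<close>, whence \<open>\<delta> (a i)\<close> is at most
        \<open>exp (\<tau> - \<bar>T i - T j\<bar>)\<close>. The geometric mean with
        \<open>\<delta> (a i) \<le> \<epsilon>\<close> trades half of the decay for the small factor
        \<open>sqrt \<epsilon>\<close>.\<close>
      have decay: "\<delta> (a i) \<le> 2 * sqrt \<epsilon> * ?E i" if i: "i \<le> N" for i
      proof -
        have "kobayashi \<Omega> (a i) (a j) \<le> ln (1 / \<delta> (a i)) / 2 + ln (1 / \<delta> (a j)) / 2"
          using near[OF i] near[OF j(1)] \<epsilon>(4) by (intro upper a\<Omega> i j) auto
        moreover have "ln (\<delta> (a i)) \<le> ln (\<delta> (a j))"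
          using jmax[OF i] \<delta>0[OF i] by (intro ln_mono)
        moreover have "ln (1 / \<delta> (a i)) = - ln (\<delta> (a i))" "ln (1 / \<delta> (a j)) = - ln (\<delta> (a j))"
          using \<delta>0[OF i] \<delta>0[OF j(1)] by (simp_all add: ln_div)
        ultimately have "\<bar>T i - T j\<bar> \<le> - ln (\<delta> (a i)) + \<tau>"
          using nk[OF i j(1)] by linarith
        then have "ln (\<delta> (a i)) \<le> \<tau> - \<bar>T i - T j\<bar>" by linarith
        then have "\<delta> (a i) \<le> exp (\<tau> - \<bar>T i - T j\<bar>)"
          using \<delta>0[OF i] by (metis exp_le_cancel_iff exp_ln)
        also have "\<dots> = (exp (\<tau> / 2) * ?E i)\<^sup>2"
          by (simp add: power2_eq_square flip: exp_add)
        finally have "\<delta> (a i) \<le> (exp (\<tau> / 2) * ?E i)\<^sup>2" .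
        then have "sqrt (\<delta> (a i)) \<le> exp (\<tau> / 2) * ?E i"
          by (intro real_le_lsqrt) auto
        also have "exp (\<tau> / 2) \<le> 2"
        proof -
          have "exp (\<tau> / 2) \<le> 1 + \<tau> / 2 + (\<tau> / 2)\<^sup>2" using \<tau> by (intro exp_bound) auto
          also have "(\<tau> / 2)\<^sup>2 \<le> (1 / 2)\<^sup>2" using \<tau> by (intro power_mono) auto
          finally show ?thesis using \<tau> by (simp add: power2_eq_square)
        qed
        finally have s: "sqrt (\<delta> (a i)) \<le> 2 * ?E i" by simp
        have "\<delta> (a i) = sqrt (\<delta> (a i)) * sqrt (\<delta> (a i))" using \<delta>0[OF i] by simp
        also have "\<dots> \<le> sqrt \<epsilon> * (2 * ?E i)"
          using s \<delta>\<epsilon>[OF i] \<delta>0[OF i] \<epsilon>(1) by (intro mult_mono) auto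
        finally show ?thesis by (simp add: mult_ac)
      qed
      have stepD: "kobayashi D (a i) (a (Suc i)) \<le> (1 + 2 * (B * \<delta> (a i) + \<tau>)) * l i" "a (Suc i) \<in> D"
        if i: "i < N" and aD: "a i \<in> D" for i
      proof -
        have iN: "i \<le> N" using i by simp
        \<comment> \<open>The supporting function changes with \<open>i\<close>: taken at the
          boundary point nearest to \<open>a i\<close>, it is bounded there by
          \<open>L * \<delta> (a i)\<close>.\<close>
        obtain q where q: "q \<in> frontier \<Omega>" "dist q (a i) = \<delta> (a i)" "dist p q \<le> 2 * dist p (a i)"
          by (rule nearest[OF a\<Omega>[OF iN]])
        have q1: "q \<in> ball p \<eta>1" using q(3) near[OF iN] \<epsilon>(3) by simp
        have aR: "a i \<in> ball p (R / 2)" using near[OF iN] \<epsilon>(2) by simp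
        define x where "x = C * cmod (H q (a i))"
        have "cmod (H q (a i)) \<le> L * \<delta> (a i)"
          using H_lip[OF q(1), of "a i"] q1 \<eta>1 aR R q(2) by auto
        then have x: "0 \<le> x" "x \<le> B * \<delta> (a i)"
          using C by (auto simp: x_def B_def mult.assoc)
        have "B * \<delta> (a i) \<le> B * \<epsilon>" using \<delta>\<epsilon>[OF iN] B by simp
        then have x4: "x \<le> 1 / 4" using x B\<epsilon>(1) by simp
        have "disc_step (\<Omega> \<inter> ball p (R / 2)) (a i) (a (Suc i)) (t i / (1 - x))"
          unfolding x_def
          by (rule loc[OF q(1) q1 aR st[OF i]]) (use x4 t\<tau>[OF i] \<tau> in \<open>simp flip: x_def\<close>)
        then have sD: "disc_step D (a i) (a (Suc i)) (t i / (1 - x))"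
          unfolding D_def by (rule disc_step_component) (use W(2) aD in \<open>auto simp: D_def\<close>)
        then show "a (Suc i) \<in> D" by (rule disc_step_imp(4))
        have "kobayashi D (a i) (a (Suc i)) \<le> artanh (t i / (1 - x))"
          by (rule kobayashi_le_disc_step[OF domD sD])
        also have "\<dots> \<le> (1 + 2 * (x + \<tau>)) * artanh (t i)"
          using t0[OF i] t\<tau>[OF i] \<tau> x x4 by (intro artanh_rescale_le) auto
        also have "\<dots> \<le> (1 + 2 * (B * \<delta> (a i) + \<tau>)) * l i"
          using x i l(1)[of i] by (simp add: l_def mult_right_mono)
        finally show "kobayashi D (a i) (a (Suc i)) \<le> (1 + 2 * (B * \<delta> (a i) + \<tau>)) * l i" .
      qed
      have inD: "a i \<in> D \<and> kobayashi D z (a i) \<le> (\<Sum>m<i. (1 + 2 * (B * \<delta> (a m) + \<tau>)) * l m)" if "i \<le> N" for i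
        using that
      proof (induction i)
        case 0
        then show ?case using zD a(1) kobayashi_refl[OF domD zD] by simp
      next
        case (Suc i)
        then have IH: "a i \<in> D" "kobayashi D z (a i) \<le> (\<Sum>m<i. (1 + 2 * (B * \<delta> (a m) + \<tau>)) * l m)" by auto
        have iN: "i < N" using Suc.prems by simp
        have "kobayashi D z (a (Suc i)) \<le> kobayashi D z (a i) + kobayashi D (a i) (a (Suc i))"
          using stepD(2)[OF iN IH(1)] IH(1) zD by (intro kobayashi_triangle[OF domD])
        then show ?case using IH stepD[OF iN IH(1)] by simp
      qed
      have wD: "w \<in> D" and kw: "kobayashi D z w \<le> (\<Sum>m<N. (1 + 2 * (B * \<delta> (a m) + \<tau>)) * l m)"
        using inD[of N] a(2) by auto
      have sumT: "(\<Sum>m<N. l m) = \<Lambda>" using TN by (simp add: T_def)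
      have "(\<Sum>m<N. (1 + 2 * (B * \<delta> (a m) + \<tau>)) * l m) \<le> (\<Sum>m<N. (1 + 2 * (B * \<epsilon> + \<tau>)) * l m)"
        using \<delta>\<epsilon> B l(1) by (intro sum_mono mult_right_mono) auto
      also have "\<dots> = (1 + 2 * (B * \<epsilon> + \<tau>)) * \<Lambda>" by (simp add: sumT flip: sum_distrib_left)
      also have "\<dots> \<le> (1 + 2 * (B * \<epsilon> + \<tau>)) * (k + \<tau>)"
        using \<Lambda>(2) B \<epsilon>(1) \<tau>(1) by (intro mult_left_mono) (auto intro!: add_nonneg_nonneg)
      finally have ratio: "kobayashi D z w \<le> (1 + 2 * (B * \<epsilon> + \<tau>)) * (k + \<tau>)" using kw by linarith
      have "(\<Sum>m<N. (1 + 2 * (B * \<delta> (a m) + \<tau>)) * l m) = (1 + 2 * \<tau>) * \<Lambda> + 2 * B * (\<Sum>m<N. \<delta> (a m) * l m)"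
        by (simp add: algebra_simps sum.distrib sum_distrib_left flip: sumT)
      moreover have "(\<Sum>m<N. \<delta> (a m) * l m) \<le> (\<Sum>m<N. 2 * sqrt \<epsilon> * (?E m * l m))"
        using decay l(1) by (intro sum_mono) (simp add: mult_right_mono flip: mult.assoc)
      moreover have "\<dots> = 2 * sqrt \<epsilon> * (\<Sum>m<N. ?E m * l m)" by (simp add: sum_distrib_left)
      moreover have "\<dots> \<le> 2 * sqrt \<epsilon> * 8"
        using exponential_chain_sum_le[of l j N] l \<epsilon>(1) unfolding T_def by (intro mult_left_mono) auto
      ultimately have "kobayashi D z w \<le> (1 + 2 * \<tau>) * \<Lambda> + 2 * B * (16 * sqrt \<epsilon>)"
        using kw B mult_left_mono[of "(\<Sum>m<N. \<delta> (a m) * l m)" "16 * sqrt \<epsilon>" "2 * B"] by linarith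
      also have "\<dots> \<le> (1 + 2 * \<tau>) * (k + \<tau>) + \<sigma>"
        using \<Lambda>(2) \<tau>(1) B\<epsilon>(3) by (intro add_mono mult_left_mono) (auto simp: mult_ac)
      finally show ?thesis using wD ratio by blast
    qed
    have k0: "0 \<le> k" unfolding k_def using kobayashi_nonneg[OF dom z(1) w(1)] .
    have wD: "w \<in> D" using key[of "1 / 8"] by simp
    have "kobayashi D z w \<le> (1 + 2 * (B * \<epsilon>)) * k"
    proof (rule le_of_approx[of "1 / 8" _ _ "1 + 2 * (B * \<epsilon>) + 2 * (k + 1)"])
      fix \<tau> :: real assume \<tau>: "0 < \<tau>" "\<tau> \<le> 1 / 8"
      have "\<tau> * \<tau> \<le> \<tau> * 1" using \<tau> by (intro mult_left_mono) auto
      then have "(1 + 2 * (B * \<epsilon> + \<tau>)) * (k + \<tau>) \<le> (1 + 2 * (B * \<epsilon>)) * k + \<tau> * (1 + 2 * (B * \<epsilon>) + 2 * (k + 1))"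
        by (simp add: algebra_simps)
      then show "kobayashi D z w \<le> (1 + 2 * (B * \<epsilon>)) * k + \<tau> * (1 + 2 * (B * \<epsilon>) + 2 * (k + 1))"
        using key[OF \<tau>] by linarith
    qed simp
    also have "\<dots> \<le> (1 + \<sigma>) * k" using B\<epsilon>(2) k0 by (intro mult_right_mono) auto
    finally have r: "kobayashi D z w \<le> (1 + \<sigma>) * k" .
    have d: "kobayashi D z w \<le> k + \<sigma>"
    proof (rule le_of_approx[of "1 / 8" _ _ "1 + 2 * (k + 1)"])
      fix \<tau> :: real assume \<tau>: "0 < \<tau>" "\<tau> \<le> 1 / 8"
      have "\<tau> * \<tau> \<le> \<tau> * 1" using \<tau> by (intro mult_left_mono) auto
      then have "(1 + 2 * \<tau>) * (k + \<tau>) + \<sigma> \<le> k + \<sigma> + \<tau> * (1 + 2 * (k + 1))"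
        by (simp add: algebra_simps)
      then show "kobayashi D z w \<le> k + \<sigma> + \<tau> * (1 + 2 * (k + 1))"
        using key[OF \<tau>] by linarith
    qed simp
    show "connected_component (\<Omega> \<inter> W) z w \<and>
       kobayashi_comp (\<Omega> \<inter> W) z w \<le> (1 + \<sigma>) * kobayashi \<Omega> z w \<and>
       kobayashi_comp (\<Omega> \<inter> W) z w \<le> kobayashi \<Omega> z w + \<sigma>"
      using wD r d by (simp add: D_def k_def kobayashi_comp_def)
  qed
qed

section \<open>Monotonicity, positivity and the two limits\<close>

lemma kobayashi_antimono:
  assumes X: "domain_set X" and Y: "domain_set Y" and sub: "X \<subseteq> Y" and xy: "x \<in> X" "y \<in> X"
  shows "kobayashi Y x y \<le> kobayashi X x y"
proof (rule le_kobayashiI[OF X _ _ xy])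
  show "pseudodistance_on X (kobayashi Y)"
    using kobayashi_candidate_kobayashi[OF Y] sub
    unfolding kobayashi_candidate_def pseudodistance_on_def by (meson subsetD)
  show "kobayashi Y u v \<le> artanh t" if "disc_step X u v t" for u v t
    by (rule kobayashi_le_disc_step[OF Y disc_step_mono[OF that sub]])
qed

text \<open>A multiple of the Euclidean distance is a pseudodistance below the Lempert function:
  apply the Schwarz lemma to the component of the disc in the direction
  \<open>v - u\<close>.\<close>

lemma kobayashi_pos_bounded:
  fixes X :: "(complex^'n) set"
  assumes X: "domain_set X" and bd: "bounded X" and xy: "x \<in> X" "y \<in> X" "x \<noteq> y"
  shows "0 < kobayashi X x y"
proof -
  obtain M where M: "0 < M" "\<And>x. x \<in> X \<Longrightarrow> norm x \<le> M" using bd by (auto simp: bounded_pos)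
  define K where "K = 2 * M + 1"
  have K: "0 < K" using M by (simp add: K_def)
  have "dist x y / K \<le> kobayashi X x y"
  proof (rule le_kobayashiI[OF X _ _ xy(1,2)])
    show "pseudodistance_on X (\<lambda>x y. dist x y / K)"
      unfolding pseudodistance_on_def using K
      by (auto simp: dist_commute add_divide_distrib[symmetric] intro!: divide_right_mono dist_triangle)
    fix u v t assume step: "disc_step X u v t"
    then obtain \<phi> \<alpha> where \<phi>: "analytic_disc X \<phi>" "\<phi> 0 = u" "\<phi> \<alpha> = v" "cmod \<alpha> = t" "t < 1"
      by (auto simp: disc_step_def)
    define f where "f \<zeta> = cdot (v - u) (\<phi> \<zeta> - u)" for \<zeta>
    have uX: "u \<in> X" using disc_step_imp(3)[OF step] .
    have "dist u v / K \<le> t"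
    proof (cases "u = v")
      case True
      then show ?thesis using disc_step_imp(1)[OF step] by simp
    next
      case False
      have n: "0 < norm (v - u)" using False by simp
      have "cmod (f \<alpha>) \<le> (norm (v - u) * K) * cmod \<alpha> / 1"
      proof (rule Schwarz_Lemma_ball)
        show "f holomorphic_on ball 0 1"
          using \<phi>(1) unfolding f_def cdot_def analytic_disc_def by (auto intro!: holomorphic_intros)
        show "f 0 = 0" by (simp add: f_def \<phi>(2) cdot_def)
        show "0 < norm (v - u) * K" using n K by simp
        show "cmod (f \<zeta>) < norm (v - u) * K" if "cmod \<zeta> < 1" for \<zeta>
        proof -
          have "\<phi> \<zeta> \<in> X" using \<phi>(1) that by (auto simp: analytic_disc_def)
          then have "norm (\<phi> \<zeta> - u) < K"
            using M(2)[OF uX] M(2)[of "\<phi> \<zeta>"] norm_triangle_ineq4[of "\<phi> \<zeta>" u] by (simp add: K_def)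
          then have "norm (v - u) * norm (\<phi> \<zeta> - u) < norm (v - u) * K" using n by simp
          then show ?thesis using norm_cdot_le[of "v - u" "\<phi> \<zeta> - u"] by (simp add: f_def)
        qed
      qed (use \<phi> in auto)
      moreover have "cmod (f \<alpha>) = norm (v - u) * norm (v - u)"
        by (simp add: f_def \<phi>(3) cdot_self norm_power power2_eq_square norm_mult)
      ultimately have "norm (v - u) \<le> K * t" using n \<phi>(4) by simp
      then show ?thesis using K by (simp add: dist_norm norm_minus_commute pos_divide_le_eq mult.commute)
    qed
    also have "t \<le> artanh t" using disc_step_imp[OF step] by (intro le_artanh)
    finally show "dist u v / K \<le> artanh t" .
  qed
  moreover have "0 < dist x y / K" using xy(3) K by simp
  ultimately show ?thesis by linarith
qed

theorem corollary10:
  fixes \<Omega> U :: "(complex^'n) set" and p :: "complex^'n"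
  assumes "domain_set \<Omega>"
    and "p \<in> frontier \<Omega>"
    and "C_strictly_convexifiable_point \<Omega> p"
    and "dini_smooth_near \<Omega> p"
    and "open U" and "p \<in> U"
  shows "((\<lambda>(z, w). kobayashi_comp (\<Omega> \<inter> U) z w / kobayashi \<Omega> z w) \<longlongrightarrow> 1)
           (at (p, p) within {(z, w). connected_component (\<Omega> \<inter> U) z w \<and> z \<noteq> w})
       \<and> ((\<lambda>(z, w). kobayashi_comp (\<Omega> \<inter> U) z w - kobayashi \<Omega> z w) \<longlongrightarrow> 0)
           (at (p, p) within {(z, w). connected_component (\<Omega> \<inter> U) z w})"
proof -
  let ?K = "kobayashi_comp (\<Omega> \<inter> U)" and ?k = "kobayashi \<Omega>"
  note \<Omega> = assms(1)
  obtain R L and H :: "complex^'n \<Rightarrow> complex^'n \<Rightarrow> complex" where R: "0 < R" and RU: "ball p R \<subseteq> U" and sp: "supported_point \<Omega> p R L H"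
  proof (rule supporting_functions_exist[OF assms(3,5,6)], goal_cases)
    case (1 R L H)
    have "supported_point \<Omega> p R L H"
      by (rule supported_point.intro[OF assms(1,2) 1(2,3)]) (use 1(5-8) in blast)+
    then show ?case using 1 by blast
  qed
  interpret supported_point \<Omega> p R L H by (rule sp)
  have WU: "ball p (R / 2) \<subseteq> U" using RU R by auto
  \<comment> \<open>Monotonicity gives the lower bounds \<open>1\<close> for the ratio and
    \<open>0\<close> for the difference, so only upper bounds depend on the localization.\<close>
  have comp_ge: "kobayashi \<Omega> z w \<le> kobayashi_comp (\<Omega> \<inter> V) z w \<and> z \<in> \<Omega> \<and> w \<in> \<Omega>"
    if V: "open V" and con: "connected_component (\<Omega> \<inter> V) z w" for V z w
  proof -
    let ?D = "connected_component_set (\<Omega> \<inter> V) z"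
    have D: "z \<in> ?D" "w \<in> ?D" "?D \<subseteq> \<Omega>"
      using con connected_component_in[OF con] connected_component_subset[of "\<Omega> \<inter> V" z] connected_component_refl
      by auto
    have "open (\<Omega> \<inter> V)" using \<Omega> V by (simp add: domain_set_def open_Int)
    then have dD: "domain_set ?D"
      unfolding domain_set_def using D by (metis connected_connected_component empty_iff open_connected_component)
    show ?thesis
      unfolding kobayashi_comp_def
      using kobayashi_antimono[OF dD \<Omega> D(3,1,2)] D by auto
  qed
  \<comment> \<open>Here the localization is applied to the bounded set
    \<open>\<Omega> \<inter> ball p (R / 2)\<close> with \<open>\<sigma> = 1\<close>: twice the
    distance in \<open>\<Omega>\<close> dominates the distance in a bounded component, which
    separates points.\<close>
  have pos: "\<exists>\<eta>>0. \<forall>z w. z \<in> \<Omega> \<longrightarrow> w \<in> \<Omega> \<longrightarrow> dist p z < \<eta> \<longrightarrow> dist p w < \<eta> \<longrightarrow> z \<noteq> w \<longrightarrow> 0 < kobayashi \<Omega> z w"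
  proof -
    obtain \<eta> where \<eta>: "0 < \<eta>" and loc: "\<And>z w. z \<in> \<Omega> \<Longrightarrow> w \<in> \<Omega> \<Longrightarrow> dist p z < \<eta> \<Longrightarrow> dist p w < \<eta> \<Longrightarrow> connected_component (\<Omega> \<inter> ball p (R / 2)) z w \<and>
       kobayashi_comp (\<Omega> \<inter> ball p (R / 2)) z w \<le> (1 + 1) * kobayashi \<Omega> z w"
      using localization[OF assms(4), of "ball p (R / 2)" 1] by (metis open_ball order_refl zero_less_one)
    have "0 < kobayashi \<Omega> z w" if zw: "z \<in> \<Omega>" "w \<in> \<Omega>" "dist p z < \<eta>" "dist p w < \<eta>" "z \<noteq> w" for z w
    proof -
      let ?D = "connected_component_set (\<Omega> \<inter> ball p (R / 2)) z"
      have con: "connected_component (\<Omega> \<inter> ball p (R / 2)) z w" using loc zw by blast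
      have D: "z \<in> ?D" "w \<in> ?D"
        using con connected_component_in[OF con] connected_component_refl by auto
      have "open (\<Omega> \<inter> ball p (R / 2))" using \<Omega> by (simp add: domain_set_def open_Int)
      then have dD: "domain_set ?D"
        unfolding domain_set_def using D by (metis connected_connected_component empty_iff open_connected_component)
      have "bounded ?D"
        using connected_component_subset[of "\<Omega> \<inter> ball p (R / 2)" z] bounded_ball[of p "R / 2"]
        by (auto intro: bounded_subset)
      from kobayashi_pos_bounded[OF dD this D zw(5)] loc[OF zw(1-4)]
      show ?thesis by (simp add: kobayashi_comp_def)
    qed
    then show ?thesis using \<eta> by blast
  qed
  have near: "\<exists>\<eta>>0. \<forall>z w. connected_component (\<Omega> \<inter> U) z w \<longrightarrow> dist (z, w) (p, p) < \<eta> \<longrightarrow>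
      z \<in> \<Omega> \<and> w \<in> \<Omega> \<and> ?k z w \<le> ?K z w \<and>
      ?K z w \<le> (1 + \<sigma>) * ?k z w \<and>
      ?K z w \<le> ?k z w + \<sigma> \<and> (z \<noteq> w \<longrightarrow> 0 < ?k z w)"
    if \<sigma>: "0 < \<sigma>" for \<sigma>
  proof -
    obtain \<eta>1 where \<eta>1: "0 < \<eta>1" "\<And>z w. z \<in> \<Omega> \<Longrightarrow> w \<in> \<Omega> \<Longrightarrow> dist p z < \<eta>1 \<Longrightarrow> dist p w < \<eta>1 \<Longrightarrow> connected_component (\<Omega> \<inter> U) z w \<and>
       ?K z w \<le> (1 + \<sigma>) * ?k z w \<and>
       ?K z w \<le> ?k z w + \<sigma>"
      by (rule localization[OF assms(4,5) WU \<sigma>]) blast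
    obtain \<eta>2 where \<eta>2: "0 < \<eta>2" "\<And>z w. z \<in> \<Omega> \<Longrightarrow> w \<in> \<Omega> \<Longrightarrow> dist p z < \<eta>2 \<Longrightarrow> dist p w < \<eta>2 \<Longrightarrow> z \<noteq> w \<Longrightarrow> 0 < ?k z w"
      using pos by blast
    show ?thesis
    proof (intro exI[of _ "min \<eta>1 \<eta>2"] conjI allI impI)
      show "0 < min \<eta>1 \<eta>2" using \<eta>1 \<eta>2 by simp
      fix z w assume con: "connected_component (\<Omega> \<inter> U) z w" and d: "dist (z, w) (p, p) < min \<eta>1 \<eta>2"
      have dz: "dist p z < min \<eta>1 \<eta>2" "dist p w < min \<eta>1 \<eta>2"
        using dist_fst_le[of "(z, w)" "(p, p)"] dist_snd_le[of "(z, w)" "(p, p)"] d by (auto simp: dist_commute)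
      note N = comp_ge[OF assms(5) con]
      show "z \<in> \<Omega>" "w \<in> \<Omega>" "?k z w \<le> ?K z w" using N by auto
      show "?K z w \<le> (1 + \<sigma>) * ?k z w"
        "?K z w \<le> ?k z w + \<sigma>"
        using \<eta>1(2)[of z w] N dz by auto
      show "0 < ?k z w" if "z \<noteq> w" using \<eta>2(2)[of z w] N dz that by auto
    qed
  qed
  show ?thesis
  proof
    show "((\<lambda>(z, w). ?K z w / ?k z w) \<longlongrightarrow> 1)
           (at (p, p) within {(z, w). connected_component (\<Omega> \<inter> U) z w \<and> z \<noteq> w})"
    proof (rule tendstoI)
      fix e :: real assume e: "0 < e"
      obtain \<eta> where \<eta>: "0 < \<eta>" "\<And>z w. connected_component (\<Omega> \<inter> U) z w \<Longrightarrow> dist (z, w) (p, p) < \<eta> \<Longrightarrow> z \<noteq> w \<Longrightarrow>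
          ?k z w \<le> ?K z w \<and>
          ?K z w \<le> (1 + e / 2) * ?k z w \<and> 0 < ?k z w"
        using near[of "e / 2"] e by (meson half_gt_zero)
      have "dist (?K z w / ?k z w) 1 < e"
        if "connected_component (\<Omega> \<inter> U) z w" "dist (z, w) (p, p) < \<eta>" "z \<noteq> w" for z w
      proof -
        have "1 \<le> ?K z w / ?k z w"
          "?K z w / ?k z w \<le> 1 + e / 2"
          using \<eta>(2)[OF that] by (auto simp: pos_divide_le_eq)
        then show ?thesis using e by (simp add: dist_real_def)
      qed
      then show "\<forall>\<^sub>F x in at (p, p) within {(z, w). connected_component (\<Omega> \<inter> U) z w \<and> z \<noteq> w}.
          dist (case x of (z, w) \<Rightarrow> ?K z w / ?k z w) 1 < e"
        unfolding eventually_at using \<eta>(1) by (intro exI[of _ \<eta>]) auto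
    qed
    show "((\<lambda>(z, w). ?K z w - ?k z w) \<longlongrightarrow> 0)
           (at (p, p) within {(z, w). connected_component (\<Omega> \<inter> U) z w})"
    proof (rule tendstoI)
      fix e :: real assume e: "0 < e"
      obtain \<eta> where \<eta>: "0 < \<eta>" "\<And>z w. connected_component (\<Omega> \<inter> U) z w \<Longrightarrow> dist (z, w) (p, p) < \<eta> \<Longrightarrow>
          ?k z w \<le> ?K z w \<and>
          ?K z w \<le> ?k z w + e / 2"
        using near[of "e / 2"] e by (meson half_gt_zero)
      have "dist (?K z w - ?k z w) 0 < e"
        if "connected_component (\<Omega> \<inter> U) z w" "dist (z, w) (p, p) < \<eta>" for z w
        using \<eta>(2)[OF that] e by (auto simp: dist_real_def)
      then show "\<forall>\<^sub>F x in at (p, p) within {(z, w). connected_component (\<Omega> \<inter> U) z w}.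
          dist (case x of (z, w) \<Rightarrow> ?K z w - ?k z w) 0 < e"
        unfolding eventually_at using \<eta>(1) by (intro exI[of _ \<eta>]) auto
    qed
  qed
qed

end
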